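(* Let $\boldsymbol t=0.0110\,1001\,1001\,0110\ldots$ (binary) be the Thue–Morse constant and let $P_\infty$ be the open hexagon $$P_\infty=\{(x,y)\in[0,1]^2:\ 2x-1<y<2x,\ \ 2-4x<y<3-4x,\ \ \boldsymbol t<x<1-\boldsymbol t\}.$$ Then $P_\infty$ is a dimension trap for the baker's map, i.e. $\dim_{\mathrm H}\mathcal J(P_\infty)=0$.
   Context: The Thue–Morse word $t_0t_1t_2\dots$ is given by $t_0=0$, $t_{2m}=t_m$, $t_{2m+1}=1-t_m$, and $\boldsymbol t=\sum_{i\ge0}t_i2^{-i-1}\approx0.41245$. Let $X=[0,1]^2$. The baker's map is $B(x,y)=(2x,\frac y2)$ if $0\le x<\frac12$ and $B(x,y)=(2x-1,\frac{y+1}2)$ if $\frac12\le x<1$. For a bi-infinite sequence $u=(x_n)_{n\in\mathbb Z}\in\{0,1\}^{\mathbb Z}$, written $\dots x_{-1}x_0\cdot x_1x_2\dots$, put $\pi(u)=\left(\sum_{n\ge1}x_n2^{-n},\ \sum_{n\ge0}x_{-n}2^{-n-1}\right)$. The map $\pi$ conjugates the left shift $\sigma$ and $B$; points and sequences are used interchangeably, so the $B$-orbit of the point $\pi(u)$ is $(\pi(\sigma^n u))_{n\in\mathbb Z}$. For $H\subset X$ the survivor set is $\mathcal J(H)=\{(x,y)\in X: B^n(x,y)\notin H \text{ for all } n\in\mathbb Z\}$, i.e. $\mathcal J(H)=\{\pi(u): \pi(\sigma^nu)\notin H\ \text{for all } n\in\mathbb Z\}$. An open set $H$ is a dimension trap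 if $\dim_{\mathrm H}\mathcal J(H)=0$ (Hausdorff dimension). *)

theory Defs
  imports "HOL-Analysis.Analysis"
begin

section \<open>Hausdorff measure and Hausdorff dimension\<close>

text \<open>
  The quantity \<open>(diam U)\<^sup>s\<close> with the conventions that the empty set contributes 0 and that a
  nonempty set contributes 1 when \<open>s = 0\<close>, so that the 0-dimensional measure is counting measure
  (in the library \<open>0 powr 0 = 0\<close>).
\<close>

definition diam_pow :: "real \<Rightarrow> 'a::metric_space set \<Rightarrow> ennreal" where
  "diam_pow s U = (if U = {} then 0 else if s = 0 then 1 else ennreal (diameter U powr s))"

text \<open>
  Boundedness is required explicitly because the real-valued \<open>diameter\<close> is unspecified on
  unbounded sets.
\<close>

definition hausdorff_premeasure :: "real \<Rightarrow> real \<Rightarrow> 'a::metric_space set \<Rightarrow> ennreal" where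
  "hausdorff_premeasure s \<delta> A =
     (INF U \<in> {U :: nat \<Rightarrow> 'a set.
         A \<subseteq> (\<Union>i. U i) \<and> (\<forall>i. bounded (U i) \<and> diameter (U i) \<le> \<delta>)}.
       \<Sum>i. diam_pow s (U i))"

definition hausdorff_measure :: "real \<Rightarrow> 'a::metric_space set \<Rightarrow> ennreal" where
  "hausdorff_measure s A = (SUP \<delta> \<in> {0<..}. hausdorff_premeasure s \<delta> A)"

text \<open>Extended-valued, so that the infimum over an empty set of exponents is \<open>\<infinity>\<close>.\<close>

definition hausdorff_dim :: "'a::metric_space set \<Rightarrow> ennreal" where
  "hausdorff_dim A = (INF s \<in> {s. 0 \<le> s \<and> hausdorff_measure s A = 0}. ennreal s)"


section \<open>The baker's map and its symbolic coding\<close>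

definition unit_square :: "(real \<times> real) set" where
  "unit_square = {0..1} \<times> {0..1}"

text \<open>On the edge \<open>x = 1\<close> the second branch is used; the map is usually defined for \<open>x < 1\<close> only.\<close>

definition baker :: "real \<times> real \<Rightarrow> real \<times> real" where
  "baker = (\<lambda>(x, y). if x < 1/2 then (2 * x, y / 2) else (2 * x - 1, (y + 1) / 2))"

definition bi_sequences :: "(int \<Rightarrow> nat) set" where
  "bi_sequences = {u. \<forall>n. u n \<in> {0, 1}}"

text \<open>\<open>shift n\<close> is the \<open>n\<close>-th iterate of the left shift, for any integer \<open>n\<close>.\<close>

definition shift :: "int \<Rightarrow> (int \<Rightarrow> nat) \<Rightarrow> (int \<Rightarrow> nat)" where
  "shift n u = (\<lambda>k. u (k + n))"

text \<open>
  The first sum is \<open>\<Sum>\<^sub>n\<^sub>\<ge>\<^sub>1 x\<^sub>n 2\<^sup>-\<^sup>n\<close>, reindexed from 0.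
\<close>

definition coding :: "(int \<Rightarrow> nat) \<Rightarrow> real \<times> real" where
  "coding u = (\<Sum>n. real (u (int n + 1)) / 2 ^ (n + 1), \<Sum>n. real (u (- int n)) / 2 ^ (n + 1))"

text \<open>
  The orbit of a point is the one given by its coding sequence. This fixes the meaning of
  \<open>B\<^sup>n\<close> for negative \<open>n\<close>, and of orbits at points with more than one binary expansion.
\<close>

definition survivor_set :: "(real \<times> real) set \<Rightarrow> (real \<times> real) set" where
  "survivor_set H = {coding u | u. u \<in> bi_sequences \<and> (\<forall>n::int. coding (shift n u) \<notin> H)}"

definition dimension_trap :: "(real \<times> real) set \<Rightarrow> bool" where
  "dimension_trap H \<longleftrightarrow>
     openin (top_of_set unit_square) H \<and> hausdorff_dim (survivor_set H) = 0"

lemma summable_digits: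
  fixes f :: "nat \<Rightarrow> nat"
  assumes "\<And>n. f n \<in> {0, 1}"
  shows "summable (\<lambda>n. real (f n) / 2 ^ (n + 1))"
proof (rule summable_comparison_test)
  show "\<exists>N. \<forall>n\<ge>N. norm (real (f n) / 2 ^ (n + 1)) \<le> (1/2) ^ n"
  proof (intro exI[of _ 0] allI impI)
    fix n
    have "f n = 0 \<or> f n = 1" using assms[of n] by auto
    then show "norm (real (f n) / 2 ^ (n + 1)) \<le> (1/2) ^ n"
      by (auto simp: power_divide divide_simps)
  qed
  show "summable (\<lambda>n. (1/2 :: real) ^ n)" by (simp add: summable_geometric)
qed

lemma digits_sum_split:
  fixes f :: "nat \<Rightarrow> nat"
  assumes "\<And>n. f n \<in> {0, 1}"
  shows "(\<Sum>n. real (f n) / 2 ^ (n + 1)) =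
         (real (f 0) + (\<Sum>n. real (f (Suc n)) / 2 ^ (n + 1))) / 2"
proof -
  have s: "summable (\<lambda>n. real (f (Suc n)) / 2 ^ (n + 1))"
    using summable_digits[of "\<lambda>n. f (Suc n)"] assms by simp
  have "(\<Sum>n. real (f (Suc n)) / 2 ^ (Suc n + 1)) =
        (\<Sum>n. (real (f (Suc n)) / 2 ^ (n + 1)) / 2)"
    by (intro suminf_cong) (simp add: field_simps)
  also have "\<dots> = (\<Sum>n. real (f (Suc n)) / 2 ^ (n + 1)) / 2"
    using suminf_divide[OF s, of 2] by simp
  finally have "(\<Sum>n. real (f (Suc n)) / 2 ^ (Suc n + 1)) =
    (\<Sum>n. real (f (Suc n)) / 2 ^ (n + 1)) / 2" .
  moreover have "(\<Sum>n. real (f (Suc n)) / 2 ^ (Suc n + 1)) =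
    (\<Sum>n. real (f n) / 2 ^ (n + 1)) - real (f 0) / 2"
    using suminf_split_head[OF summable_digits, of f] assms by simp
  ultimately show ?thesis by argo
qed

text \<open>
  The coding conjugates the left shift and the baker's map. The excluded case is the expansion
  \<open>x = 0.0111\<dots>\<close> of 1/2, whose shift follows the other branch of the map.
\<close>

lemma baker_coding:
  assumes u: "u \<in> bi_sequences" and "u 1 = 1 \<or> fst (coding u) \<noteq> 1/2"
  shows "baker (coding u) = coding (shift 1 u)"
proof -
  have d: "u k \<in> {0, 1}" for k using u by (simp add: bi_sequences_def)
  let ?x = "\<Sum>n. real (u (int n + 1)) / 2 ^ (n + 1)"
  let ?x' = "\<Sum>n. real (u (int n + 1 + 1)) / 2 ^ (n + 1)"
  let ?y = "\<Sum>n. real (u (- int n)) / 2 ^ (n + 1)"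
  let ?y' = "\<Sum>n. real (u (- int n + 1)) / 2 ^ (n + 1)"
  have x: "?x = (real (u 1) + ?x') / 2"
    using digits_sum_split[of "\<lambda>n. u (int n + 1)"] d by (simp add: add_ac)
  have y: "?y' = (real (u 1) + ?y) / 2"
    using digits_sum_split[of "\<lambda>n. u (- int n + 1)"] d by simp
  have sx: "summable (\<lambda>n. real (u (int n + 1 + 1)) / 2 ^ (n + 1))"
    using summable_digits[of "\<lambda>n. u (int n + 1 + 1)"] d by simp
  have x'0: "0 \<le> ?x'" by (rule suminf_nonneg[OF sx]) simp
  have half: "(\<lambda>n. 1 / 2 ^ (n + 1) :: real) sums 1"
    using power_half_series by (simp add: power_divide)
  have "?x' \<le> (\<Sum>n. 1 / 2 ^ (n + 1))"
  proof (rule suminf_le[OF _ sx sums_summable[OF half]])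
    fix n
    have "u (int n + 1 + 1) = 0 \<or> u (int n + 1 + 1) = 1" using d by blast
    then show "real (u (int n + 1 + 1)) / 2 ^ (n + 1) \<le> 1 / 2 ^ (n + 1)"
      by (auto simp: divide_simps)
  qed
  then have x'1: "?x' \<le> 1" using sums_unique[OF half] by simp
  have c: "coding u = (?x, ?y)" "coding (shift 1 u) = (?x', ?y')"
    by (simp_all add: coding_def shift_def)
  consider "u 1 = 1" | "u 1 = 0" "?x \<noteq> 1/2"
    using assms(2) d[of 1] c by auto
  then show ?thesis
  proof cases
    case 1
    then have "\<not> ?x < 1/2" using x x'0 by simp
    then have "baker (coding u) = (2 * ?x - 1, (?y + 1) / 2)"
      unfolding c baker_def by (simp only: case_prod_conv if_False)
    also have "\<dots> = (?x', ?y')" using x y 1 by (simp only: prod.inject) (simp add: field_simps)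
    finally show ?thesis using c by simp
  next
    case 2
    have "?x \<le> 1/2" unfolding x using x'1 2(1) by simp
    then have "?x < 1/2" using 2(2) by (rule order.not_eq_order_implies_strict[rotated])
    then have "baker (coding u) = (2 * ?x, ?y / 2)"
      unfolding c baker_def by (simp only: case_prod_conv if_True)
    also have "\<dots> = (?x', ?y')" using x y 2 by (simp only: prod.inject) (simp add: field_simps)
    finally show ?thesis using c by simp
  qed
qed


section \<open>The Thue--Morse constant and the hexagon\<close>

fun thue_morse :: "nat \<Rightarrow> nat" where
  "thue_morse n =
     (if n = 0 then 0
      else if even n then thue_morse (n div 2)
      else 1 - thue_morse (n div 2))"

declare thue_morse.simps [simp del]

lemma thue_morse_rec:
  "thue_morse 0 = 0"
  "thue_morse (2 * m) = thue_morse m"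
  "thue_morse (2 * m + 1) = 1 - thue_morse m"
    apply (simp add: thue_morse.simps)
   apply (cases "m = 0"; simp add: thue_morse.simps[of "2 * m"])
  apply (subst thue_morse.simps, simp)
  done

definition thue_morse_const :: real where
  "thue_morse_const = (\<Sum>i. real (thue_morse i) / 2 ^ (i + 1))"

definition hexagon :: "(real \<times> real) set" where
  "hexagon = {(x, y). (x, y) \<in> unit_square \<and>
      2 * x - 1 < y \<and> y < 2 * x \<and> 2 - 4 * x < y \<and> y < 3 - 4 * x \<and>
      thue_morse_const < x \<and> x < 1 - thue_morse_const}"

end

theory Submission
  imports Defs
begin

text \<open>
  Call a position \<open>p\<close> of a bi-infinite word bad if the word to its right, written relative to the
  letter at \<open>p\<close>, exceeds the shifted Thue--Morse word \<open>1101001\<dots>\<close>; the vertical strip of the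
  hexagon says that \<open>p\<close> is bad. The slanted sides then say that, at every bad position of a
  surviving word, the word read to the left is at least as large as the one read to the right,
  after reflection at \<open>p\<close> or at the edge between \<open>p\<close> and \<open>p + 1\<close>. Hence each bad position has a
  bad predecessor that is at least as extreme, unless the word is eventually periodic to the left.
  Measuring extremality by a label from a set that becomes finite when large entries are
  identified, the labels along a chain of predecessors are eventually constant, and then the gaps
  in the chain are either determined or long; in both cases the number of words of length \<open>n\<close> is
  at most \<open>C c^n\<close> with \<open>c\<close> arbitrarily close to 1. A tail without bad positions is eventually
  periodic or an image of another such tail under the Thue--Morse substitution \<open>0 \<mapsto> 01, 1 \<mapsto> 10\<close>;
  iterating, its complexity is at most about \<open>2^(n / 2^k)\<close> for every \<open>k\<close>. So for each \<open>s > 0\<close> the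
  survivor set is a countable union of sets whose number of central words of length \<open>2n + 1\<close> grows
  more slowly than \<open>2^(s n)\<close>, and these have \<open>s\<close>-dimensional measure zero.
\<close>


section \<open>Bad positions and labels\<close>

text \<open>The sides of the hexagon come in pairs exchanged by
  \<open>(x, y) \<mapsto> (1 - x, 1 - y)\<close>, that is, by swapping the two letters, so one may
  assume that the letter at \<open>p\<close> is 0. If X and Y are the values of the words to the
  right and to the left of \<open>p\<close>, then \<open>x = X / 2\<close> and \<open>y = Y\<close>:
  the side \<open>y < 2 * x\<close> compares X with Y, and \<open>2 - 4 * x < y\<close> compares X
  with \<open>1 - Y / 2\<close>, the value of the word read leftwards from \<open>p + 1\<close>. The
  obstacle is that the distance to a predecessor is unbounded and that labels might keep growing
  along a chain. A cutoff K meets both: labels of size at least K are confused with each other, but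
  such a label at a predecessor forces a gap of length at least K, and long gaps contribute little
  growth; below K the label becomes constant and fixes the whole gap. K depends on the growth rate
  to be reached, so the survivor set is decomposed anew for each s. Since predecessors lie only to
  the left, left and right tails need different arguments.\<close>

definition lex_gt :: "(nat \<Rightarrow> bool) \<Rightarrow> (nat \<Rightarrow> bool) \<Rightarrow> bool" where
  "lex_gt f g \<longleftrightarrow> (\<exists>j. (\<forall>i<j. f i = g i) \<and> f j \<and> \<not> g j)"

definition rel_right :: "(int \<Rightarrow> bool) \<Rightarrow> int \<Rightarrow> nat \<Rightarrow> bool" where
  "rel_right u p i \<longleftrightarrow> u (p + 1 + int i) \<noteq> u p"

definition rel_left :: "(int \<Rightarrow> bool) \<Rightarrow> int \<Rightarrow> nat \<Rightarrow> bool" where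
  "rel_left u p i \<longleftrightarrow> u (p - 1 - int i) \<noteq> u p"

text \<open>The first letter is dropped because the letter at \<open>p\<close> has become the
  reference: for \<open>u p = 0\<close> the expansion of x starts with this 0, just as
  \<open>thue_morse\<close> does.\<close>

definition tm :: "nat \<Rightarrow> bool" where
  "tm i \<longleftrightarrow> thue_morse (i + 1) = 1"

definition bad :: "(int \<Rightarrow> bool) \<Rightarrow> int \<Rightarrow> bool" where
  "bad u p \<longleftrightarrow> lex_gt (rel_right u p) tm"

text \<open>The disjuncts are the two ways of leaving the hexagon across a slanted side. Stating
  them as negated strict comparisons admits equal words.\<close>

definition left_dominated :: "(int \<Rightarrow> bool) \<Rightarrow> bool" where
  "left_dominated u \<longleftrightarrow> (\<forall>p. bad u p \<longrightarrow>
     \<not> lex_gt (rel_right u p) (rel_left u p) \<or> \<not> lex_gt (rel_right u p) (rel_left u (p + 1)))"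

section \<open>The shifted Thue-Morse word and its prefixes\<close>

lemma thue_morse_le: "thue_morse n \<le> 1"
proof (induction n rule: less_induct)
  case (less n)
  show ?case
  proof (cases "n = 0")
    case False
    then show ?thesis using less[of "n div 2"] by (subst thue_morse.simps) auto
  qed (simp add: thue_morse.simps)
qed

lemma tm_rec: "tm 0" "tm (2 * j + 1) = tm j" "tm (2 * j + 2) = (\<not> tm j)"
proof -
  show "tm 0" using thue_morse_rec(3)[of 0] by (simp add: tm_def thue_morse_rec(1))
  show "tm (2 * j + 1) = tm j" using thue_morse_rec(2)[of "j + 1"] by (simp add: tm_def)
  show "tm (2 * j + 2) = (\<not> tm j)"
    using thue_morse_rec(3)[of "j + 1"] thue_morse_le[of "j + 1"] by (auto simp: tm_def)
qed

lemma tm_values: "tm 0" "tm (Suc 0)" "\<not> tm 2" "tm 3" "\<not> tm 4" "\<not> tm 5" "tm 6" "tm 7" "\<not> tm 8" "\<not> tm 9"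
  using tm_rec(1) tm_rec(2,3)[of 0] tm_rec(2,3)[of 1] tm_rec(2,3)[of 2] tm_rec(2,3)[of 3]
    tm_rec(2)[of 4] by (simp_all add: numeral_eq_Suc)

lemma less_numeral_iff:
  "(\<forall>i<2::nat. P i) \<longleftrightarrow> P 0 \<and> P 1"
  "(\<forall>i<4::nat. P i) \<longleftrightarrow> P 0 \<and> P 1 \<and> P 2 \<and> P 3"
  "(\<forall>i<5::nat. P i) \<longleftrightarrow> P 0 \<and> P 1 \<and> P 2 \<and> P 3 \<and> P 4"
  "(\<forall>i<8::nat. P i) \<longleftrightarrow> P 0 \<and> P 1 \<and> P 2 \<and> P 3 \<and> P 4 \<and> P 5 \<and> P 6 \<and> P 7"
  "(\<forall>i<9::nat. P i) \<longleftrightarrow> P 0 \<and> P 1 \<and> P 2 \<and> P 3 \<and> P 4 \<and> P 5 \<and> P 6 \<and> P 7 \<and> P 8"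
  by (auto simp: numeral_eq_Suc All_less_Suc)

text \<open>Each prefix leaves \<open>tm = 1101001100...\<close> at a place where \<open>tm\<close>
  has 0. The last one serves \<open>Sm 2\<close>: its block 110100 agrees with \<open>tm\<close>, so
  the letters at the next position of the chain have to decide.\<close>

lemma lex_gt_tm_prefix:
  "f 0 \<Longrightarrow> f 1 \<Longrightarrow> f 2 \<Longrightarrow> lex_gt f tm"
  "f 0 \<Longrightarrow> f 1 \<Longrightarrow> \<not> f 2 \<Longrightarrow> f 3 \<Longrightarrow> f 4 \<Longrightarrow> lex_gt f tm"
  "f 0 \<Longrightarrow> f 1 \<Longrightarrow> \<not> f 2 \<Longrightarrow> f 3 \<Longrightarrow> \<not> f 4 \<Longrightarrow> f 5 \<Longrightarrow> lex_gt f tm"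
  "f 0 \<Longrightarrow> f 1 \<Longrightarrow> \<not> f 2 \<Longrightarrow> f 3 \<Longrightarrow> \<not> f 4 \<Longrightarrow> \<not> f 5 \<Longrightarrow> f 6 \<Longrightarrow> f 7 \<Longrightarrow> f 8 \<or> f 9 \<Longrightarrow> lex_gt f tm"
     apply (simp_all only: lex_gt_def)
  subgoal by (rule exI[of _ 2]) (auto simp: less_numeral_iff tm_values)
  subgoal by (rule exI[of _ 4]) (auto simp: less_numeral_iff tm_values)
  subgoal by (rule exI[of _ 5]) (auto simp: less_numeral_iff tm_values)
  subgoal
    apply (cases "f 8")
    subgoal by (rule exI[of _ 8]) (auto simp: less_numeral_iff tm_values)
    subgoal by (rule exI[of _ 9]) (auto simp: less_numeral_iff tm_values)
    done
  done

lemma lex_gt_tm_cases: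
  assumes "lex_gt f tm"
  shows "f 0 \<and> f 1 \<and> (f 2 \<or> f 3)"
proof -
  obtain j where j: "\<forall>i<j. f i = tm i" "f j" "\<not> tm j" using assms by (auto simp: lex_gt_def)
  have "j \<noteq> 0" "j \<noteq> Suc 0" "j \<noteq> 3" using j(3) tm_values(1,2,4) by metis+
  then consider "j = 2" | "j > 3" by linarith
  then show ?thesis
  proof cases
    case 1 then show ?thesis using j tm_values by (auto simp: less_numeral_iff)
  next
    case 2 then have "\<forall>i<4. f i = tm i" using j(1) by auto
    then show ?thesis using tm_values by (auto simp: less_numeral_iff)
  qed
qed

text \<open>Dominance is exploited at the first disagreement, where the dominating word must carry
  the 1.\<close>

lemma not_lex_gt_first_diff:
  assumes "\<not> lex_gt f g" "\<And>i. i < m \<Longrightarrow> g i = f i" "g m \<noteq> f m"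
  shows "g m"
  using assms by (auto simp: lex_gt_def)

lemma not_lex_gt_ones:
  assumes "\<not> lex_gt f g" "\<And>i. i < k \<Longrightarrow> f i" "i < k"
  shows "g i"
  using assms(3)
proof (induction i rule: less_induct)
  case (less i)
  show ?case
  proof (rule ccontr)
    assume "\<not> g i"
    moreover have "\<forall>j<i. f j = g j" using less assms(2) by auto
    ultimately show False using assms(1) assms(2)[OF less.prems] unfolding lex_gt_def by blast
  qed
qed

text \<open>A constant prefix followed by a word in which one of the two letters occurs exactly at the
  positions of a residue class: polynomially many words, and all gaps in a chain are of this form.\<close>

definition simple_window :: "(int \<Rightarrow> bool) \<Rightarrow> int \<Rightarrow> int \<Rightarrow> bool" where
  "simple_window u a b \<longleftrightarrow> (\<exists>j c \<pi> s v. (\<forall>i. a \<le> i \<longrightarrow> i < j \<longrightarrow> u i = c) \<and>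
     (\<forall>i. j \<le> i \<longrightarrow> i < b \<longrightarrow> (u i = v) = (\<pi> dvd i - s)))"

lemma simple_windowI:
  assumes "\<And>i. a \<le> i \<Longrightarrow> i < j \<Longrightarrow> u i = c"
    and "\<And>i. j \<le> i \<Longrightarrow> i < b \<Longrightarrow> (u i = v) = (\<pi> dvd i - s)"
  shows "simple_window u a b"
  unfolding simple_window_def
  by (intro exI[of _ j] exI[of _ c] exI[of _ \<pi>] exI[of _ s] exI[of _ v] conjI allI impI assms)

lemma simple_windowE:
  assumes "simple_window u a b"
  obtains j c \<pi> s v where "\<And>i. a \<le> i \<Longrightarrow> i < j \<Longrightarrow> u i = c"
    "\<And>i. j \<le> i \<Longrightarrow> i < b \<Longrightarrow> (u i = v) = (\<pi> dvd i - s)"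
proof -
  from assms obtain j c \<pi> s v where "\<forall>i. a \<le> i \<longrightarrow> i < j \<longrightarrow> u i = c"
    "\<forall>i. j \<le> i \<longrightarrow> i < b \<longrightarrow> (u i = v) = (\<pi> dvd i - s)"
    unfolding simple_window_def by (elim exE conjE)
  then show ?thesis by (intro that[of j c v \<pi> s]) (drule spec, erule (2) mp[THEN mp])+
qed

lemma simple_window_mono:
  assumes "simple_window u a b" "a \<le> a'" "b' \<le> b"
  shows "simple_window u a' b'"
  using assms(1)
proof (rule simple_windowE)
  fix j c \<pi> s v
  assume *: "\<And>i. a \<le> i \<Longrightarrow> i < j \<Longrightarrow> u i = c"
    "\<And>i. j \<le> i \<Longrightarrow> i < b \<Longrightarrow> (u i = v) = (\<pi> dvd i - s)"
  show ?thesis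
    by (rule simple_windowI[of a' j u c b' v \<pi> s]; rule *; use assms in linarith)
qed

lemma simple_window_compl: "simple_window (\<lambda>i. \<not> u i) a b = simple_window u a b"
proof -
  have *: "simple_window (\<lambda>i. \<not> u i) a b" if "simple_window u a b" for u
    using that
  proof (rule simple_windowE)
    fix j c \<pi> s v
    assume *: "\<And>i. a \<le> i \<Longrightarrow> i < j \<Longrightarrow> u i = c"
      "\<And>i. j \<le> i \<Longrightarrow> i < b \<Longrightarrow> (u i = v) = (\<pi> dvd i - s)"
    show ?thesis
      by (rule simple_windowI[of a j _ "\<not> c" b "\<not> v" \<pi> s]) (use * in blast)+
  qed
  from *[of u] *[of "\<lambda>i. \<not> u i"] show ?thesis by auto
qed

text \<open>
  The labels record how the relative word at a bad position begins: \<open>Sm i\<close> stands for \<open>1(10)^i\<close>,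
  \<open>Md i\<close> for \<open>1(10)^i 11\<close>, and \<open>Nr k\<close> for \<open>1^k\<close>; \<open>Fl k r\<close> stands for \<open>(1^k 0)^r\<close> at a
  position whose left neighbour carries the same letter. A position is big if the relative word
  begins with \<open>111\<close> or \<open>11011\<close>. Labels do not decrease in the order \<open>label_less\<close> when one passes to
  the predecessor of a bad position.
\<close>

datatype label = Sm nat | Md nat | Nr nat | Fl nat nat

definition big :: "(int \<Rightarrow> bool) \<Rightarrow> int \<Rightarrow> bool" where
  "big u p \<longleftrightarrow> rel_right u p 0 \<and> rel_right u p 1 \<and>
     (rel_right u p 2 \<or> rel_right u p 3 \<and> rel_right u p 4)"

fun labelled :: "(int \<Rightarrow> bool) \<Rightarrow> int \<Rightarrow> label \<Rightarrow> bool" where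
  "labelled u p (Sm i) \<longleftrightarrow> 2 \<le> i \<and> bad u p \<and>
     (\<forall>j\<le>2 * i. rel_right u p j \<longleftrightarrow> j = 0 \<or> odd j)"
| "labelled u p (Md i) \<longleftrightarrow> 2 \<le> i \<and> bad u p \<and>
     (\<forall>j\<le>2 * i + 2. rel_right u p j \<longleftrightarrow> j = 0 \<or> odd j \<or> j = 2 * i + 2)"
| "labelled u p (Nr k) \<longleftrightarrow> 2 \<le> k \<and> big u p \<and> (\<forall>j<k. rel_right u p j)"
| "labelled u p (Fl k r) \<longleftrightarrow> 2 \<le> k \<and> 1 \<le> r \<and> big u p \<and> u (p - 1) = u p \<and>
     (\<forall>j<r * (k + 1). rel_right u p j \<longleftrightarrow> \<not> (k + 1) dvd (j + 1))"

text \<open>The block of a label runs from the letter after a position up to and including its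
  successor in the chain, when the label repeats. For \<open>Fl k r\<close> the last 0 of
  \<open>(1^k 0)^r\<close> falls one place beyond that successor, hence the
  \<open>- 1\<close>.\<close>

fun block_len :: "label \<Rightarrow> nat" where
  "block_len (Sm i) = 2 * i + 2"
| "block_len (Md i) = 2 * i + 3"
| "block_len (Nr k) = k + 1"
| "block_len (Fl k r) = r * (k + 1) - 1"

fun block_letter :: "label \<Rightarrow> nat \<Rightarrow> bool" where
  "block_letter (Sm i) j \<longleftrightarrow> j = 0 \<or> odd j \<and> j < 2 * i"
| "block_letter (Md i) j \<longleftrightarrow> j = 0 \<or> odd j \<or> j = 2 * i + 2"
| "block_letter (Nr k) j \<longleftrightarrow> j < k"
| "block_letter (Fl k r) j \<longleftrightarrow> \<not> (k + 1) dvd (j + 1)"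

text \<open>Modelled on the lexicographic order of the words: \<open>1(10)^i 0\<close> increases
  with i, \<open>1(10)^i 11\<close> decreases with i and lies above all of these, and big words lie
  above both. A chain may pass from \<open>Nr k\<close> to \<open>Fl k r\<close>, never
  back.\<close>

fun label_less :: "label \<Rightarrow> label \<Rightarrow> bool" where
  "label_less (Sm i) (Sm i') = (i < i')"
| "label_less (Sm i) _ = True"
| "label_less (Md i) (Sm i') = False"
| "label_less (Md i) (Md i') = (i' < i)"
| "label_less (Md i) _ = True"
| "label_less (Nr k) (Nr k') = (k < k')"
| "label_less (Nr k) (Fl k' r) = (k \<le> k')"
| "label_less (Nr k) _ = False"
| "label_less (Fl k r) (Nr k') = (k < k')"
| "label_less (Fl k r) (Fl k' r') = (k < k' \<or> k = k' \<and> r < r')"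
| "label_less (Fl k r) _ = False"

fun label_size :: "label \<Rightarrow> nat" where
  "label_size (Sm i) = i"
| "label_size (Md i) = i"
| "label_size (Nr k) = k"
| "label_size (Fl k r) = max k r"

text \<open>Below a cutoff a label can grow only finitely often, so nothing beyond simplicity is
  asked of the gap then, whereas a repeated label must determine the gap. Above the cutoff the bound
  by \<open>label_size\<close> provides long gaps instead.\<close>

definition chain_step :: "(int \<Rightarrow> bool) \<Rightarrow> label \<Rightarrow> int \<Rightarrow> label \<Rightarrow> int \<Rightarrow> bool" where
  "chain_step u \<sigma> p \<sigma>' q \<longleftrightarrow> q < p \<and> labelled u q \<sigma>' \<and> simple_window u (q + 1) p \<and>
     int (label_size \<sigma>') \<le> p - q \<and>
     (label_less \<sigma> \<sigma>' \<or> \<sigma> = \<sigma>' \<and> p - q = int (block_len \<sigma>) \<and>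
        (\<forall>j<block_len \<sigma>. rel_right u q j = block_letter \<sigma> j))"

definition simple_left :: "(int \<Rightarrow> bool) \<Rightarrow> int \<Rightarrow> bool" where
  "simple_left u p \<longleftrightarrow> (\<forall>a. simple_window u a p)"

lemma big_imp_bad: "big u p \<Longrightarrow> bad u p"
  unfolding big_def bad_def using lex_gt_tm_prefix(1,2) by blast

lemma labelled_bad: "labelled u p \<sigma> \<Longrightarrow> bad u p"
  by (cases \<sigma>) (auto simp: big_imp_bad)

text \<open>The coarsest labels suffice to start a chain: \<open>Nr 2\<close> at a big position, and
  \<open>Sm 2\<close> otherwise, since a bad word that is not big begins with 11010.\<close>

lemma bad_imp_labelled:
  assumes "bad u p"
  shows "\<exists>\<sigma>. labelled u p \<sigma>"
proof -
  let ?e = "rel_right u p"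
  have e: "?e 0" "?e 1" "?e 2 \<or> ?e 3" using assms lex_gt_tm_cases by (auto simp: bad_def)
  show ?thesis
  proof (cases "big u p")
    case True
    then have "labelled u p (Nr 2)" using e by (simp add: less_numeral_iff)
    then show ?thesis ..
  next
    case False
    then have "\<forall>j<5. ?e j \<longleftrightarrow> j = 0 \<or> odd j" using e by (auto simp: big_def less_numeral_iff)
    then have "labelled u p (Sm 2)" using assms by simp
    then show ?thesis ..
  qed
qed

section \<open>Exchange of the two letters\<close>

lemma rel_compl:
  "rel_right (\<lambda>i. \<not> u i) p = rel_right u p" "rel_left (\<lambda>i. \<not> u i) p = rel_left u p"
  by (auto simp: rel_right_def rel_left_def fun_eq_iff)

lemma compl_iffs:
  "bad (\<lambda>i. \<not> u i) p = bad u p" "big (\<lambda>i. \<not> u i) p = big u p"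
  "left_dominated (\<lambda>i. \<not> u i) = left_dominated u"
  by (auto simp: bad_def big_def left_dominated_def rel_compl)

lemma labelled_compl: "labelled (\<lambda>i. \<not> u i) p \<sigma> = labelled u p \<sigma>"
  by (cases \<sigma>) (auto simp: compl_iffs rel_compl)

lemma chain_step_compl: "chain_step (\<lambda>i. \<not> u i) = chain_step u"
  by (simp add: chain_step_def labelled_compl simple_window_compl rel_compl fun_eq_iff)

lemma simple_left_compl: "simple_left (\<lambda>i. \<not> u i) = simple_left u"
  by (simp add: simple_left_def simple_window_compl fun_eq_iff)

lemma run_left:
  fixes u :: "int \<Rightarrow> bool"
  shows "(\<forall>i\<le>p. u i = c) \<or> (\<exists>k::nat. u (p - int k) \<noteq> c \<and> (\<forall>i. p - int k < i \<and> i \<le> p \<longrightarrow> u i = c))"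
proof (cases "\<forall>i\<le>p. u i = c")
  case False
  then obtain i where i: "i \<le> p" "u i \<noteq> c" by blast
  then have ex: "\<exists>k::nat. u (p - int k) \<noteq> c" by (intro exI[of _ "nat (p - i)"]) auto
  define k where "k = (LEAST k::nat. u (p - int k) \<noteq> c)"
  have "u (p - int k) \<noteq> c" using LeastI_ex[OF ex] by (simp add: k_def)
  moreover have "u i = c" if "p - int k < i" "i \<le> p" for i
  proof (rule ccontr)
    assume "u i \<noteq> c"
    then have "u (p - int (nat (p - i))) \<noteq> c" using that by simp
    then have "k \<le> nat (p - i)" unfolding k_def by (rule Least_le)
    then show False using that by linarith
  qed
  ultimately show ?thesis by blast
qed simp


section \<open>Chains of bad positions\<close>

lemma labelled_ones:
  assumes "labelled u p \<sigma>"
  shows "rel_right u p 0" "rel_right u p 1"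
  using lex_gt_tm_cases[OF labelled_bad[OF assms, unfolded bad_def]] by auto

text \<open>Reflection at \<open>p\<close>: the leading 1s of the word to the right recur on the
  left, and the place \<open>q\<close> where this left run ends is the predecessor. From
  \<open>q\<close> one reads \<open>1^k 0\<close> and then the word at \<open>p\<close>. A label
  \<open>Fl\<close> cannot occur here because it makes the left neighbour of \<open>p\<close> equal
  to \<open>u p\<close>.\<close>

lemma step_same_letter:
  assumes lab: "labelled u p \<sigma>" and p: "\<not> u p"
    and dom: "\<not> lex_gt (rel_right u p) (rel_left u p)"
  shows "simple_left u p \<or> (\<exists>q \<sigma>'. chain_step u \<sigma> p \<sigma>' q)"
proof -
  have left: "u (p - 1 - int i)" if "i < m" "\<And>j. j < m \<Longrightarrow> rel_right u p j" for i m
    using not_lex_gt_ones[OF dom that(2) that(1)] p by (simp add: rel_left_def)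
  have e01: "j < 2 \<Longrightarrow> rel_right u p j" for j
    using labelled_ones[OF lab] by (auto simp: less_2_cases_iff)
  show ?thesis
  proof (cases "\<forall>i\<le>p - 1. u i = True")
    case True
    then have "simple_left u p"
      unfolding simple_left_def by (intro allI simple_windowI[of _ p u True p]) auto
    then show ?thesis ..
  next
    case False
    then obtain k :: nat where k: "\<not> u (p - 1 - int k)" "\<And>i. p - 1 - int k < i \<Longrightarrow> i \<le> p - 1 \<Longrightarrow> u i"
      using run_left[of "p - 1" u True] by auto
    have k_ge: "m \<le> k" if "\<And>j. j < m \<Longrightarrow> rel_right u p j" for m
      using left[of k m] that k(1) by (meson not_le)
    have "2 \<le> k" using k_ge[of 2] e01 by blast
    define q where "q = p - 1 - int k"
    have r1: "rel_right u q j" if "j < k" for j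
      using k that by (simp add: rel_right_def q_def)
    have r2: "\<not> rel_right u q k"
      using k p by (simp add: rel_right_def q_def)
    have r3: "rel_right u q (k + 1 + i) = rel_right u p i" for i
      using k p by (simp add: rel_right_def q_def algebra_simps)
    \<comment> \<open>For \<open>k = 2\<close> the word at \<open>q\<close> is 110 followed by the
      word at \<open>p\<close>, which begins with 11.\<close>
    have "big u q"
    proof (cases "k = 2")
      case True
      then show ?thesis using r1[of 0] r1[of 1] r3[of 0] r3[of 1] e01[of 0] e01[of 1]
        by (simp add: big_def numeral_eq_Suc)
    next
      case False
      then show ?thesis using r1[of 0] r1[of 1] r1[of 2] \<open>2 \<le> k\<close> by (simp add: big_def)
    qed
    then have lq: "labelled u q (Nr k)" using \<open>2 \<le> k\<close> r1 by simp
    have w: "simple_window u (q + 1) p"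
      by (rule simple_windowI[of _ p _ True]) (use k in \<open>auto simp: q_def\<close>)
    have "label_less \<sigma> (Nr k) \<or> \<sigma> = Nr k"
    proof (cases \<sigma>)
      case (Nr k0)
      then show ?thesis using k_ge[of k0] lab by auto
    next
      case (Fl k0 r)
      then have "u (p - 1) = u p" using lab by simp
      then show ?thesis using left[of 0 2] e01 p by simp
    qed simp_all
    moreover have "p - q = int (block_len (Nr k))" by (simp add: q_def)
    moreover have "\<forall>j<block_len (Nr k). rel_right u q j = block_letter (Nr k) j"
      using r1 r2 by (auto simp: less_Suc_eq)
    ultimately have "chain_step u \<sigma> p (Nr k) q"
      using lq w by (auto simp: chain_step_def q_def)
    then show ?thesis by blast
  qed
qed

text \<open>Reflection at the edge after \<open>p\<close>, when the left run is exactly as long as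
  the run recorded in the label. Read leftwards from \<open>p\<close>, the pattern
  \<open>0^k 1\<close> occurs s times in a row, with s maximal. What interrupts it decides: a longer
  run gives \<open>Nr k'\<close> with k' > k, an earlier 1 gives \<open>Fl k s\<close>, and
  dominance then yields \<open>r \<le> s\<close>.\<close>

lemma step_flip:
  assumes ld: "left_dominated u" and p: "\<not> u p" "u (p + 1)"
    and dom: "\<not> lex_gt (rel_right u p) (rel_left u (p + 1))"
    and kr: "2 \<le> k" "1 \<le> r" and bg: "big u p"
    and pat': "\<forall>j<r * (k + 1). rel_right u p j \<longleftrightarrow> \<not> (k + 1) dvd (j + 1)"
    and run': "u (p - int k)" "\<forall>i. p - int k < i \<longrightarrow> i \<le> p \<longrightarrow> \<not> u i"
  shows "simple_left u p \<or> (\<exists>q \<sigma>'. q < p \<and> labelled u q \<sigma>' \<and> simple_window u (q + 1) p \<and>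
     int (label_size \<sigma>') \<le> p - q \<and>
     ((\<exists>k'>k. \<sigma>' = Nr k') \<or> (\<exists>s\<ge>r. \<sigma>' = Fl k s) \<and> p - q = int (block_len \<sigma>') \<and>
        (\<forall>j<block_len \<sigma>'. rel_right u q j = block_letter \<sigma>' j)))" (is "_ \<or> ?concl")
proof -
  note pat = pat'[rule_format] and run = run'[rule_format]
  define P where "P s \<longleftrightarrow> (\<forall>i<s * (k + 1). u (p - int i) \<longleftrightarrow> (k + 1) dvd (i + 1))" for s
  have P1: "P 1"
    using run by (auto simp: P_def less_Suc_eq dest: dvd_imp_le)
  show ?thesis
  proof (cases "\<forall>s\<ge>1. P s")
    case True
    have "u i = True \<longleftrightarrow> int (k + 1) dvd i - (p + 1)" if "i < p" for i
    proof -
      define n where "n = nat (p - i)"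
      have n: "i = p - int n" using that by (simp add: n_def)
      have "n < (n + 1) * (k + 1)" by simp
      then have "u (p - int n) \<longleftrightarrow> (k + 1) dvd (n + 1)" using True[rule_format, of "n + 1"] unfolding P_def by auto
      also have "\<dots> \<longleftrightarrow> int (k + 1) dvd int (n + 1)" by (simp only: of_nat_dvd_iff)
      also have "\<dots> \<longleftrightarrow> int (k + 1) dvd - int (n + 1)" by (simp only: dvd_minus_iff)
      also have "- int (n + 1) = i - (p + 1)" by (simp add: n)
      finally show ?thesis by (simp add: n)
    qed
    then have "simple_left u p"
      unfolding simple_left_def by (intro allI simple_windowI[of a a u True p True "int (k + 1)" "p + 1" for a]) auto
    then show ?thesis ..
  next
    case False
    have "\<exists>s\<ge>1. P s \<and> \<not> P (Suc s)"
    proof (rule ccontr)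
      assume no: "\<not> ?thesis"
      have "P s" if "1 \<le> s" for s using that
        by (induction s rule: dec_induct) (use P1 no in auto)
      then show False using False by blast
    qed
    then obtain s where s: "1 \<le> s" "P s" "\<not> P (Suc s)" by blast
    define m where "m = s * (k + 1)"
    have m: "k + 1 \<le> m" "3 * s \<le> m" "(k + 1) dvd m"
      using mult_le_mono1[OF s(1), of "k + 1"] mult_le_mono2[of 3 "k + 1" s] kr(1)
      by (simp_all only: m_def dvd_triv_right) (simp_all add: mult.commute)
    \<comment> \<open>The 1 that completes the last of the s repetitions of \<open>0^k 1\<close>, so
      that \<open>(1 0^k)^s\<close> occupies the places from \<open>q\<close> to
      \<open>p\<close>.\<close>
    define q where "q = p + 1 - int m"
    have Ps: "u (p - int i) \<longleftrightarrow> (k + 1) dvd (i + 1)" if "i < m" for i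
      using s(2) that unfolding P_def m_def by blast
    have per: "u i \<longleftrightarrow> int (k + 1) dvd i - q" if "q \<le> i" "i \<le> p" for i
    proof -
      define n where "n = nat (p - i)"
      have n: "i = p - int n" using that by (simp add: n_def)
      have "n < m" using that by (simp add: n_def q_def)
      have iq: "i - q = int m - int (n + 1)" by (simp add: n q_def)
      have "int (k + 1) dvd int m - int (n + 1) \<longleftrightarrow> int (k + 1) dvd int (n + 1)"
        using m(3) by (metis dvd_diff_commute dvd_diff_left_iff of_nat_dvd_iff)
      then have "int (k + 1) dvd i - q \<longleftrightarrow> (k + 1) dvd (n + 1)"
        unfolding iq by (simp only: of_nat_dvd_iff)
      moreover have "u i \<longleftrightarrow> (k + 1) dvd (n + 1)" using Ps[OF \<open>n < m\<close>] n by (simp only:)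
      ultimately show ?thesis by (simp only:)
    qed
    have uq: "u q" using per[of q] m by (simp add: q_def)
    have rq: "rel_right u q j \<longleftrightarrow> \<not> (k + 1) dvd (j + 1)" if "j < m" for j
    proof (cases "j = m - 1")
      case True
      then have "q + 1 + int j = p + 1" "j + 1 = m" using m by (simp_all add: q_def)
      then show ?thesis using uq p m(3) by (simp only: rel_right_def) simp
    next
      case False
      have "u (q + 1 + int j) \<longleftrightarrow> int (k + 1) dvd int (j + 1)"
        using per[of "q + 1 + int j"] that False by (simp add: q_def algebra_simps)
      then show ?thesis using uq by (simp only: rel_right_def of_nat_dvd_iff) simp
    qed
    have nxt: "\<exists>i\<le>k. u (q - 1 - int i) \<noteq> (i = k)"
    proof -
      obtain n where n: "n < Suc s * (k + 1)" "u (p - int n) \<noteq> ((k + 1) dvd (n + 1))"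
        using s(3) unfolding P_def by blast
      then have "\<not> n < m" using Ps by blast
      define i where "i = n - m"
      have n': "n = m + i" using \<open>\<not> n < m\<close> by (simp add: i_def)
      have "i \<le> k" using n(1) by (simp add: n' m_def)
      moreover have "(k + 1) dvd (n + 1) \<longleftrightarrow> (k + 1) dvd (i + 1)"
        unfolding n' using m(3) by (metis add.assoc dvd_add_right_iff)
      moreover have "(k + 1) dvd (i + 1) \<longleftrightarrow> i = k"
        using \<open>i \<le> k\<close> by (metis add_le_mono1 dvd_imp_le dvd_refl le_antisym add_right_cancel le_add2 less_le_trans zero_less_one)
      moreover have "p - int n = q - 1 - int i" by (simp add: n' q_def)
      ultimately show ?thesis using n(2) by auto
    qed
    show ?thesis
    proof (cases "\<forall>i\<le>k. \<not> u (q - 1 - int i)")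
      case zeros: True
      show ?thesis
      proof (cases "\<forall>i\<le>q - 1. u i = False")
        case True
        have "simple_window u a p" for a
          by (rule simple_windowI[of a q u False p True "int (k + 1)" q]) (use True per in auto)
        then show ?thesis by (simp add: simple_left_def)
      next
        case False
        then obtain k' :: nat where k': "u (q - 1 - int k')"
          "\<And>i. q - 1 - int k' < i \<Longrightarrow> i \<le> q - 1 \<Longrightarrow> \<not> u i"
          using run_left[of "q - 1" u False] by auto
        have "k < k'" using zeros k'(1) by (meson not_le)
        define q' where "q' = q - 1 - int k'"
        have r: "rel_right u q' j" if "j < k'" for j
          using k' that by (simp add: rel_right_def q'_def)
        then have "labelled u q' (Nr k')"
          using \<open>k < k'\<close> kr(1) by (simp add: big_def)
        moreover have "simple_window u (q' + 1) p"
          by (rule simple_windowI[of _ q u False p True "int (k + 1)" q]) (use k' per in \<open>auto simp: q'_def\<close>)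
        moreover have "q' < p" "int (label_size (Nr k')) \<le> p - q'" using m by (auto simp: q'_def q_def)
        ultimately show ?thesis using \<open>k < k'\<close> by blast
      qed
    next
      case False
      then have ex: "\<exists>i. i \<le> k \<and> u (q - 1 - int i)" by blast
      define i0 where "i0 = (LEAST i. i \<le> k \<and> u (q - 1 - int i))"
      have i0: "i0 \<le> k" "u (q - 1 - int i0)" using LeastI_ex[OF ex] by (auto simp: i0_def)
      have i0_least: "\<not> u (q - 1 - int i)" if "i < i0" for i
        using not_less_Least[of i "\<lambda>i. i \<le> k \<and> u (q - 1 - int i)"] that i0(1) by (auto simp: i0_def)
      have "i0 < k"
      proof (rule ccontr)
        assume "\<not> i0 < k"
        then have "i0 = k" using i0 by simp
        then show False using nxt i0 i0_least by (metis le_neq_implies_less)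
      qed
      have l: "rel_left u (p + 1) n \<longleftrightarrow> \<not> u (p - int n)" for n
        using p by (simp add: rel_left_def)
      \<comment> \<open>The s repetitions on the left are followed by \<open>i0\<close> zeros and
        then a 1, which is a 0 of the relative left word. Dominance forbids the right word to agree
        up to there and have a 1 at that place.\<close>
      have contra: False if e: "\<And>n. n < m \<Longrightarrow> rel_right u p n \<longleftrightarrow> \<not> (k + 1) dvd (n + 1)"
        "\<And>i. i \<le> i0 \<Longrightarrow> rel_right u p (m + i)"
      proof -
        have "rel_left u (p + 1) (m + i0)"
        proof (rule not_lex_gt_first_diff[OF dom])
          fix n assume "n < m + i0"
          show "rel_left u (p + 1) n = rel_right u p n"
          proof (cases "n < m")
            case True
            then show ?thesis using e(1) Ps l by simp
          next
            case False
            define i where "i = n - m"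
            have n: "n = m + i" "i < i0" using False \<open>n < m + i0\<close> by (auto simp: i_def)
            then have "p - int n = q - 1 - int i" by (simp add: q_def)
            then show ?thesis using e(2)[of i] i0_least[of i] n l by (simp only: simp_thms)
          qed
        next
          have "p - int (m + i0) = q - 1 - int i0" by (simp add: q_def)
          then show "rel_left u (p + 1) (m + i0) \<noteq> rel_right u p (m + i0)"
            using e(2)[of i0] i0(2) l[of "m + i0"] by (simp only: simp_thms)
        qed
        moreover have "p - int (m + i0) = q - 1 - int i0" by (simp add: q_def)
        ultimately show False using i0(2) l[of "m + i0"] by (simp only: simp_thms)
      qed
      have "r \<le> s"
      proof (rule ccontr)
        assume "\<not> r \<le> s"
        then have "Suc s * (k + 1) \<le> r * (k + 1)" by (intro mult_le_mono1) simp
        then have mr: "m + (k + 1) \<le> r * (k + 1)" by (simp add: m_def)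
        show False
        proof (rule contra)
          show "rel_right u p n \<longleftrightarrow> \<not> (k + 1) dvd (n + 1)" if "n < m" for n
            using pat mr that by simp
          show "rel_right u p (m + i)" if "i \<le> i0" for i
          proof -
            have "\<not> (k + 1) dvd (i + 1)" using that \<open>i0 < k\<close> by (auto dest: dvd_imp_le)
            then have "\<not> (k + 1) dvd (m + (i + 1))" using m(3) by (meson dvd_add_right_iff)
            then show ?thesis using pat[of "m + i"] mr that \<open>i0 < k\<close> by (simp add: add.assoc)
          qed
        qed
      qed
      have e2: "\<not> rel_right u p k"
        using pat[of k] kr by (metis Suc_eq_plus1 dvd_refl le_add2 less_le_trans mult_le_mono1 nat_mult_1 lessI)
      \<comment> \<open>For \<open>k = 2\<close> and \<open>s = 1\<close> the block at
        \<open>q\<close> is only 110, which does not show that \<open>q\<close> is big. But then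
        \<open>p\<close> begins with 11011, against the dominance just used.\<close>
      have ks: "3 \<le> k \<or> 2 \<le> s"
      proof (rule ccontr)
        assume "\<not> ?thesis"
        then have k2: "k = 2" "s = 1" using kr s by auto
        then have e34: "rel_right u p 3" "rel_right u p 4" using bg e2 by (auto simp: big_def)
        have m3: "m = 3" using k2 by (simp add: m_def)
        show False
        proof (rule contra)
          show "rel_right u p n \<longleftrightarrow> \<not> (k + 1) dvd (n + 1)" if "n < m" for n
            using pat[of n] that m3 k2 kr by simp
          show "rel_right u p (m + i)" if "i \<le> i0" for i
            using that \<open>i0 < k\<close> k2 m3 e34 by (cases "i = 0") (auto simp: numeral_eq_Suc less_Suc_eq_le le_Suc_eq)
        qed
      qed
      have bq: "big u q"
      proof (cases "3 \<le> k")
        case True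
        then show ?thesis using rq[of 0] rq[of 1] rq[of 2] m by (auto simp: big_def dest: dvd_imp_le)
      next
        case False
        then have "k = 2" "2 \<le> s" using kr ks by auto
        then show ?thesis using rq[of 0] rq[of 1] rq[of 3] rq[of 4] m by (auto simp: big_def dest: dvd_imp_le)
      qed
      \<comment> \<open>Dominance at \<open>q\<close> itself: reflection at \<open>q\<close> would
        require \<open>k\<close> letters unlike \<open>u q\<close> on its left, but the one at index
        \<open>i0 < k\<close> equals \<open>u q\<close>. So the reflection at the edge applies, and
        it makes the left neighbour equal.\<close>
      have "u (q - 1)"
      proof -
        consider "\<not> lex_gt (rel_right u q) (rel_left u q)" | "\<not> lex_gt (rel_right u q) (rel_left u (q + 1))"
          using ld big_imp_bad[OF bq] by (auto simp: left_dominated_def)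
        then show ?thesis
        proof cases
          case 1
          have "rel_right u q j" if "j < k" for j
            using rq[of j] that m by (auto dest: dvd_imp_le)
          then have "rel_left u q i0" using not_lex_gt_ones[OF 1 _ \<open>i0 < k\<close>] by blast
          then show ?thesis using uq i0(2) by (simp add: rel_left_def)
        next
          case 2
          have q1: "\<not> u (q + 1)" using rq[of 0] m kr uq by (simp add: rel_right_def)
          have "rel_left u (q + 1) 1"
            by (rule not_lex_gt_ones[OF 2, of 2]) (use bq in \<open>auto simp: big_def less_2_cases_iff\<close>)
          then show ?thesis using q1 by (simp add: rel_left_def)
        qed
      qed
      then have "labelled u q (Fl k s)"
        using bq kr s(1) uq rq by (simp add: m_def)
      moreover have "simple_window u (q + 1) p"
        by (rule simple_windowI[of _ q u True p True "int (k + 1)" q]) (use per in auto)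
      moreover have "q < p" "int (label_size (Fl k s)) \<le> p - q" using m kr s(1) by (auto simp: q_def)
      moreover have "p - q = int (block_len (Fl k s))"
        using m by (simp add: q_def m_def of_nat_diff)
      moreover have "\<forall>j<block_len (Fl k s). rel_right u q j = block_letter (Fl k s) j"
        using rq by (simp add: m_def)
      ultimately show ?thesis using \<open>r \<le> s\<close> by blast
    qed
  qed
qed

text \<open>The word at \<open>p\<close> begins with \<open>1(10)^i1\<close>, and dominance makes
  the letters before \<open>p\<close> alternate as well. Let \<open>(10)^i\<close> be the longest
  such stretch. The two letters in front of it cannot be 10: with 01 one finds \<open>Sm i\<close>,
  with 11 a label \<open>Nr\<close>, and with 00 either \<open>Md i\<close> or, if the run of zeros
  has length at least 3, a label \<open>Nr\<close>.\<close>

lemma step_alternating: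
  assumes lab: "labelled u p \<sigma>" and \<sigma>: "\<sigma> = Sm i1 \<or> \<sigma> = Md i1"
    and p: "\<not> u p" "\<not> u (p - 1)" "u (p - 2)" "u (p + 1)"
    and dom: "\<not> lex_gt (rel_right u p) (rel_left u (p + 1))"
  shows "simple_left u p \<or> (\<exists>q \<sigma>'. chain_step u \<sigma> p \<sigma>' q)"
proof -
  have l: "rel_left u (p + 1) n \<longleftrightarrow> \<not> u (p - int n)" for n
    using p by (simp add: rel_left_def)
  have i1: "2 \<le> i1" using lab \<sigma> by auto
  have e: "rel_right u p n \<longleftrightarrow> n = 0 \<or> odd n" if "n \<le> 2 * i1" for n
    using lab \<sigma> that by auto
  have e_Md: "rel_right u p n \<longleftrightarrow> n = 0 \<or> odd n \<or> n = 2 * i1 + 2"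
    if "n \<le> 2 * i1 + 2" "\<sigma> = Md i1" for n
    using lab that by simp
  have less_Nr: "label_less \<sigma> (Nr k)" for k using \<sigma> by auto
  have p3: "\<not> u (p - 3)"
  proof
    assume u3: "u (p - 3)"
    have "rel_left u (p + 1) 3"
    proof (rule not_lex_gt_first_diff[OF dom])
      fix n :: nat assume "n < 3"
      then have "n = 0 \<or> n = 1 \<or> n = 2" by auto
      then show "rel_left u (p + 1) n = rel_right u p n"
        using e[of n] i1 p l[of n] by auto
    qed (use e[of 3] i1 l[of 3] u3 in auto)
    then show False using l[of 3] u3 by simp
  qed
  have Nr_step: "\<exists>q \<sigma>'. chain_step u \<sigma> p \<sigma>' q"
    if "q < p" "simple_window u (q + 1) p" "int k \<le> p - q" "2 \<le> k" "\<And>n. n < k \<Longrightarrow> rel_right u q n"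
      "3 \<le> k \<or> rel_right u q 3 \<and> rel_right u q 4" for q k
  proof -
    have "big u q" using that(4-6) by (auto simp: big_def)
    then have "labelled u q (Nr k)" using that by simp
    then show ?thesis using that less_Nr[of k] unfolding chain_step_def by (intro exI[of _ q] exI[of _ "Nr k"]) auto
  qed
  show ?thesis
  \<comment> \<open>If \<open>u (p - 4)\<close> is 0, the run of zeros ending at
    \<open>p - 3\<close> gives a word \<open>1^k 011\<close>, big even for \<open>k = 2\<close>.
    Otherwise the stretch \<open>(10)^2\<close> needed for a label is present.\<close>
  proof (cases "u (p - 4)")
    case False
    have per: "u i = True \<longleftrightarrow> 2 dvd i - (p - 2)" if "p - 2 \<le> i" "i < p" for i
    proof -
      have "i = p - 2 \<or> i = p - 1" using that by linarith
      then show ?thesis using p by auto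
    qed
    show ?thesis
    proof (cases "\<forall>i\<le>p - 3. u i = False")
      case True
      have "simple_window u a p" for a
        by (rule simple_windowI[of a "p - 2" u False p True 2 "p - 2"]) (use True per in auto)
      then show ?thesis by (simp add: simple_left_def)
    next
      case nz: False
      then obtain k :: nat where k: "u (p - 3 - int k)"
        "\<And>i. p - 3 - int k < i \<Longrightarrow> i \<le> p - 3 \<Longrightarrow> \<not> u i"
        using run_left[of "p - 3" u False] by auto
      have "k \<noteq> 0" using k(1) p3 by (intro notI) simp
      moreover have "k \<noteq> 1" using k(1) False by (intro notI) simp
      ultimately have k2: "2 \<le> k" by linarith
      define q where "q = p - 3 - int k"
      have "\<exists>q \<sigma>'. chain_step u \<sigma> p \<sigma>' q"
      proof (rule Nr_step)
        show "simple_window u (q + 1) p"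
          by (rule simple_windowI[of _ "p - 2" u False p True 2 "p - 2"]) (use k per in \<open>auto simp: q_def\<close>)
        show r: "rel_right u q n" if "n < k" for n
          using k that by (simp add: rel_right_def q_def)
        show "3 \<le> k \<or> rel_right u q 3 \<and> rel_right u q 4"
          using k2 k(1) p by (cases "k = 2") (auto simp: rel_right_def q_def)
      qed (use k2 in \<open>auto simp: q_def\<close>)
      then show ?thesis ..
    qed
  next
    case u4: True
    define Q where "Q i \<longleftrightarrow> (\<forall>n<2 * i. u (p - 1 - int n) \<longleftrightarrow> odd n)" for i
    have Q2: "Q 2"
      unfolding Q_def using p p3 u4 by (simp add: less_numeral_iff)
    show ?thesis
    proof (cases "\<forall>i\<ge>2. Q i")
      case True
      have "u i = True \<longleftrightarrow> 2 dvd i - p" if "i < p" for i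
      proof -
        define n where "n = nat (p - 1 - i)"
        have n: "i = p - 1 - int n" using that by (simp add: n_def)
        have "n < 2 * (n + 2)" by simp
        then have "u i \<longleftrightarrow> odd n" using True[rule_format, of "n + 2"] n unfolding Q_def by auto
        also have "\<dots> \<longleftrightarrow> even (i - p)" by (simp add: n)
        finally show ?thesis by simp
      qed
      then have "simple_left u p"
        unfolding simple_left_def by (intro allI simple_windowI[of a a u True p True 2 p for a]) auto
      then show ?thesis ..
    next
      case False
      have "\<exists>i\<ge>2. Q i \<and> \<not> Q (Suc i)"
      proof (rule ccontr)
        assume no: "\<not> ?thesis"
        have "Q i" if "2 \<le> i" for i using that
          by (induction i rule: dec_induct) (use Q2 no in auto)
        then show False using False by blast
      qed
      then obtain i where i: "2 \<le> i" "Q i" "\<not> Q (Suc i)" by blast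
      define q0 where "q0 = p - 2 * int i"
      have per: "u x \<longleftrightarrow> 2 dvd x - q0" if "q0 \<le> x" "x < p" for x
      proof -
        define n where "n = nat (p - 1 - x)"
        have n: "x = p - 1 - int n" "n < 2 * i" using that by (auto simp: n_def q0_def)
        then have "u x \<longleftrightarrow> odd n" using i(2) unfolding Q_def by auto
        then show ?thesis by (simp add: n q0_def)
      qed
      have lo: "rel_left u (p + 1) n \<longleftrightarrow> n = 0 \<or> odd n" if "n \<le> 2 * i" for n
      proof (cases "n = 0")
        case True
        then show ?thesis using l[of 0] p by simp
      next
        case False
        then have "u (p - int n) \<longleftrightarrow> 2 dvd p - int n - q0"
          using that by (intro per) (auto simp: q0_def)
        then show ?thesis using l[of n] False by (simp add: q0_def)
      qed
      have l1: "rel_left u (p + 1) (2 * i + 1) \<longleftrightarrow> \<not> u (q0 - 1)"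
        "rel_left u (p + 1) (2 * i + 2) \<longleftrightarrow> \<not> u (q0 - 2)"
        using l[of "2 * i + 1"] l[of "2 * i + 2"] by (simp_all add: q0_def algebra_simps)
      have nxt: "u (q0 - 1) \<or> \<not> u (q0 - 2)"
      proof -
        obtain n where n: "n < 2 * Suc i" "u (p - 1 - int n) \<noteq> odd n" using i(3) unfolding Q_def by blast
        then have "\<not> n < 2 * i" using i(2) unfolding Q_def by blast
        then have "n = 2 * i \<or> n = 2 * i + 1" using n(1) by auto
        then show ?thesis using n(2) by (auto simp: q0_def algebra_simps)
      qed
      have uq0: "u q0" using per[of q0] i(1) by (simp add: q0_def)
      \<comment> \<open>A longer alternating stretch would make the left word carry a 0 where the
        right word has the last 1 of \<open>1(10)^i1 11\<close>. This is why \<open>Md\<close> is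
        ordered backwards.\<close>
      have Md_le: "i \<le> i1" if "\<sigma> = Md i1"
      proof (rule ccontr)
        assume "\<not> i \<le> i1"
        then have j: "2 * i1 + 2 \<le> 2 * i" by simp
        have "rel_left u (p + 1) (2 * i1 + 2)"
        proof (rule not_lex_gt_first_diff[OF dom])
          fix n assume "n < 2 * i1 + 2"
          then show "rel_left u (p + 1) n = rel_right u p n"
            using e_Md[OF _ that, of n] lo[of n] j by simp
        qed (use lo[OF j] e_Md[OF _ that, of "2 * i1 + 2"] in simp)
        then show False using lo[OF j] by simp
      qed
      show ?thesis
      proof (cases "u (q0 - 1)")
        case False
        then have q2: "\<not> u (q0 - 2)" using nxt by simp
        show ?thesis
        proof (cases "\<forall>x\<le>q0 - 1. u x = False")
          case True
          have "simple_window u a p" for a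
            by (rule simple_windowI[of a q0 u False p True 2 q0]) (use True per in auto)
          then show ?thesis by (simp add: simple_left_def)
        next
          case nz: False
          then obtain k :: nat where k: "u (q0 - 1 - int k)"
            "\<And>x. q0 - 1 - int k < x \<Longrightarrow> x \<le> q0 - 1 \<Longrightarrow> \<not> u x"
            using run_left[of "q0 - 1" u False] by auto
          have "k \<noteq> 0" using k(1) False by (intro notI) simp
          moreover have "k \<noteq> 1" using k(1) q2 by (intro notI) simp
          ultimately have k2: "2 \<le> k" by linarith
          define q where "q = q0 - 1 - int k"
          have w: "simple_window u (q + 1) p"
            by (rule simple_windowI[of _ q0 u False p True 2 q0]) (use k per in \<open>auto simp: q_def\<close>)
          have r1: "rel_right u q n" if "n < k" for n
            using k that by (simp add: rel_right_def q_def)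
          show ?thesis
          proof (cases "3 \<le> k")
            case True
            have "\<exists>q \<sigma>'. chain_step u \<sigma> p \<sigma>' q"
              by (rule Nr_step[of q k]) (use w r1 True in \<open>auto simp: q_def q0_def\<close>)
            then show ?thesis ..
          next
            case False
            then have k: "k = 2" "u q" using k2 k by (auto simp: q_def)
            have r2: "rel_right u q (2 + m) \<longleftrightarrow> odd m" if "m < 2 * i" for m
            proof -
              have "q + 1 + int (2 + m) = q0 + int m" using k by (simp add: q_def)
              then show ?thesis using per[of "q0 + int m"] that k(2)
                by (simp only: rel_right_def) (simp add: q0_def)
            qed
            have r3: "rel_right u q (2 * i + 2)"
            proof -
              have "q + 1 + int (2 * i + 2) = p" using k by (simp add: q_def q0_def)
              then show ?thesis using k p by (simp only: rel_right_def) simp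
            qed
            have r: "rel_right u q n \<longleftrightarrow> n = 0 \<or> odd n \<or> n = 2 * i + 2" if "n \<le> 2 * i + 2" for n
            proof -
              have "n = 0 \<or> n = 1 \<or> n = 2 * i + 2 \<or> n = 2 + (n - 2) \<and> n - 2 < 2 * i"
                using that by linarith
              then consider "n = 0" | "n = 1" | m where "n = 2 + m" "m < 2 * i" | "n = 2 * i + 2"
                by blast
              then show ?thesis by cases (use r1 r2 r3 k in auto)
            qed
            have "bad u q"
              unfolding bad_def by (rule lex_gt_tm_prefix(3)) (use r i(1) in auto)
            then have lq: "labelled u q (Md i)" using r i(1) by simp
            have "label_less \<sigma> (Md i) \<or> \<sigma> = Md i"
              using \<sigma> Md_le by (auto simp: le_less)
            moreover have "p - q = int (block_len (Md i))" using k by (simp add: q_def q0_def)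
            moreover have "\<forall>j<block_len (Md i). rel_right u q j = block_letter (Md i) j"
              using r by simp
            ultimately have "chain_step u \<sigma> p (Md i) q"
              using lq w by (auto simp: chain_step_def)
            then show ?thesis by blast
          qed
        qed
      next
        case u1: True
        show ?thesis
        proof (cases "u (q0 - 2)")
          case False
          define q where "q = q0 - 2"
          have "u x = True" if "q + 1 \<le> x" "x < q0" for x
          proof -
            have "x = q0 - 1" using that by (simp add: q_def)
            then show ?thesis using u1 by simp
          qed
          then have w: "simple_window u (q + 1) p"
            by (rule simple_windowI[of _ q0 u True p True 2 q0]) (use per in auto)
          have uq: "\<not> u q" using False by (simp add: q_def)
          have r0: "rel_right u q 0" using uq u1 by (simp add: rel_right_def q_def)
          have r1: "rel_right u q (1 + m) \<longleftrightarrow> even m" if "m < 2 * i" for m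
          proof -
            have "q + 1 + int (1 + m) = q0 + int m" by (simp add: q_def)
            then show ?thesis using per[of "q0 + int m"] that uq
              by (simp only: rel_right_def) (simp add: q0_def)
          qed
          have r2: "\<not> rel_right u q (2 * i + 1)"
          proof -
            have "q + 1 + int (2 * i + 1) = p" by (simp add: q_def q0_def)
            then show ?thesis using uq p by (simp only: rel_right_def simp_thms)
          qed
          have r3: "rel_right u q (2 * i + 2 + m) = rel_right u p m" for m
          proof -
            have "q + 1 + int (2 * i + 2 + m) = p + 1 + int m" by (simp add: q_def q0_def)
            then show ?thesis using uq p by (simp only: rel_right_def simp_thms)
          qed
          have r: "rel_right u q n \<longleftrightarrow> n = 0 \<or> odd n" if "n \<le> 2 * i" for n
          proof (cases n)
            case (Suc m)
            then show ?thesis using r1[of m] that by simp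
          qed (use r0 in simp)
          \<comment> \<open>For \<open>i = 2\<close> the word is 110100 followed by the word at
            \<open>p\<close>, which begins with 1101: it exceeds \<open>tm\<close> only at the tenth
            letter. For larger i it begins with 110101.\<close>
          have "bad u q"
          proof (cases "i = 2")
            case True
            then show ?thesis using r[of 0] r[of 1] r[of 2] r[of 3] r[of 4] r2 r3[of 0] r3[of 1] r3[of 3]
                e[of 0] e[of 1] e[of 3] i1
              unfolding bad_def by (intro lex_gt_tm_prefix(4)) simp_all
          next
            case False
            then show ?thesis using r[of 0] r[of 1] r[of 2] r[of 3] r[of 4] r[of 5] i(1)
              unfolding bad_def by (intro lex_gt_tm_prefix(3)) simp_all
          qed
          then have lq: "labelled u q (Sm i)" using r i(1) by simp
          have not_Md: "\<sigma> \<noteq> Md i1"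
          proof
            assume s: "\<sigma> = Md i1"
            have "i \<le> i1" using Md_le s by simp
            then have "rel_left u (p + 1) (2 * i + 1)"
              using e_Md[OF _ s] lo l1 u1
              by (intro not_lex_gt_first_diff[OF dom]) auto
            then show False using l1 u1 by simp
          qed
          have "i1 \<le> i"
          proof (rule ccontr)
            assume "\<not> i1 \<le> i"
            then have "rel_left u (p + 1) (2 * i + 1)"
              using e lo l1 u1 by (intro not_lex_gt_first_diff[OF dom]) auto
            then show False using l1 u1 by simp
          qed
          then have "label_less \<sigma> (Sm i) \<or> \<sigma> = Sm i" using \<sigma> not_Md by auto
          moreover have "p - q = int (block_len (Sm i))" by (simp add: q_def q0_def)
          moreover have "\<forall>j<block_len (Sm i). rel_right u q j = block_letter (Sm i) j"
          proof (intro allI impI)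
            fix j assume "j < block_len (Sm i)"
            then have "j \<le> 2 * i \<or> j = 2 * i + 1" by auto
            then show "rel_right u q j = block_letter (Sm i) j" using r[of j] r2
              by (auto simp: le_less)
          qed
          ultimately have "chain_step u \<sigma> p (Sm i) q"
            using lq w by (auto simp: chain_step_def)
          then show ?thesis by blast
        next
          case u2: True
          show ?thesis
          proof (cases "\<forall>x\<le>q0. u x = True")
            case True
            have "simple_window u a p" for a
              by (rule simple_windowI[of a q0 u True p True 2 q0]) (use True per in auto)
            then show ?thesis by (simp add: simple_left_def)
          next
            case False
            then obtain k :: nat where k: "\<not> u (q0 - int k)"
              "\<And>x. q0 - int k < x \<Longrightarrow> x \<le> q0 \<Longrightarrow> u x"
              using run_left[of q0 u True] by auto
            have "k \<noteq> 0" using k(1) uq0 by (intro notI) simp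
            moreover have "k \<noteq> 1" using k(1) u1 by (intro notI) simp
            moreover have "k \<noteq> 2" using k(1) u2 by (intro notI) simp
            ultimately have k3: "3 \<le> k" by linarith
            define q where "q = q0 - int k"
            have w: "simple_window u (q + 1) p"
              by (rule simple_windowI[of _ q0 u True p True 2 q0]) (use k per in \<open>auto simp: q_def\<close>)
            have r1: "rel_right u q n" if "n < k" for n
              using k that by (simp add: rel_right_def q_def)
            have "\<exists>q \<sigma>'. chain_step u \<sigma> p \<sigma>' q"
              by (rule Nr_step[of q k]) (use w r1 k3 i(1) in \<open>auto simp: q_def q0_def\<close>)
            then show ?thesis ..
          qed
        qed
      qed
    qed
  qed
qed

text \<open>Reflection at the edge after \<open>p\<close>: the run of letters equal to
  \<open>u p\<close> that ends at \<open>p\<close> is at least as long as the leading run of 1s to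
  the right. A longer run yields a new label \<open>Nr k\<close>; only equality needs the finer
  analysis of the two preceding lemmas.\<close>

lemma step_other_letter:
  assumes ld: "left_dominated u" and lab: "labelled u p \<sigma>" and p: "\<not> u p"
    and dom: "\<not> lex_gt (rel_right u p) (rel_left u (p + 1))"
  shows "simple_left u p \<or> (\<exists>q \<sigma>'. chain_step u \<sigma> p \<sigma>' q)"
proof -
  have e01: "j < 2 \<Longrightarrow> rel_right u p j" for j
    using labelled_ones[OF lab] by (auto simp: less_2_cases_iff)
  have p1: "u (p + 1)" using e01[of 0] p by (simp add: rel_right_def)
  have l: "rel_left u (p + 1) n \<longleftrightarrow> \<not> u (p - int n)" for n
    using p1 by (simp add: rel_left_def)
  show ?thesis
  proof (cases "\<forall>i\<le>p. u i = False")
    case True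
    then have "simple_left u p"
      unfolding simple_left_def by (intro allI simple_windowI[of _ p u False p]) auto
    then show ?thesis ..
  next
    case False
    then obtain k :: nat where k: "u (p - int k)" "\<And>i. p - int k < i \<Longrightarrow> i \<le> p \<Longrightarrow> \<not> u i"
      using run_left[of p u False] by auto
    have k_ge: "m \<le> k" if "\<And>j. j < m \<Longrightarrow> rel_right u p j" for m
      using not_lex_gt_ones[OF dom that, of m k] k(1) l by (meson not_le)
    have k2: "2 \<le> k" using k_ge[of 2] e01 by blast
    define q where "q = p - int k"
    have r: "rel_right u q j" if "j < k" for j
      using k that by (simp add: rel_right_def q_def)
    have w: "simple_window u (q + 1) p"
      by (rule simple_windowI[of _ p _ False]) (use k in \<open>auto simp: q_def\<close>)
    have up: ?thesis if "3 \<le> k" "label_less \<sigma> (Nr k)"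
    proof -
      have "labelled u q (Nr k)" using r that(1) by (simp add: big_def)
      then have "chain_step u \<sigma> p (Nr k) q"
        using w that by (auto simp: chain_step_def q_def)
      then show ?thesis by blast
    qed
    have flip: ?thesis if bg: "big u p" and k0: "2 \<le> k0" "\<And>j. j < k0 \<Longrightarrow> rel_right u p j" "1 \<le> r"
      "k = k0 \<Longrightarrow> (\<And>j. j < r * (k + 1) \<Longrightarrow> rel_right u p j \<longleftrightarrow> \<not> (k + 1) dvd (j + 1))"
      "\<And>k'. k0 < k' \<Longrightarrow> label_less \<sigma> (Nr k')"
      "\<And>s. k = k0 \<Longrightarrow> r \<le> s \<Longrightarrow> label_less \<sigma> (Fl k s) \<or> \<sigma> = Fl k s" for k0 r
    proof (cases "k = k0")
      case False
      moreover have "k0 \<le> k" by (rule k_ge) (rule k0(2))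
      ultimately have "k0 < k" by simp
      then show ?thesis using up k0(1,5) by simp
    next
      case True
      have "\<forall>j<r * (k + 1). rel_right u p j \<longleftrightarrow> \<not> (k + 1) dvd (j + 1)"
        using k0(4)[OF True] by blast
      moreover have "\<forall>i. p - int k < i \<longrightarrow> i \<le> p \<longrightarrow> \<not> u i" using k(2) by blast
      ultimately have "simple_left u p \<or> (\<exists>q \<sigma>'. q < p \<and> labelled u q \<sigma>' \<and>
        simple_window u (q + 1) p \<and> int (label_size \<sigma>') \<le> p - q \<and>
        ((\<exists>k'>k. \<sigma>' = Nr k') \<or> (\<exists>s\<ge>r. \<sigma>' = Fl k s) \<and> p - q = int (block_len \<sigma>') \<and>
        (\<forall>j<block_len \<sigma>'. rel_right u q j = block_letter \<sigma>' j)))"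
        using step_flip[OF ld p p1 dom k2 k0(3) bg _ k(1)] by blast
      then show ?thesis
      proof (elim disjE exE conjE)
        fix q \<sigma>' k' assume "q < p" "labelled u q \<sigma>'" "simple_window u (q + 1) p"
          "int (label_size \<sigma>') \<le> p - q" "k < k'" "\<sigma>' = Nr k'"
        then have "chain_step u \<sigma> p \<sigma>' q" using k0(5) True by (auto simp: chain_step_def)
        then show ?thesis by blast
      next
        fix q \<sigma>' s assume *: "q < p" "labelled u q \<sigma>'" "simple_window u (q + 1) p"
          "int (label_size \<sigma>') \<le> p - q" "r \<le> s" "\<sigma>' = Fl k s" "p - q = int (block_len \<sigma>')"
          "\<forall>j<block_len \<sigma>'. rel_right u q j = block_letter \<sigma>' j"
        have "label_less \<sigma> \<sigma>' \<or> \<sigma> = \<sigma>'" using k0(6)[OF True *(5)] *(6) by simp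
        then have "chain_step u \<sigma> p \<sigma>' q" using * unfolding chain_step_def by auto
        then show ?thesis by blast
      qed blast
    qed
    show ?thesis
    proof (cases \<sigma>)
      case (Nr k0)
      have "rel_right u p j \<longleftrightarrow> \<not> (k + 1) dvd (j + 1)" if kk: "k = k0" and j: "j < 1 * (k + 1)" for j
      proof (cases "j = k")
        case True
        \<comment> \<open>\<open>Nr k0\<close> says nothing about the letter after its 1s. The left
          word has \<open>k\<close> leading 1s and then 0, so dominance forces a 0 here, and the
          pattern of \<open>step_flip\<close> is available with \<open>r = 1\<close>.\<close>
        have "\<not> rel_right u p k"
        proof
          assume e: "rel_right u p k"
          have "rel_left u (p + 1) k"
          proof (rule not_lex_gt_first_diff[OF dom])
            fix n assume "n < k"
            then show "rel_left u (p + 1) n = rel_right u p n"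
              using lab Nr kk l[of n] k(2)[of "p - int n"] by simp
          qed (use e l[of k] k(1) in simp)
          then show False using l[of k] k(1) by simp
        qed
        then show ?thesis using True by simp
      next
        case False
        then show ?thesis using lab Nr kk j by (auto dest: dvd_imp_le)
      qed
      then show ?thesis by (intro flip[of k0 1]) (use Nr lab in auto)
    next
      case (Fl k0 r)
      have "rel_right u p j" if "j < k0" for j
      proof -
        have "k0 + 1 \<le> r * (k0 + 1)" using lab Fl mult_le_mono1[of 1 r "k0 + 1"] by simp
        then have "rel_right u p j \<longleftrightarrow> \<not> (k0 + 1) dvd (j + 1)" using lab Fl that by simp
        then show ?thesis using that by (auto dest: dvd_imp_le)
      qed
      then show ?thesis by (intro flip[of k0 r]) (use Fl lab in auto)
    next
      case (Sm i)
      show ?thesis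
      proof (cases "3 \<le> k")
        case True then show ?thesis using up Sm by simp
      next
        case False
        then have "k = 2" using k2 by simp
        then show ?thesis using k(1) k(2)[of "p - 1"]
          by (intro step_alternating[OF lab _ p _ _ p1 dom]) (use Sm in auto)
      qed
    next
      case (Md i)
      show ?thesis
      proof (cases "3 \<le> k")
        case True then show ?thesis using up Md by simp
      next
        case False
        then have "k = 2" using k2 by simp
        then show ?thesis using k(1) k(2)[of "p - 1"]
          by (intro step_alternating[OF lab _ p _ _ p1 dom]) (use Md in auto)
      qed
    qed
  qed
qed

theorem chain_step_exists:
  assumes ld: "left_dominated u" and lab: "labelled u p \<sigma>"
  shows "simple_left u p \<or> (\<exists>q \<sigma>'. chain_step u \<sigma> p \<sigma>' q)"
proof -
  have *: "simple_left u p \<or> (\<exists>q \<sigma>'. chain_step u \<sigma> p \<sigma>' q)"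
    if "left_dominated u" "labelled u p \<sigma>" "\<not> u p" for u
  proof -
    have "\<not> lex_gt (rel_right u p) (rel_left u p) \<or> \<not> lex_gt (rel_right u p) (rel_left u (p + 1))"
      using that(1) labelled_bad[OF that(2)] by (auto simp: left_dominated_def)
    then show ?thesis
      using step_same_letter[OF that(2,3)] step_other_letter[OF that] by blast
  qed
  show ?thesis
  proof (cases "u p")
    case True
    then show ?thesis using *[of "\<lambda>i. \<not> u i"] assms
      by (simp add: compl_iffs labelled_compl simple_left_compl chain_step_compl)
  next
    case False
    then show ?thesis using * assms by blast
  qed
qed


section \<open>Chains with constant label\<close>

text \<open>A truncation monotone for \<open>label_less\<close>. \<open>Sm i\<close> rises to K and
  \<open>Md i\<close> descends to K, by truncated subtraction, so they meet there. \<open>Nr\<close>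
  and \<open>Fl\<close> are written in base \<open>K + 2\<close>: the upper digit is
  \<open>min k K\<close>, and the lower digit 0 is kept for \<open>Nr\<close> and for
  \<open>Fl\<close> with large k.\<close>

fun label_code :: "nat \<Rightarrow> label \<Rightarrow> nat" where
  "label_code K (Sm i) = min i K"
| "label_code K (Md i) = K + (K - i)"
| "label_code K (Nr k) = 2 * K + min k K * (K + 2)"
| "label_code K (Fl k r) = 2 * K + min k K * (K + 2) + (if K \<le> k then 0 else 1 + min r K)"

lemma label_code_le: "label_code K \<sigma> \<le> 2 * K + K * (K + 2) + (K + 1)"
proof -
  have "min k K * (K + 2) \<le> K * (K + 2)" for k by (intro mult_le_mono1) simp
  from this[of "case \<sigma> of Nr k \<Rightarrow> k | Fl k r \<Rightarrow> k | _ \<Rightarrow> 0"] show ?thesis by (cases \<sigma>) auto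
qed

lemma label_code_mono:
  assumes "label_less \<sigma> \<sigma>'"
  shows "label_code K \<sigma> \<le> label_code K \<sigma>'"
proof -
  have le: "min k K * (K + 2) \<le> min k' K * (K + 2)" if "k \<le> k'" for k k'
    using that by (intro mult_le_mono1) auto
  have less: "min k K * (K + 2) + (if K \<le> k then 0 else 1 + min r K) \<le> min k' K * (K + 2)"
    if "k < k'" for k k' r
  proof (cases "K \<le> k")
    case False
    then have "Suc k * (K + 2) \<le> min k' K * (K + 2)" using that by (intro mult_le_mono1) auto
    then show ?thesis using False by auto
  qed (use that in auto)
  show ?thesis
  proof (cases \<sigma>)
    case (Sm i) then show ?thesis using assms by (cases \<sigma>') auto
  next
    case (Md i) then show ?thesis using assms by (cases \<sigma>') auto
  next
    case (Nr k)
    show ?thesis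
    proof (cases \<sigma>')
      case (Nr k') then show ?thesis using assms \<open>\<sigma> = Nr k\<close> le[of k k'] by simp
    next
      case (Fl k' r) then show ?thesis using assms \<open>\<sigma> = Nr k\<close> le[of k k'] by simp
    qed (use assms Nr in auto)
  next
    case (Fl k r)
    show ?thesis
    proof (cases \<sigma>')
      case (Nr k') then show ?thesis using assms Fl less[of k k' r] by simp
    next
      case (Fl k' r')
      then show ?thesis using assms \<open>\<sigma> = Fl k r\<close> less[of k k' r] by auto
    qed (use assms Fl in auto)
  qed
qed

lemma label_less_irrefl: "\<not> label_less \<sigma> \<sigma>"
  by (cases \<sigma>) auto

text \<open>Codes lose information only where a \<open>min\<close> or a truncated difference takes
  effect. Occurring labels have \<open>2 \<le> k\<close>, which for positive K keeps
  \<open>Nr\<close> and \<open>Fl\<close> above \<open>2 * K\<close>, the top of the range of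
  \<open>Sm\<close> and \<open>Md\<close>.\<close>

lemma label_code_eq:
  assumes "label_code K \<sigma> = label_code K \<sigma>'" and lab: "labelled u p \<sigma>" "labelled v q \<sigma>'"
  shows "\<sigma> = \<sigma>' \<or> K \<le> label_size \<sigma> \<and> K \<le> label_size \<sigma>'"
proof -
  have digits: "a = a' \<and> b = b'"
    if "a * (K + 2) + b = a' * (K + 2) + b'" "b < K + 2" "b' < K + 2" for a b a' b'
  proof -
    have *: "(a * n + b) div n = a" "(a * n + b) mod n = b" if "b < n" for a b n :: nat
      using that by simp_all
    show ?thesis using *[OF that(2), of a] *[OF that(3), of a'] that(1) by metis
  qed
  have pos: "K \<noteq> 0 \<Longrightarrow> 1 \<le> min k K * (K + 2)" if "2 \<le> k" for k
    using that by simp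
  define \<beta> where "\<beta> k r = (if K \<le> k then 0 else 1 + min r K)" for k r
  have \<beta>: "\<beta> k r < K + 2" for k r by (simp add: \<beta>_def less_Suc_eq_le)
  have code: "label_code K (Fl k r) = 2 * K + min k K * (K + 2) + \<beta> k r" for k r
    by (simp add: \<beta>_def)
  note eq = assms(1)
  show ?thesis
  proof (cases \<sigma>)
    case (Sm i)
    show ?thesis
    proof (cases \<sigma>')
      case (Nr k) then show ?thesis using eq Sm lab pos[of k] by auto
    next
      case (Fl k r) then show ?thesis using eq Sm lab pos[of k] by (auto simp del: label_code.simps(4) simp: code)
    qed (use eq Sm lab in auto)
  next
    case (Md i)
    show ?thesis
    proof (cases \<sigma>')
      case (Nr k) then show ?thesis using eq Md lab pos[of k] by auto
    next
      case (Fl k r) then show ?thesis using eq Md lab pos[of k] by (auto simp del: label_code.simps(4) simp: code)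
    qed (use eq Md lab in auto)
  next
    case (Nr k)
    have k: "2 \<le> k" using lab Nr by simp
    show ?thesis
    proof (cases \<sigma>')
      case (Nr k')
      have "min k K * (K + 2) + 0 = min k' K * (K + 2) + 0"
        using eq Nr \<open>\<sigma> = Nr k\<close> by simp
      from digits[OF this] have "min k K = min k' K" by simp
      then show ?thesis using Nr \<open>\<sigma> = Nr k\<close> by (auto simp: min_def split: if_splits)
    next
      case (Fl k' r)
      have "min k K * (K + 2) + 0 = min k' K * (K + 2) + \<beta> k' r"
        using eq Fl Nr code[of k' r] by simp
      from digits[OF this] \<beta>[of k' r] have "min k K = min k' K" "\<beta> k' r = 0" by simp_all
      then show ?thesis using Nr Fl by (auto simp: min_def \<beta>_def split: if_splits)
    qed (use eq Nr k pos[of k] in auto)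
  next
    case (Fl k r)
    have k: "2 \<le> k" using lab Fl by simp
    show ?thesis
    proof (cases \<sigma>')
      case (Nr k')
      have "min k K * (K + 2) + \<beta> k r = min k' K * (K + 2) + 0"
        using eq Fl Nr code[of k r] by simp
      from digits[OF this] \<beta>[of k r] have "min k K = min k' K" "\<beta> k r = 0" by simp_all
      then show ?thesis using Nr Fl by (auto simp: min_def \<beta>_def split: if_splits)
    next
      case (Fl k' r')
      have "min k K * (K + 2) + \<beta> k r = min k' K * (K + 2) + \<beta> k' r'"
        using eq Fl \<open>\<sigma> = Fl k r\<close> code[of k r] code[of k' r'] by simp
      from digits[OF this] \<beta> have "min k K = min k' K" "\<beta> k r = \<beta> k' r'" by simp_all
      then show ?thesis using Fl \<open>\<sigma> = Fl k r\<close> by (auto simp: min_def \<beta>_def split: if_splits)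
    qed (use eq Fl k pos[of k] in \<open>auto simp del: label_code.simps(4) simp: code\<close>)
  qed
qed

text \<open>\<open>None\<close> stands for the requirement that all blocks are long, \<open>Some \<sigma>\<close> for the requirement
  that all blocks are the one determined by \<open>\<sigma>\<close>.\<close>

fun link :: "nat \<Rightarrow> label option \<Rightarrow> (int \<Rightarrow> bool) \<Rightarrow> int \<Rightarrow> int \<Rightarrow> bool" where
  "link K None u q p \<longleftrightarrow> int K \<le> p - q"
| "link K (Some \<sigma>) u q p \<longleftrightarrow> p - q = int (block_len \<sigma>) \<and>
     (\<forall>j<block_len \<sigma>. rel_right u q j = block_letter \<sigma> j)"

text \<open>The base case covers both a word that is simple all the way to the left and a block cut
  by the left end \<open>a\<close>.\<close>

inductive chained :: "nat \<Rightarrow> label option \<Rightarrow> (int \<Rightarrow> bool) \<Rightarrow> int \<Rightarrow> int \<Rightarrow> bool"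
  for K \<tau> u a where
  base: "a \<le> p \<Longrightarrow> simple_window u a p \<Longrightarrow> chained K \<tau> u a p"
| step: "chained K \<tau> u a q \<Longrightarrow> a \<le> q \<Longrightarrow> q < p \<Longrightarrow> simple_window u (q + 1) p \<Longrightarrow>
    link K \<tau> u q p \<Longrightarrow> chained K \<tau> u a p"

text \<open>With constant code, either all labels coincide, and since they do not grow every gap is
  the forced block, or all have size at least K and every gap is long. The predicate
  \<open>P\<close> lets one induction serve both chains followed to the left without limit and
  chains kept to the right of a bound \<open>N\<close>.\<close>

lemma chained_of_constant_code:
  assumes ld: "left_dominated u"
    and P: "\<And>q \<sigma>. P q \<sigma> \<Longrightarrow> labelled u q \<sigma> \<and> label_code K \<sigma> = c"
    and closed: "\<And>q \<sigma> q' \<sigma>'. P q \<sigma> \<Longrightarrow> chain_step u \<sigma> q \<sigma>' q' \<Longrightarrow> N \<le> q' \<Longrightarrow> P q' \<sigma>'"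
    and p0: "P p0 \<sigma>0" and \<tau>: "\<tau> = (if K \<le> label_size \<sigma>0 then None else Some \<sigma>0)"
    and a: "N \<le> a"
  shows "P p \<sigma> \<Longrightarrow> a \<le> p \<Longrightarrow> chained K \<tau> u a p"
proof (induction "nat (p - a)" arbitrary: p \<sigma> rule: less_induct)
  case less
  have lab: "labelled u p \<sigma>" using P less.prems by blast
  consider "simple_left u p" | q \<sigma>' where "chain_step u \<sigma> p \<sigma>' q"
    using chain_step_exists[OF ld lab] by blast
  then show ?case
  proof cases
    case 1
    then show ?thesis using less.prems by (intro chained.base) (auto simp: simple_left_def)
  next
    case 2
    have st: "q < p" "simple_window u (q + 1) p" "int (label_size \<sigma>') \<le> p - q"
      and disj: "label_less \<sigma> \<sigma>' \<or> \<sigma> = \<sigma>' \<and> link K (Some \<sigma>) u q p"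
      using 2 unfolding chain_step_def link.simps by blast+
    show ?thesis
    proof (cases "a \<le> q")
      case False
      then have "simple_window u a p" using st by (intro simple_window_mono[OF st(2)]) auto
      then show ?thesis using less.prems by (intro chained.base)
    next
      case True
      have P': "P q \<sigma>'" using closed[OF less.prems(1) 2] True a by simp
      have "chained K \<tau> u a q"
        by (rule less.hyps[OF _ P' True]) (use st True in auto)
      moreover have "link K \<tau> u q p"
      proof (cases "K \<le> label_size \<sigma>0")
        case capped: True
        have "K \<le> label_size \<sigma>'"
          using label_code_eq[of K \<sigma>' \<sigma>0 u q u p0] P[OF P'] P[OF p0] capped by auto
        then show ?thesis using \<tau> capped st(3) by simp
      next
        case False
        then have "\<sigma>' = \<sigma>0" "\<sigma> = \<sigma>0"
          using label_code_eq[of K \<sigma>' \<sigma>0 u q u p0] label_code_eq[of K \<sigma> \<sigma>0 u p u p0]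
            P[OF P'] P[OF p0] P[OF less.prems(1)] by auto
        then show ?thesis using \<tau> False disj label_less_irrefl[of \<sigma>0] by (simp del: link.simps)
      qed
      ultimately show ?thesis by (rule chained.step[OF _ True st(1,2)])
    qed
  qed
qed

lemma chain_step_code_mono:
  "chain_step u \<sigma> p \<sigma>' q \<Longrightarrow> label_code K \<sigma> \<le> label_code K \<sigma>'"
  using label_code_mono by (auto simp: chain_step_def)

text \<open>Codes are bounded and do not decrease along chains. From a reachable position of maximal
  code on, the code is constant.\<close>

lemma chained_left:
  assumes ld: "left_dominated u" and "bad u p"
  shows "\<exists>\<tau> p'. \<forall>a\<le>p'. chained K \<tau> u a p'"
proof -
  obtain \<sigma> where lab: "labelled u p \<sigma>" using bad_imp_labelled assms(2) by blast
  define R where "R = (\<lambda>(p, \<sigma>) (q, \<sigma>'). chain_step u \<sigma> p \<sigma>' q)"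
  define S where "S = R\<^sup>*\<^sup>*"
  have lab_S: "labelled u (fst y) (snd y)" if "S (p, \<sigma>) y" for y
    using that unfolding S_def by (induction) (use lab in \<open>auto simp: R_def chain_step_def\<close>)
  have "\<exists>x. S (p, \<sigma>) x \<and> (\<forall>y. S (p, \<sigma>) y \<longrightarrow> label_code K (snd y) \<le> label_code K (snd x))"
    by (rule ex_has_greatest_nat[of _ "(p, \<sigma>)" _ "2 * K + K * (K + 2) + (K + 1) + 1"])
      (use label_code_le in \<open>auto simp: S_def less_Suc_eq_le\<close>)
  then obtain p0 \<sigma>0 where x: "S (p, \<sigma>) (p0, \<sigma>0)"
    and max: "\<And>y. S (p, \<sigma>) y \<Longrightarrow> label_code K (snd y) \<le> label_code K \<sigma>0" by auto
  have mono: "label_code K \<sigma>0 \<le> label_code K (snd y)" if "S (p0, \<sigma>0) y" for y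
    using that unfolding S_def
    by (induction) (use chain_step_code_mono order_trans in \<open>fastforce simp: R_def\<close>)+
  have trans: "S (p, \<sigma>) y" if "S (p0, \<sigma>0) y" for y
    using x that unfolding S_def by simp
  have "chained K (if K \<le> label_size \<sigma>0 then None else Some \<sigma>0) u a p0" if "a \<le> p0" for a
  proof (rule chained_of_constant_code[OF ld, where N = a and P = "\<lambda>q \<sigma>'. S (p0, \<sigma>0) (q, \<sigma>')"])
    show "labelled u q \<sigma>' \<and> label_code K \<sigma>' = label_code K \<sigma>0" if "S (p0, \<sigma>0) (q, \<sigma>')" for q \<sigma>'
      using lab_S[OF trans[OF that]] mono[OF that] max[OF trans[OF that]] by simp
    show "S (p0, \<sigma>0) (q', \<sigma>'')" if "S (p0, \<sigma>0) (q, \<sigma>')" "chain_step u \<sigma>' q \<sigma>'' q'" for q \<sigma>' q' \<sigma>''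
    proof -
      have "R (q, \<sigma>') (q', \<sigma>'')" using that(2) by (simp add: R_def)
      with that(1) show ?thesis unfolding S_def by (rule rtranclp.rtrancl_into_rtrancl)
    qed
  qed (use that in \<open>auto simp: S_def\<close>)
  then show ?thesis by blast
qed

text \<open>A maximum along a single chain would not control positions further right. Instead
  \<open>c\<close> is the largest code met arbitrarily far to the right: beyond some
  \<open>N\<close> no code exceeds it, and a chain started at code \<open>c\<close> cannot fall
  below it, so every such chain keeps the code \<open>c\<close> down to \<open>N\<close>.\<close>

lemma chained_right:
  assumes ld: "left_dominated u" and "\<forall>N. \<exists>p\<ge>N. bad u p"
  shows "\<exists>\<tau> a. \<forall>b. \<exists>p\<ge>b. chained K \<tau> u a p"
proof -
  define Q where "Q c \<longleftrightarrow> (\<forall>N. \<exists>p\<ge>N. \<exists>\<sigma>. labelled u p \<sigma> \<and> c \<le> label_code K \<sigma>)" for c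
  have Q0: "Q 0" unfolding Q_def using assms(2) bad_imp_labelled by (metis le0)
  have Q_le: "c \<le> 2 * K + K * (K + 2) + (K + 1)" if "Q c" for c
    using that label_code_le[of K] order_trans unfolding Q_def by blast
  obtain c where c: "Q c" "\<And>d. Q d \<Longrightarrow> d \<le> c"
    using GreatestI_nat[of Q, OF Q0] Greatest_le_nat[of Q] Q_le by blast
  then have "\<not> Q (Suc c)" by fastforce
  then obtain N where N: "\<And>p \<sigma>. N \<le> p \<Longrightarrow> labelled u p \<sigma> \<Longrightarrow> label_code K \<sigma> \<le> c"
    unfolding Q_def by (meson not_less_eq_eq)
  define P where "P q \<sigma> \<longleftrightarrow> N \<le> q \<and> labelled u q \<sigma> \<and> label_code K \<sigma> = c" for q \<sigma>
  have ex: "\<exists>p\<ge>M. \<exists>\<sigma>. P p \<sigma>" for M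
  proof -
    obtain p \<sigma> where "max M N \<le> p" "labelled u p \<sigma>" "c \<le> label_code K \<sigma>"
      using c(1) unfolding Q_def by blast
    then show ?thesis using N[of p \<sigma>] unfolding P_def by (metis antisym max.bounded_iff)
  qed
  obtain p0 \<sigma>0 where p0: "P p0 \<sigma>0" using ex by blast
  define \<tau> where "\<tau> = (if K \<le> label_size \<sigma>0 then None else Some \<sigma>0)"
  have "chained K \<tau> u N p" if "P p \<sigma>" "N \<le> p" for p \<sigma>
  proof (rule chained_of_constant_code[OF ld _ _ p0 \<tau>_def order_refl that])
    show "labelled u q \<sigma> \<and> label_code K \<sigma> = c" if "P q \<sigma>" for q \<sigma> using that by (simp add: P_def)
    show "P q' \<sigma>'" if "P q \<sigma>" "chain_step u \<sigma> q \<sigma>' q'" "N \<le> q'" for q \<sigma> q' \<sigma>'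
      using that(1,3) chain_step_code_mono[OF that(2), of K] N[of q' \<sigma>'] that(2)
      unfolding P_def chain_step_def by (simp add: antisym)
  qed
  then show ?thesis using ex unfolding P_def by meson
qed

definition cut_window :: "nat \<Rightarrow> label option \<Rightarrow> (int \<Rightarrow> bool) \<Rightarrow> int \<Rightarrow> int \<Rightarrow> bool" where
  "cut_window K \<tau> u a b \<longleftrightarrow> simple_window u a b \<or>
     (\<exists>q. a \<le> q \<and> q < b \<and> chained K \<tau> u a q \<and> simple_window u (q + 1) b)"

lemma chained_cut: "chained K \<tau> u a p \<Longrightarrow> b \<le> p \<Longrightarrow> cut_window K \<tau> u a b"
proof (induction rule: chained.induct)
  case (base p)
  then show ?case using simple_window_mono[of u a p a b] by (simp add: cut_window_def)
next
  case (step q p)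
  show ?case
  proof (cases "b \<le> q")
    case False
    then show ?thesis using step simple_window_mono[of u "q + 1" p "q + 1" b]
      unfolding cut_window_def by (metis not_le order_refl)
  qed (use step in simp)
qed


section \<open>Counting words\<close>

definition word :: "(int \<Rightarrow> bool) \<Rightarrow> int \<Rightarrow> nat \<Rightarrow> bool list" where
  "word u a n = map (\<lambda>i. u (a + int i)) [0..<n]"

lemma length_word [simp]: "length (word u a n) = n"
  by (simp add: word_def)

lemma nth_word [simp]: "i < n \<Longrightarrow> word u a n ! i = u (a + int i)"
  by (simp add: word_def)

lemma word_append: "word u a (m + n) = word u a m @ word u (a + int m) n"
  by (rule nth_equalityI) (auto simp: nth_append algebra_simps)

lemma finite_bool_lists: "finite {xs :: bool list. length xs = n}"
  using finite_lists_length_eq[of "UNIV :: bool set" n] by simp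

definition simple_words :: "nat \<Rightarrow> bool list set" where
  "simple_words n = {word u a n |u a. simple_window u a (a + int n)}"

definition chained_words :: "nat \<Rightarrow> label option \<Rightarrow> nat \<Rightarrow> bool list set" where
  "chained_words K \<tau> n = {word u a (Suc n) |u a. chained K \<tau> u a (a + int n)}"

definition cut_words :: "nat \<Rightarrow> label option \<Rightarrow> nat \<Rightarrow> bool list set" where
  "cut_words K \<tau> n = {word u a n |u a. cut_window K \<tau> u a (a + int n)}"

lemma simple_wordsI: "simple_window u a (a + int n) \<Longrightarrow> word u a n \<in> simple_words n"
  by (auto simp: simple_words_def)

lemma chained_wordsI: "chained K \<tau> u a (a + int n) \<Longrightarrow> word u a (Suc n) \<in> chained_words K \<tau> n"
  by (auto simp: chained_words_def)

lemma finite_words: "finite (simple_words n)" "finite (chained_words K \<tau> n)" "finite (cut_words K \<tau> n)"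
  by (rule finite_subset[OF _ finite_bool_lists[of n]];
      auto simp: simple_words_def cut_words_def)
     (rule finite_subset[OF _ finite_bool_lists[of "Suc n"]], auto simp: chained_words_def,
      rule finite_subset[OF _ finite_bool_lists[of n]], auto simp: cut_words_def)

text \<open>Within n places a modulus that is 0 or larger than n meets its class at most once and
  can be replaced by \<open>n + 1\<close>; an empty class is replaced by modulus 1 with the other
  letter. Moduli are stored as \<open>\<pi> + 1\<close> to exclude 0.\<close>

lemma simple_word_parameters:
  assumes "simple_window u a (a + int n)"
  shows "\<exists>j\<le>n. \<exists>\<pi>\<le>n. \<exists>s\<le>n. \<exists>c v. word u a n =
    map (\<lambda>i. if i < j then c else v = (int (\<pi> + 1) dvd int i - int s)) [0..<n]"
  using assms
proof (rule simple_windowE)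
  fix j' c \<pi>' s' v
  assume const: "\<And>i. a \<le> i \<Longrightarrow> i < j' \<Longrightarrow> u i = c"
    and per: "\<And>i. j' \<le> i \<Longrightarrow> i < a + int n \<Longrightarrow> (u i = v) = (\<pi>' dvd i - s')"
  define j where "j = min n (nat (j' - a))"
  have const': "u (a + int i) = c" if "i < j" for i using that by (intro const) (auto simp: j_def)
  have per': "(u (a + int i) = v) = (\<pi>' dvd a + int i - s')" if "\<not> i < j" "i < n" for i
    using that by (intro per) (auto simp: j_def)
  have wd: "word u a n = map (\<lambda>i. if i < j then c else v' = (int (\<pi> + 1) dvd int i - int s)) [0..<n]"
    if "\<And>i. \<not> i < j \<Longrightarrow> i < n \<Longrightarrow> u (a + int i) = (v' = (int (\<pi> + 1) dvd int i - int s))" for \<pi> s v'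
    using const' that by (intro nth_equalityI) auto
  show ?thesis
  proof (cases "\<exists>i0. \<not> i0 < j \<and> i0 < n \<and> \<pi>' dvd a + int i0 - s'")
    case False
    then have "u (a + int i) = ((\<not> v) = (int (0 + 1) dvd int i - int 0))" if "\<not> i < j" "i < n" for i
      using per'[OF that] that by auto
    from wd[OF this] show ?thesis by (intro exI[of _ j] exI[of _ 0] exI[of _ c] exI[of _ "\<not> v"] conjI) (auto simp: j_def)
  next
    case True
    then obtain i0 where i0: "\<not> i0 < j" "i0 < n" "\<pi>' dvd a + int i0 - s'" by blast
    have dvd_iff: "\<pi>' dvd a + int i - s' \<longleftrightarrow> \<pi>' dvd int i - int i0" for i
    proof -
      have "a + int i - s' = (a + int i0 - s') + (int i - int i0)" by simp
      then show ?thesis using i0(3) by (metis dvd_add_right_iff)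
    qed
    have "\<exists>\<pi>\<le>n. \<forall>i<n. \<pi>' dvd int i - int i0 \<longleftrightarrow> int (\<pi> + 1) dvd int i - int i0"
    proof (cases "\<pi>' \<noteq> 0 \<and> \<bar>\<pi>'\<bar> \<le> int n")
      case True
      then have "int (nat \<bar>\<pi>'\<bar> - 1 + 1) = \<bar>\<pi>'\<bar>" by (simp add: nat_le_iff)
      then show ?thesis using True by (intro exI[of _ "nat \<bar>\<pi>'\<bar> - 1"]) (auto simp: nat_le_iff)
    next
      case False
      have "\<pi>' dvd int i - int i0 \<longleftrightarrow> i = i0" if "i < n" for i
      proof
        assume d: "\<pi>' dvd int i - int i0"
        show "i = i0"
        proof (rule ccontr)
          assume "i \<noteq> i0"
          then have "\<bar>\<pi>'\<bar> \<le> \<bar>int i - int i0\<bar>" using d by (intro dvd_imp_le_int) auto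
          moreover have "\<bar>int i - int i0\<bar> < int n" using that i0 by auto
          moreover have "\<pi>' \<noteq> 0" using d \<open>i \<noteq> i0\<close> by auto
          ultimately show False using False by auto
        qed
      qed simp
      moreover have "int (n + 1) dvd int i - int i0 \<longleftrightarrow> i = i0" if "i < n" for i
      proof
        assume d: "int (n + 1) dvd int i - int i0"
        show "i = i0"
        proof (rule ccontr)
          assume "i \<noteq> i0"
          then have "\<bar>int (n + 1)\<bar> \<le> \<bar>int i - int i0\<bar>" using d by (intro dvd_imp_le_int) auto
          moreover have "\<bar>int i - int i0\<bar> < int n" using that i0 by auto
          ultimately show False by auto
        qed
      qed simp
      ultimately show ?thesis by (intro exI[of _ n]) auto
    qed
    then obtain \<pi> where \<pi>: "\<pi> \<le> n" "\<And>i. i < n \<Longrightarrow> \<pi>' dvd int i - int i0 \<longleftrightarrow> int (\<pi> + 1) dvd int i - int i0"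
      by blast
    have "u (a + int i) = (v = (int (\<pi> + 1) dvd int i - int i0))" if "\<not> i < j" "i < n" for i
      using per'[OF that] \<pi>(2)[OF that(2)] dvd_iff[of i] by auto
    from wd[OF this] show ?thesis using \<pi>(1) i0(2) by (intro exI[of _ j] conjI exI[of _ \<pi>] exI[of _ i0] exI[of _ c] exI[of _ v]) (auto simp: j_def)
  qed
qed

lemma card_simple_words: "card (simple_words n) \<le> 4 * (n + 1) ^ 3"
proof -
  define F where "F = (\<lambda>(j, \<pi>, s, c, v). map (\<lambda>i. if i < j then c else v = (int (\<pi> + 1) dvd int i - int s)) [0..<n])"
  let ?P = "{..n} \<times> {..n} \<times> {..n} \<times> (UNIV :: bool set) \<times> (UNIV :: bool set)"
  have "simple_words n \<subseteq> F ` ?P"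
  proof
    fix w assume "w \<in> simple_words n"
    then obtain u a where w: "w = word u a n" "simple_window u a (a + int n)" by (auto simp: simple_words_def)
    from simple_word_parameters[OF w(2)] obtain j \<pi> s c v where
      "j \<le> n" "\<pi> \<le> n" "s \<le> n"
      "word u a n = map (\<lambda>i. if i < j then c else v = (int (\<pi> + 1) dvd int i - int s)) [0..<n]"
      by (elim exE conjE)
    then show "w \<in> F ` ?P" unfolding w F_def by (intro image_eqI[of _ _ "(j, \<pi>, s, c, v)"]) auto
  qed
  then have "card (simple_words n) \<le> card (F ` ?P)" by (intro card_mono) auto
  also have "\<dots> \<le> card ?P" by (rule card_image_le) simp
  also have "\<dots> = 4 * (n + 1) ^ 3" by (simp add: card_cartesian_product power3_eq_cube algebra_simps)
  finally show ?thesis .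
qed

lemma chained_wordsE:
  assumes "w \<in> chained_words K \<tau> n"
  obtains u a where "w = word u a n @ [u (a + int n)]" "simple_window u a (a + int n)"
  | u a d where "1 \<le> d" "d \<le> n" "chained K \<tau> u a (a + int (n - d))"
      "link K \<tau> u (a + int (n - d)) (a + int n)"
      "simple_window u (a + int (n - d) + 1) (a + int (n - d) + 1 + int (d - 1))"
      "w = word u a (Suc (n - d)) @ word u (a + int (n - d) + 1) d"
proof -
  obtain u a where w: "w = word u a (Suc n)" and ch: "chained K \<tau> u a (a + int n)"
    using assms by (auto simp: chained_words_def)
  have w1: "word u a (Suc n) = word u a n @ [u (a + int n)]"
    using word_append[of u a n 1] by (simp add: word_def)
  from ch show ?thesis
  proof cases
    case base
    then show ?thesis using that(1) w w1 by blast
  next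
    case (step q)
    define d where "d = nat (a + int n - q)"
    have d: "1 \<le> d" "d \<le> n" "q = a + int (n - d)" using step by (auto simp: d_def of_nat_diff)
    have "word u a (Suc n) = word u a (Suc (n - d)) @ word u (a + int (n - d) + 1) d"
      using word_append[of u a "Suc (n - d)" d] d by (simp add: algebra_simps)
    moreover have "a + int (n - d) + 1 + int (d - 1) = a + int n" using d by (simp add: of_nat_diff)
    ultimately show ?thesis using that(2)[of d u a] step d w by simp
  qed
qed

text \<open>The last block is split off: its first \<open>d - 1\<close> letters form a simple word
  and the letter at \<open>p\<close> is free, whence the factor 2.\<close>

lemma card_chained_words_long:
  "card (chained_words K None n) \<le> 2 * card (simple_words n) +
     (\<Sum>d\<in>{1..n} \<inter> {K..}. 2 * card (simple_words (d - 1)) * card (chained_words K None (n - d)))"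
proof -
  define A where "A = (\<lambda>(g, b). g @ [b :: bool]) ` (simple_words n \<times> UNIV)"
  define B where "B d = (\<lambda>(v, g, b). v @ g @ [b :: bool]) ` (chained_words K None (n - d) \<times> simple_words (d - 1) \<times> UNIV)" for d
  have cA: "card A \<le> 2 * card (simple_words n)"
    unfolding A_def by (rule order_trans[OF card_image_le]) (auto simp: finite_words card_cartesian_product)
  have cB: "card (B d) \<le> 2 * card (simple_words (d - 1)) * card (chained_words K None (n - d))" for d
    unfolding B_def by (rule order_trans[OF card_image_le]) (auto simp: finite_words card_cartesian_product)
  have fin: "finite A" "finite (B d)" for d by (auto simp: A_def B_def finite_words)
  have "chained_words K None n \<subseteq> A \<union> (\<Union>d\<in>{1..n} \<inter> {K..}. B d)"
  proof
    fix w assume "w \<in> chained_words K None n"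
    then show "w \<in> A \<union> (\<Union>d\<in>{1..n} \<inter> {K..}. B d)"
    proof (cases rule: chained_wordsE)
      case (1 u a)
      then have "w \<in> A" unfolding A_def by (intro image_eqI[of _ _ "(word u a n, u (a + int n))"]) (auto simp: simple_words_def)
      then show ?thesis by blast
    next
      case (2 u a d)
      have "w \<in> B d" unfolding B_def
      proof (rule image_eqI)
        let ?q = "a + int (n - d)"
        show "w = (case (word u a (Suc (n - d)), word u (?q + 1) (d - 1), u (a + int n)) of (v, g, b) \<Rightarrow> v @ g @ [b])"
          using word_append[of u "?q + 1" "d - 1" 1] 2 by (simp add: word_def of_nat_diff)
        show "(word u a (Suc (n - d)), word u (?q + 1) (d - 1), u (a + int n)) \<in>
          chained_words K None (n - d) \<times> simple_words (d - 1) \<times> UNIV"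
          using 2(3,5) by (intro SigmaI simple_wordsI chained_wordsI UNIV_I)
      qed
      moreover have "K \<le> d" using 2 by simp
      ultimately show ?thesis using 2 by auto
    qed
  qed
  then have "card (chained_words K None n) \<le> card (A \<union> (\<Union>d\<in>{1..n} \<inter> {K..}. B d))"
    by (intro card_mono) (use fin in auto)
  also have "\<dots> \<le> card A + card (\<Union>d\<in>{1..n} \<inter> {K..}. B d)" by (rule card_Un_le)
  also have "\<dots> \<le> card A + (\<Sum>d\<in>{1..n} \<inter> {K..}. card (B d))" by (intro add_left_mono card_UN_le) simp
  also have "\<dots> \<le> 2 * card (simple_words n) +
     (\<Sum>d\<in>{1..n} \<inter> {K..}. 2 * card (simple_words (d - 1)) * card (chained_words K None (n - d)))"
    using cA cB by (intro add_mono sum_mono)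
  finally show ?thesis .
qed

text \<open>The last block, including the letter at \<open>p\<close>, is computed from the letter at
  \<open>q\<close>, so splitting it off leaves one continuation for each word.\<close>

lemma card_chained_words_det:
  "card (chained_words K (Some \<sigma>) n) \<le> 2 * card (simple_words n) +
     (\<Sum>d\<in>{1..n} \<inter> {block_len \<sigma>}. card (chained_words K (Some \<sigma>) (n - d)))"
proof -
  define A where "A = (\<lambda>(g, b). g @ [b :: bool]) ` (simple_words n \<times> UNIV)"
  define B where "B d = (\<lambda>v. v @ map (\<lambda>j. block_letter \<sigma> j \<noteq> last v) [0..<d]) ` chained_words K (Some \<sigma>) (n - d)" for d
  have cA: "card A \<le> 2 * card (simple_words n)"
    unfolding A_def by (rule order_trans[OF card_image_le]) (auto simp: finite_words card_cartesian_product)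
  have cB: "card (B d) \<le> card (chained_words K (Some \<sigma>) (n - d))" for d
    unfolding B_def by (rule card_image_le) (auto simp: finite_words)
  have fin: "finite A" "finite (B d)" for d by (auto simp: A_def B_def finite_words)
  have "chained_words K (Some \<sigma>) n \<subseteq> A \<union> (\<Union>d\<in>{1..n} \<inter> {block_len \<sigma>}. B d)"
  proof
    fix w assume "w \<in> chained_words K (Some \<sigma>) n"
    then show "w \<in> A \<union> (\<Union>d\<in>{1..n} \<inter> {block_len \<sigma>}. B d)"
    proof (cases rule: chained_wordsE)
      case (1 u a)
      then have "w \<in> A" unfolding A_def by (intro image_eqI[of _ _ "(word u a n, u (a + int n))"]) (auto simp: simple_words_def)
      then show ?thesis by blast
    next
      case (2 u a d)
      let ?q = "a + int (n - d)"
      have d: "d = block_len \<sigma>" using 2 by (simp add: of_nat_diff)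
      have l: "rel_right u ?q j = block_letter \<sigma> j" if "j < d" for j using 2 that d by simp
      have "last (word u a (Suc (n - d))) = u ?q" by (simp add: word_def)
      moreover have "word u (?q + 1) d = map (\<lambda>j. block_letter \<sigma> j \<noteq> u ?q) [0..<d]"
        using l by (intro nth_equalityI) (auto simp: rel_right_def)
      ultimately have "w \<in> B d" unfolding B_def using 2
        by (intro image_eqI[of _ _ "word u a (Suc (n - d))"]) (auto simp: chained_words_def)
      then show ?thesis using 2 d by auto
    qed
  qed
  then have "card (chained_words K (Some \<sigma>) n) \<le> card (A \<union> (\<Union>d\<in>{1..n} \<inter> {block_len \<sigma>}. B d))"
    by (intro card_mono) (use fin in auto)
  also have "\<dots> \<le> card A + card (\<Union>d\<in>{1..n} \<inter> {block_len \<sigma>}. B d)" by (rule card_Un_le)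
  also have "\<dots> \<le> card A + (\<Sum>d\<in>{1..n} \<inter> {block_len \<sigma>}. card (B d))" by (intro add_left_mono card_UN_le) simp
  also have "\<dots> \<le> 2 * card (simple_words n) +
     (\<Sum>d\<in>{1..n} \<inter> {block_len \<sigma>}. card (chained_words K (Some \<sigma>) (n - d)))"
    using cA cB by (intro add_mono sum_mono)
  finally show ?thesis .
qed

lemma card_cut_words:
  "card (cut_words K \<tau> n) \<le> card (simple_words n) +
     (\<Sum>m<n. card (chained_words K \<tau> m) * card (simple_words (n - Suc m)))"
proof -
  define B where "B m = (\<lambda>(v, g). v @ g) ` (chained_words K \<tau> m \<times> simple_words (n - Suc m))" for m
  have cB: "card (B m) \<le> card (chained_words K \<tau> m) * card (simple_words (n - Suc m))" for m
    unfolding B_def by (rule order_trans[OF card_image_le]) (auto simp: finite_words card_cartesian_product)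
  have fin: "finite (B d)" for d by (auto simp: B_def finite_words)
  have "cut_words K \<tau> n \<subseteq> simple_words n \<union> (\<Union>m\<in>{..<n}. B m)"
  proof
    fix w assume "w \<in> cut_words K \<tau> n"
    then obtain u a where w: "w = word u a n" "cut_window K \<tau> u a (a + int n)" by (auto simp: cut_words_def)
    then consider "simple_window u a (a + int n)"
      | q where "a \<le> q" "q < a + int n" "chained K \<tau> u a q" "simple_window u (q + 1) (a + int n)"
      by (auto simp: cut_window_def)
    then show "w \<in> simple_words n \<union> (\<Union>m\<in>{..<n}. B m)"
    proof cases
      case 1
      then show ?thesis using w by (auto simp: simple_words_def)
    next
      case 2
      define m where "m = nat (q - a)"
      have m: "q = a + int m" "m < n" using 2 by (auto simp: m_def)
      have "w = word u a (Suc m) @ word u (q + 1) (n - Suc m)"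
        using word_append[of u a "Suc m" "n - Suc m"] m w by (simp add: algebra_simps)
      moreover have "q + 1 + int (n - Suc m) = a + int n" using m by (simp add: of_nat_diff)
      moreover have "word u a (Suc m) \<in> chained_words K \<tau> m"
        using 2 m by (intro chained_wordsI) simp
      ultimately have "w \<in> B m" unfolding B_def using 2(4)
        by (intro image_eqI[of _ _ "(word u a (Suc m), word u (q + 1) (n - Suc m))"] SigmaI simple_wordsI)
          simp_all
      then show ?thesis using m by blast
    qed
  qed
  then have "card (cut_words K \<tau> n) \<le> card (simple_words n \<union> (\<Union>m\<in>{..<n}. B m))"
    by (intro card_mono) (use fin finite_words in auto)
  also have "\<dots> \<le> card (simple_words n) + card (\<Union>m\<in>{..<n}. B m)" by (rule card_Un_le)
  also have "\<dots> \<le> card (simple_words n) + (\<Sum>m\<in>{..<n}. card (B m))" by (intro add_left_mono card_UN_le) simp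
  also have "\<dots> \<le> card (simple_words n) + (\<Sum>m<n. card (chained_words K \<tau> m) * card (simple_words (n - Suc m)))"
    using cB by (intro add_mono sum_mono) auto
  finally show ?thesis .
qed


section \<open>Growth rates\<close>

text \<open>Bernoulli's inequality for the cube root of \<open>c\<close>, raised to the third
  power.\<close>

lemma cubic_le_exponential:
  fixes c :: real
  assumes "1 < c"
  obtains D where "0 < D" "\<And>n. real (4 * (n + 1) ^ 3) \<le> D * c ^ n"
proof -
  define y where "y = root 3 c"
  have y: "1 < y" "y ^ 3 = c" using assms by (auto simp: y_def)
  have lin: "real (n + 1) * (y - 1) \<le> y ^ (n + 1)" for n
    using Bernoulli_inequality[of "y - 1" "n + 1"] y by (simp add: algebra_simps)
  have "real (4 * (n + 1) ^ 3) \<le> (4 * c / (y - 1) ^ 3) * c ^ n" for n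
  proof -
    have "(real (n + 1) * (y - 1)) ^ 3 \<le> (y ^ (n + 1)) ^ 3"
      using lin y by (intro power_mono) auto
    also have "\<dots> = c ^ (n + 1)" by (metis power_mult mult.commute y(2))
    finally have "real (n + 1) ^ 3 * (y - 1) ^ 3 \<le> c * c ^ n" by (simp add: power_mult_distrib)
    then have "4 * real (n + 1) ^ 3 \<le> 4 * (c * c ^ n / (y - 1) ^ 3)"
      using y by (simp add: pos_le_divide_eq)
    then show ?thesis by simp
  qed
  moreover have "0 < 4 * c / (y - 1) ^ 3" using y assms by simp
  ultimately show ?thesis using that by blast
qed

text \<open>With total weight at most \<theta> < 1, the constant
  \<open>C = A / (1 - \<theta>)\<close> solves \<open>A + C * \<theta> = C\<close>, and the
  induction reproduces it.\<close>

lemma renewal_growth: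
  fixes f w :: "nat \<Rightarrow> real"
  assumes rec: "\<And>n. f n \<le> A * c ^ n + (\<Sum>d\<in>{1..n}. w d * f (n - d))"
    and w: "\<And>d. 0 \<le> w d" and sum: "\<And>n. (\<Sum>d\<in>{1..n}. w d / c ^ d) \<le> \<theta>" and \<theta>: "\<theta> < 1"
    and "0 < c" "0 \<le> A"
  shows "f n \<le> A / (1 - \<theta>) * c ^ n"
proof (induction n rule: less_induct)
  case (less n)
  define C where "C = A / (1 - \<theta>)"
  have C: "0 \<le> C" "A + C * \<theta> = C" using assms by (auto simp: C_def field_simps)
  have "w d * f (n - d) \<le> C * c ^ n * (w d / c ^ d)" if "d \<in> {1..n}" for d
  proof -
    have "w d * f (n - d) \<le> w d * (C * c ^ (n - d))"
      using less.IH[of "n - d"] that w by (intro mult_left_mono) (auto simp: C_def)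
    also have "\<dots> = C * c ^ n * (w d / c ^ d)"
      using that \<open>0 < c\<close> by (simp add: power_diff)
    finally show ?thesis .
  qed
  then have "f n \<le> A * c ^ n + (\<Sum>d\<in>{1..n}. C * c ^ n * (w d / c ^ d))"
    using rec[of n] by (smt (verit) sum_mono)
  also have "\<dots> = A * c ^ n + C * c ^ n * (\<Sum>d\<in>{1..n}. w d / c ^ d)" by (simp only: sum_distrib_left)
  also have "\<dots> \<le> A * c ^ n + C * c ^ n * \<theta>"
    using sum[of n] C \<open>0 < c\<close> by (intro add_left_mono mult_left_mono) auto
  also have "\<dots> = (A + C * \<theta>) * c ^ n" by (simp add: algebra_simps)
  finally show ?case using C by (simp add: C_def)
qed

lemma geometric_partial_sum_le:
  fixes z :: real
  assumes "0 \<le> z" "z < 1"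
  shows "(\<Sum>i<n. z ^ i) \<le> 1 / (1 - z)"
  using sum_le_suminf[of "\<lambda>i. z ^ i" "{..<n}"] assms by (simp add: summable_geometric suminf_geometric)

text \<open>Long gaps have small total weight once K is large, in spite of the polynomially many
  words in each. A forced block has the single weight 1 and a length of at least 1, so its
  discounted weight is at most \<open>1 / c\<close>, however short it is. Thus K works for all
  \<tau>, while C depends on \<tau>.\<close>

lemma card_chained_words_growth:
  fixes c y D :: real
  assumes y: "1 < y" "y < c" and D: "0 < D" "\<And>n. real (card (simple_words n)) \<le> D * y ^ n"
  shows "\<exists>K. \<forall>\<tau>. \<exists>C\<ge>0. \<forall>n. real (card (chained_words K \<tau> n)) \<le> C * c ^ n"
proof -
  define z where "z = y / c"
  have z: "0 < z" "z < 1" using y by (auto simp: z_def)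
  have c1: "1 < c" using y by simp
  have simple: "2 * real (card (simple_words n)) \<le> 2 * D * c ^ n" for n
  proof -
    have "D * y ^ n \<le> D * c ^ n" using y D by (intro mult_left_mono power_mono) auto
    then show ?thesis using D(2)[of n] by simp
  qed
  \<comment> \<open>Blocks of length at least K have total weight at most
    \<open>2 * D * z ^ K / (1 - z)\<close>, which this choice keeps below 1/2.\<close>
  obtain K where K: "z ^ K < (1 - z) / (4 * D)"
    using real_arch_pow_inv[of "(1 - z) / (4 * D)" z] z D by auto
  have "\<exists>C\<ge>0. \<forall>n. real (card (chained_words K \<tau> n)) \<le> C * c ^ n" for \<tau>
  proof (cases \<tau>)
    case None
    define w where "w d = (if K \<le> d then 2 * real (card (simple_words (d - 1))) else 0)" for d
    have rec: "real (card (chained_words K None n)) \<le> 2 * D * c ^ n +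
      (\<Sum>d\<in>{1..n}. w d * real (card (chained_words K None (n - d))))" for n
    proof -
      have "real (card (chained_words K None n)) \<le> real (2 * card (simple_words n) +
        (\<Sum>d\<in>{1..n} \<inter> {K..}. 2 * card (simple_words (d - 1)) * card (chained_words K None (n - d))))"
        using card_chained_words_long[of K n] by (simp only: of_nat_le_iff)
      also have "\<dots> = 2 * real (card (simple_words n)) +
        (\<Sum>d\<in>{1..n} \<inter> {K..}. w d * real (card (chained_words K None (n - d))))"
        by (simp add: w_def)
      also have "(\<Sum>d\<in>{1..n} \<inter> {K..}. w d * real (card (chained_words K None (n - d)))) =
        (\<Sum>d\<in>{1..n}. w d * real (card (chained_words K None (n - d))))"
        by (intro sum.mono_neutral_left) (auto simp: w_def)
      finally show ?thesis using simple[of n] by linarith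
    qed
    have sum: "(\<Sum>d\<in>{1..n}. w d / c ^ d) \<le> 1 / 2" for n
    proof -
      have "(\<Sum>d\<in>{1..n}. w d / c ^ d) = (\<Sum>d\<in>{1..n} \<inter> {K..}. w d / c ^ d)"
        by (intro sum.mono_neutral_right) (auto simp: w_def)
      also have "\<dots> \<le> (\<Sum>d\<in>{1..n} \<inter> {K..}. 2 * D * z ^ d)"
      proof (rule sum_mono)
        fix d assume d: "d \<in> {1..n} \<inter> {K..}"
        have "y ^ (d - 1) \<le> y ^ d" using y by (intro power_increasing) auto
        then have "D * y ^ (d - 1) \<le> D * y ^ d" using D by simp
        then have "w d \<le> 2 * (D * y ^ d)" using D(2)[of "d - 1"] d unfolding w_def by auto
        then have "w d / c ^ d \<le> 2 * (D * y ^ d) / c ^ d" using c1 by (intro divide_right_mono) auto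
        then show "w d / c ^ d \<le> 2 * D * z ^ d" by (simp add: z_def power_divide)
      qed
      also have "\<dots> \<le> (\<Sum>d\<in>{K..<Suc n + K}. 2 * D * z ^ d)"
        using D z by (intro sum_mono2) auto
      also have "\<dots> = (\<Sum>i<Suc n. 2 * D * z ^ (i + K))"
        using sum.shift_bounds_nat_ivl[of "\<lambda>d. 2 * D * z ^ d" 0 K "Suc n"] by (simp add: lessThan_atLeast0)
      also have "\<dots> = 2 * D * z ^ K * (\<Sum>i<Suc n. z ^ i)"
        by (simp only: sum_distrib_left power_add mult_ac)
      also have "\<dots> \<le> 2 * D * z ^ K * (1 / (1 - z))"
        using geometric_partial_sum_le[of z "Suc n"] z D by (intro mult_left_mono) auto
      also have "\<dots> \<le> 2 * D * ((1 - z) / (4 * D)) * (1 / (1 - z))"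
        using K z D by (intro mult_right_mono mult_left_mono) auto
      also have "\<dots> = 1 / 2" using z D by (simp add: field_simps)
      finally show ?thesis .
    qed
    have "real (card (chained_words K None n)) \<le> 2 * D / (1 - 1 / 2) * c ^ n" for n
      by (rule renewal_growth[where w = w]) (use rec sum c1 D in \<open>auto simp: w_def\<close>)
    then show ?thesis using None D by (intro exI[of _ "2 * D / (1 - 1 / 2)"]) auto
  next
    case (Some \<sigma>)
    define w :: "nat \<Rightarrow> real" where "w d = (if d = block_len \<sigma> then 1 else 0)" for d
    have rec: "real (card (chained_words K \<tau> n)) \<le> 2 * D * c ^ n +
      (\<Sum>d\<in>{1..n}. w d * real (card (chained_words K \<tau> (n - d))))" for n
    proof -
      have "real (card (chained_words K \<tau> n)) \<le> real (2 * card (simple_words n) +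
        (\<Sum>d\<in>{1..n} \<inter> {block_len \<sigma>}. card (chained_words K \<tau> (n - d))))"
        using card_chained_words_det[of K \<sigma> n] Some by (simp only: of_nat_le_iff)
      also have "\<dots> = 2 * real (card (simple_words n)) +
        (\<Sum>d\<in>{1..n} \<inter> {block_len \<sigma>}. w d * real (card (chained_words K \<tau> (n - d))))"
        by (simp add: w_def)
      also have "(\<Sum>d\<in>{1..n} \<inter> {block_len \<sigma>}. w d * real (card (chained_words K \<tau> (n - d)))) =
        (\<Sum>d\<in>{1..n}. w d * real (card (chained_words K \<tau> (n - d))))"
        by (intro sum.mono_neutral_left) (auto simp: w_def)
      finally show ?thesis using simple[of n] by linarith
    qed
    have sum: "(\<Sum>d\<in>{1..n}. w d / c ^ d) \<le> 1 / c" for n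
    proof (cases "block_len \<sigma> \<in> {1..n}")
      case True
      have "(\<Sum>d\<in>{1..n}. w d / c ^ d) = (\<Sum>d\<in>{block_len \<sigma>}. w d / c ^ d)"
        using True by (intro sum.mono_neutral_right) (auto simp: w_def)
      also have "\<dots> = 1 / c ^ block_len \<sigma>" by (simp add: w_def)
      also have "\<dots> \<le> 1 / c ^ 1"
        using True c1 by (intro divide_left_mono power_increasing) auto
      finally show ?thesis by simp
    next
      case False
      then have "(\<Sum>d\<in>{1..n}. w d / c ^ d) = 0" by (intro sum.neutral) (auto simp: w_def)
      then show ?thesis using c1 by simp
    qed
    have "real (card (chained_words K \<tau> n)) \<le> 2 * D / (1 - 1 / c) * c ^ n" for n
      by (rule renewal_growth[where w = w]) (use rec sum c1 D in \<open>auto simp: w_def\<close>)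
    moreover have "0 \<le> 2 * D / (1 - 1 / c)" using c1 D by simp
    ultimately show ?thesis by blast
  qed
  then show ?thesis by blast
qed

lemma card_cut_words_growth:
  fixes c :: real
  assumes c: "1 < c"
  shows "\<exists>K. \<forall>\<tau>. \<exists>C. \<forall>n. real (card (cut_words K \<tau> n)) \<le> C * c ^ n"
proof -
  \<comment> \<open>A rate strictly between 1 and \<open>c\<close>: the simple words grow at most
    like \<open>y ^ n\<close>, and the ratio \<open>y / c < 1\<close> makes the convolution sum
    converge.\<close>
  define y where "y = sqrt c"
  have y: "1 < y" "y < c" using c by (auto simp: y_def real_less_lsqrt power2_eq_square)
  define z where "z = y / c"
  have z: "0 < z" "z < 1" "y = z * c" using y by (auto simp: z_def)
  obtain D where D: "0 < D" "\<And>n. real (4 * (n + 1) ^ 3) \<le> D * y ^ n"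
    using cubic_le_exponential[OF y(1)] by blast
  have D': "real (card (simple_words n)) \<le> D * y ^ n" for n
  proof -
    have "real (card (simple_words n)) \<le> real (4 * (n + 1) ^ 3)"
      by (rule of_nat_mono[OF card_simple_words])
    then show ?thesis using D(2)[of n] by linarith
  qed
  obtain K where K: "\<And>\<tau>. \<exists>C\<ge>0. \<forall>n. real (card (chained_words K \<tau> n)) \<le> C * c ^ n"
    using card_chained_words_growth[OF y D(1) D'] by blast
  have "\<exists>C. \<forall>n. real (card (cut_words K \<tau> n)) \<le> C * c ^ n" for \<tau>
  proof -
    obtain C where C: "0 \<le> C" "\<And>n. real (card (chained_words K \<tau> n)) \<le> C * c ^ n" using K by blast
    have "real (card (cut_words K \<tau> n)) \<le> (D + C * D / (1 - z)) * c ^ n" for n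
    proof -
      have "real (card (cut_words K \<tau> n)) \<le> real (card (simple_words n) +
        (\<Sum>m<n. card (chained_words K \<tau> m) * card (simple_words (n - Suc m))))"
        by (rule of_nat_mono[OF card_cut_words])
      also have "\<dots> = real (card (simple_words n)) +
        (\<Sum>m<n. real (card (chained_words K \<tau> m)) * real (card (simple_words (n - Suc m))))" by simp
      also have "\<dots> \<le> D * c ^ n + (\<Sum>m<n. C * D * c ^ n * z ^ (n - Suc m))"
      proof (intro add_mono sum_mono)
        have "D * y ^ n \<le> D * c ^ n" using y D by (intro mult_left_mono power_mono) auto
        then show "real (card (simple_words n)) \<le> D * c ^ n" using D'[of n] by linarith
        fix m assume m: "m \<in> {..<n}"
        have "real (card (chained_words K \<tau> m)) * real (card (simple_words (n - Suc m)))
          \<le> (C * c ^ m) * (D * y ^ (n - Suc m))"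
          using C D' y D by (intro mult_mono) auto
        also have "\<dots> = C * D * z ^ (n - Suc m) * c ^ (m + (n - Suc m))"
          by (simp add: z(3) power_mult_distrib power_add)
        also have "\<dots> \<le> C * D * z ^ (n - Suc m) * c ^ n"
          using C D z c m by (intro mult_left_mono power_increasing) auto
        finally show "real (card (chained_words K \<tau> m)) * real (card (simple_words (n - Suc m)))
          \<le> C * D * c ^ n * z ^ (n - Suc m)" by (simp add: mult_ac)
      qed
      also have "(\<Sum>m<n. C * D * c ^ n * z ^ (n - Suc m)) = C * D * c ^ n * (\<Sum>m<n. z ^ (n - Suc m))"
        by (simp only: sum_distrib_left)
      also have "(\<Sum>m<n. z ^ (n - Suc m)) = (\<Sum>m<n. z ^ m)"
        using sum.nat_diff_reindex[of "\<lambda>m. z ^ m" n] by simp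
      also have "D * c ^ n + C * D * c ^ n * (\<Sum>m<n. z ^ m) \<le> D * c ^ n + C * D * c ^ n * (1 / (1 - z))"
        using geometric_partial_sum_le[of z n] z C D c by (intro add_left_mono mult_left_mono) auto
      also have "\<dots> = (D + C * D / (1 - z)) * c ^ n" by (simp add: algebra_simps)
      finally show ?thesis .
    qed
    then show ?thesis by blast
  qed
  then show ?thesis by blast
qed

section \<open>Sets of one-sided words with slowly growing prefix counts\<close>

definition prefixes :: "(nat \<Rightarrow> bool) set \<Rightarrow> nat \<Rightarrow> bool list set" where
  "prefixes X n = (\<lambda>f. map f [0..<n]) ` X"

definition slow :: "real \<Rightarrow> (nat \<Rightarrow> bool) set \<Rightarrow> bool" where
  "slow c X \<longleftrightarrow> (\<exists>C. \<forall>n. real (card (prefixes X n)) \<le> C * c ^ n)"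

lemma finite_prefixes: "finite (prefixes X n)"
  by (rule finite_subset[OF _ finite_bool_lists[of n]]) (auto simp: prefixes_def)

text \<open>The bi-infinite word behind a prefix may change with n, as only the number of prefixes
  matters. The family is indexed by \<tau> alone, hence countable.\<close>

definition cut_tails :: "nat \<Rightarrow> label option \<Rightarrow> (nat \<Rightarrow> bool) set" where
  "cut_tails K \<tau> = {f. \<forall>n. map f [0..<n] \<in> cut_words K \<tau> n}"

definition rev_cut_tails :: "nat \<Rightarrow> label option \<Rightarrow> (nat \<Rightarrow> bool) set" where
  "rev_cut_tails K \<tau> = {f. \<forall>n. rev (map f [0..<n]) \<in> cut_words K \<tau> n}"

lemma slow_cut_tails:
  assumes "1 < c"
  shows "\<exists>K. \<forall>\<tau>. slow c (cut_tails K \<tau>) \<and> slow c (rev_cut_tails K \<tau>)"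
proof -
  obtain K where K: "\<And>\<tau>. \<exists>C. \<forall>n. real (card (cut_words K \<tau> n)) \<le> C * c ^ n"
    using card_cut_words_growth[OF assms] by blast
  have "slow c (cut_tails K \<tau>) \<and> slow c (rev_cut_tails K \<tau>)" for \<tau>
  proof -
    obtain C where C: "\<And>n. real (card (cut_words K \<tau> n)) \<le> C * c ^ n" using K by blast
    have "card (prefixes (cut_tails K \<tau>) n) \<le> card (cut_words K \<tau> n)" for n
      by (rule card_mono) (auto simp: finite_words prefixes_def cut_tails_def)
    moreover have "card (prefixes (rev_cut_tails K \<tau>) n) \<le> card (cut_words K \<tau> n)" for n
      by (rule card_inj_on_le[of rev]) (auto simp: finite_words prefixes_def rev_cut_tails_def)
    ultimately show ?thesis using C unfolding slow_def by (meson of_nat_mono order_trans)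
  qed
  then show ?thesis by blast
qed

lemma left_tail_with_bad:
  assumes "left_dominated u" "bad u p"
  shows "\<exists>\<tau> a. (\<lambda>i. u (a - int i)) \<in> rev_cut_tails K \<tau>"
proof -
  obtain \<tau> p' where ch: "\<And>a. a \<le> p' \<Longrightarrow> chained K \<tau> u a p'" using chained_left[OF assms] by blast
  have "(\<lambda>i. u (p' - 1 - int i)) \<in> rev_cut_tails K \<tau>"
    unfolding rev_cut_tails_def
  proof (intro CollectI allI)
    fix n
    have "rev (map (\<lambda>i. u (p' - 1 - int i)) [0..<n]) = word u (p' - int n) n"
      by (rule nth_equalityI) (auto simp: rev_nth algebra_simps of_nat_diff)
    moreover have "cut_window K \<tau> u (p' - int n) (p' - int n + int n)"
      using chained_cut[OF ch[of "p' - int n"]] by simp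
    ultimately show "rev (map (\<lambda>i. u (p' - 1 - int i)) [0..<n]) \<in> cut_words K \<tau> n"
      unfolding cut_words_def by blast
  qed
  then show ?thesis by blast
qed

lemma right_tail_with_bad:
  assumes "left_dominated u" "\<forall>N. \<exists>p\<ge>N. bad u p"
  shows "\<exists>\<tau> a. (\<lambda>i. u (a + int i)) \<in> cut_tails K \<tau>"
proof -
  obtain \<tau> a where ch: "\<And>b. \<exists>p\<ge>b. chained K \<tau> u a p" using chained_right[OF assms] by blast
  have "map (\<lambda>i. u (a + int i)) [0..<n] \<in> cut_words K \<tau> n" for n
  proof -
    obtain p where "a + int n \<le> p" "chained K \<tau> u a p" using ch by blast
    then have "cut_window K \<tau> u a (a + int n)" by (intro chained_cut)
    then show ?thesis unfolding cut_words_def word_def by blast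
  qed
  then show ?thesis unfolding cut_tails_def by blast
qed


section \<open>Tails without bad positions\<close>

text \<open>The Thue-Morse substitution on one-sided words: the letter \<open>f j\<close> becomes
  the pair \<open>f j\<close>, \<open>\<not> f j\<close>.\<close>

definition theta :: "(nat \<Rightarrow> bool) \<Rightarrow> nat \<Rightarrow> bool" where
  "theta f i \<longleftrightarrow> f (i div 2) \<noteq> odd i"

definition periodic_tails :: "nat \<Rightarrow> (nat \<Rightarrow> bool) set" where
  "periodic_tails P = {f. \<forall>i. f (i + P) = f i}"

lemma theta_funpow_cong:
  "(\<And>j. j \<le> n div 2 ^ k \<Longrightarrow> f j = g j) \<Longrightarrow> (theta ^^ k) f n = (theta ^^ k) g n"
proof (induction k arbitrary: n)
  case (Suc k)
  have "(theta ^^ k) f (n div 2) = (theta ^^ k) g (n div 2)"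
    by (rule Suc.IH) (use Suc.prems in \<open>simp add: div_mult2_eq\<close>)
  then show ?case
    by (simp add: theta_def[of "(theta ^^ k) f"] theta_def[of "(theta ^^ k) g"])
qed simp

lemma theta_compl: "(theta ^^ k) (\<lambda>i. \<not> f i) = (\<lambda>i. \<not> (theta ^^ k) f i)"
proof (induction k)
  case (Suc k)
  show ?case
  proof
    fix i
    show "(theta ^^ Suc k) (\<lambda>i. \<not> f i) i = (\<not> (theta ^^ Suc k) f i)"
      by (simp add: Suc theta_def[of "(theta ^^ k) f"] theta_def[of "\<lambda>i. \<not> (theta ^^ k) f i"])
  qed
qed simp

lemma theta_periodic:
  assumes "f \<in> periodic_tails P"
  shows "theta f \<in> periodic_tails (2 * P)" "theta (\<lambda>i. \<not> f i) \<in> periodic_tails (2 * P)"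
proof -
  have f: "f (i + P) = f i" for i using assms by (simp add: periodic_tails_def)
  have "f ((i + 2 * P) div 2) = f (i div 2)" for i using f[of "i div 2"] by (simp add: add.commute)
  then show "theta f \<in> periodic_tails (2 * P)" "theta (\<lambda>i. \<not> f i) \<in> periodic_tails (2 * P)"
    by (simp_all add: theta_def periodic_tails_def)
qed

lemma card_bool_lists: "card {xs :: bool list. length xs = n} = 2 ^ n"
  using card_lists_length_eq[of "UNIV :: bool set" n] by simp

text \<open>A prefix of length n depends only on the first \<open>n div 2 ^ k + 1\<close> letters of
  the preimage, and \<open>2 \<le> c ^ (2 ^ k)\<close> turns their number of choices into
  \<open>2 * c ^ n\<close>.\<close>

lemma slow_theta:
  fixes c :: real
  assumes "1 < c" "2 \<le> c ^ (2 ^ k)"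
  shows "slow c (range (theta ^^ k))"
  unfolding slow_def
proof (intro exI[of _ 2] allI)
  fix n :: nat
  define m where "m = n div 2 ^ k + 1"
  let ?F = "\<lambda>xs :: bool list. map ((theta ^^ k) (\<lambda>i. xs ! i)) [0..<n]"
  have "prefixes (range (theta ^^ k)) n \<subseteq> ?F ` {xs. length xs = m}"
  proof
    fix w assume "w \<in> prefixes (range (theta ^^ k)) n"
    then obtain v where w: "w = map ((theta ^^ k) v) [0..<n]" by (auto simp: prefixes_def)
    have "w = ?F (map v [0..<m])"
      unfolding w
    proof (rule nth_equalityI)
      fix i assume i: "i < length (map ((theta ^^ k) v) [0..<n])"
      have "(theta ^^ k) v i = (theta ^^ k) (\<lambda>i. map v [0..<m] ! i) i"
      proof (rule theta_funpow_cong)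
        fix j assume "j \<le> i div 2 ^ k"
        also have "i div 2 ^ k \<le> n div 2 ^ k" using i by (intro div_le_mono) simp
        finally have "j < m" by (simp add: m_def)
        then show "v j = map v [0..<m] ! j" by simp
      qed
      then show "map ((theta ^^ k) v) [0..<n] ! i = ?F (map v [0..<m]) ! i" using i by simp
    qed simp
    then show "w \<in> ?F ` {xs. length xs = m}" by (intro image_eqI) auto
  qed
  then have "card (prefixes (range (theta ^^ k)) n) \<le> card {xs :: bool list. length xs = m}"
    by (rule surj_card_le[OF finite_bool_lists])
  then have "real (card (prefixes (range (theta ^^ k)) n)) \<le> 2 ^ m"
    unfolding card_bool_lists by (metis of_nat_le_iff of_nat_numeral of_nat_power)
  also have "\<dots> = 2 * 2 ^ (n div 2 ^ k)" by (simp add: m_def)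
  also have "\<dots> \<le> 2 * (c ^ (2 ^ k)) ^ (n div 2 ^ k)"
    using assms by (intro mult_left_mono power_mono) auto
  also have "\<dots> = 2 * c ^ (2 ^ k * (n div 2 ^ k))" by (simp add: power_mult)
  also have "\<dots> \<le> 2 * c ^ n"
    using assms by (intro mult_left_mono power_increasing) auto
  finally show "real (card (prefixes (range (theta ^^ k)) n)) \<le> 2 * c ^ n" .
qed

lemma slow_periodic:
  fixes c :: real
  assumes "1 < c" "0 < P"
  shows "slow c (periodic_tails P)"
  unfolding slow_def
proof (intro exI[of _ "2 ^ P"] allI)
  fix n :: nat
  let ?F = "\<lambda>xs :: bool list. map (\<lambda>i. xs ! (i mod P)) [0..<n]"
  have "prefixes (periodic_tails P) n \<subseteq> ?F ` {xs. length xs = P}"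
  proof
    fix w assume "w \<in> prefixes (periodic_tails P) n"
    then obtain f where f: "\<And>i. f (i + P) = f i" and w: "w = map f [0..<n]"
      by (auto simp: prefixes_def periodic_tails_def)
    have *: "f (i + k * P) = f i" for i k
    proof (induction k)
      case (Suc k) then show ?case using f[of "i + k * P"] by (simp add: algebra_simps)
    qed simp
    have "f i = f (i mod P)" for i
      using *[of "i mod P" "i div P"] by (simp add: mod_div_mult_eq)
    then have "w = ?F (map f [0..<P])" using w assms(2) by simp
    then show "w \<in> ?F ` {xs. length xs = P}" by (intro image_eqI) auto
  qed
  then have "card (prefixes (periodic_tails P) n) \<le> card {xs :: bool list. length xs = P}"
    by (rule surj_card_le[OF finite_bool_lists])
  then have "real (card (prefixes (periodic_tails P) n)) \<le> 2 ^ P * 1"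
    unfolding card_bool_lists by (metis mult.right_neutral of_nat_le_iff of_nat_numeral of_nat_power)
  also have "\<dots> \<le> 2 ^ P * c ^ n" using assms by (intro mult_left_mono) auto
  finally show "real (card (prefixes (periodic_tails P) n)) \<le> 2 ^ P * c ^ n" .
qed

text \<open>The recursion \<open>tm_rec\<close> of \<open>tm\<close> is the same as the one by which
  relative words change under the substitution, so a first difference at \<open>j\<close> moves to
  \<open>2 * j + 1\<close> with its sign preserved.\<close>

lemma bad_of_decoded:
  assumes dec: "\<And>j. i \<le> j \<Longrightarrow> u (s + 2 * j) = v j" "\<And>j. i \<le> j \<Longrightarrow> u (s + 2 * j + 1) = (\<not> v j)"
    and "bad v i"
  shows "bad u (s + 2 * i)"
proof -
  obtain j where j: "\<And>n. n < j \<Longrightarrow> rel_right v i n = tm n" "rel_right v i j" "\<not> tm j"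
    using assms(3) unfolding bad_def lex_gt_def by blast
  let ?p = "s + 2 * i"
  have r0: "rel_right u ?p 0" using dec[of i] by (simp add: rel_right_def)
  have r1: "rel_right u ?p (2 * n + 1) = rel_right v i n" for n
    using dec(1)[of i] dec(1)[of "i + 1 + int n"] by (simp add: rel_right_def algebra_simps)
  have r2: "rel_right u ?p (2 * n + 2) = (\<not> rel_right v i n)" for n
    using dec(1)[of i] dec(2)[of "i + 1 + int n"] by (simp add: rel_right_def algebra_simps)
  have "rel_right u ?p n = tm n" if "n < 2 * j + 1" for n
  proof -
    consider "n = 0" | m where "n = 2 * m + 1" | m where "n = 2 * m + 2"
    proof (cases "even n")
      case True
      then obtain m where "n = 2 * m" by blast
      then show ?thesis using that(1) that(3)[of "m - 1"] by (cases m) auto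
    next
      case False
      then show ?thesis using that(2) by (auto elim: oddE)
    qed
    then show ?thesis
    proof cases
      case 1 then show ?thesis using r0 tm_rec(1) by simp
    next
      case 2 then show ?thesis using r1 tm_rec(2) j(1) \<open>n < 2 * j + 1\<close> by simp
    next
      case 3 then show ?thesis using r2 tm_rec(3) j(1) \<open>n < 2 * j + 1\<close> by simp
    qed
  qed
  then show ?thesis unfolding bad_def lex_gt_def
    using r1[of j] tm_rec(2)[of j] j(2,3) by (intro exI[of _ "2 * j + 1"]) simp
qed

lemma lex_gt_tm_alternating:
  assumes "e 0" "\<And>t. t < s \<Longrightarrow> e (2 * t + 1) \<and> \<not> e (2 * t + 2)" "e (2 * s + 1)" "e (2 * s + 2)"
  shows "lex_gt e tm"
proof -
  consider "s = 0" | "s = 1" | "2 \<le> s" by linarith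
  then show ?thesis
  proof cases
    case 1
    then show ?thesis using assms by (intro lex_gt_tm_prefix(1)) (auto simp: numeral_eq_Suc)
  next
    case 2
    then show ?thesis using assms(1) assms(2)[of 0] assms(3,4)
      by (intro lex_gt_tm_prefix(2)) (auto simp: numeral_eq_Suc)
  next
    case 3
    then have "e 5" using assms(2)[of 2] assms(3) by (cases "s = 2") (auto simp: numeral_eq_Suc)
    then show ?thesis using assms(1) assms(2)[of 0] assms(2)[of 1] 3
      by (intro lex_gt_tm_prefix(3)) (auto simp: numeral_eq_Suc)
  qed
qed

text \<open>A double letter after a change fixes the division into pairs: cut between its two
  letters. If a later pair were again a double \<open>bb\<close>, go back from it to the last pair
  starting with the other letter, or else to the initial double. From the first letter found there
  one reads \<open>1(10)^s 11\<close>, so that position would be bad.\<close>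

lemma aligned_after_double:
  assumes nb: "\<And>p. N \<le> p \<Longrightarrow> \<not> bad u p" and n: "N < n" "u (n - 1) \<noteq> u n" "u (n + 1) = u n"
  shows "u (n + 1 + 2 * int i) \<noteq> u (n + 2 + 2 * int i)"
proof (induction i rule: less_induct)
  case (less i)
  define b where "b j = u (n + 1 + 2 * int j)" for j
  have pair: "u (n + 2 + 2 * int j) = (\<not> b j)" if "j < i" for j
    using less.IH[OF that] by (auto simp: b_def)
  show ?case
  proof
    assume eq: "u (n + 1 + 2 * int i) = u (n + 2 + 2 * int i)"
    have bi: "u (n + 2 + 2 * int i) = b i" using eq by (simp add: b_def)
    have contra: False
      if P: "N \<le> n - 1 + 2 * int m" "u (n - 1 + 2 * int m) = (\<not> b i)" "u (n + 2 * int m) = b i"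
        "m \<le> i" "\<And>j. m \<le> j \<Longrightarrow> j < i \<Longrightarrow> b j = b i" for m
    proof -
      let ?P = "n - 1 + 2 * int m"
      have "lex_gt (rel_right u ?P) tm"
      proof (rule lex_gt_tm_alternating[where s = "i - m"])
        show "rel_right u ?P 0" using P by (simp add: rel_right_def algebra_simps)
        have r1: "rel_right u ?P (2 * t + 1) = (b (m + t) = b i)" for t
          using P(2) by (simp add: rel_right_def b_def algebra_simps)
        have r2: "rel_right u ?P (2 * t + 2) = (u (n + 2 + 2 * int (m + t)) = b i)" for t
          using P(2) by (simp add: rel_right_def algebra_simps)
        show "rel_right u ?P (2 * t + 1) \<and> \<not> rel_right u ?P (2 * t + 2)" if "t < i - m" for t
          using r1[of t] r2[of t] P(5)[of "m + t"] pair[of "m + t"] that by auto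
        show "rel_right u ?P (2 * (i - m) + 1)" using r1[of "i - m"] P(4) by simp
        show "rel_right u ?P (2 * (i - m) + 2)" using r2[of "i - m"] P(4) bi by (simp add: of_nat_diff)
      qed
      then show False using nb[OF P(1)] by (simp add: bad_def)
    qed
    show False
    proof (cases "\<exists>j<i. b j \<noteq> b i")
      case False
      then have "b 0 = b i" by (cases i) auto
      then have "u (n + 1) = b i" by (simp add: b_def)
      then show ?thesis using n False by (intro contra[of 0]) auto
    next
      case True
      define Q where "Q j \<longleftrightarrow> j < i \<and> b j \<noteq> b i" for j
      obtain j0 where "Q j0" using True Q_def by blast
      define j where "j = (GREATEST j. Q j)"
      have j: "Q j" unfolding j_def by (rule GreatestI_nat[where P = Q and k = j0 and b = i]) (use \<open>Q j0\<close> in \<open>auto simp: Q_def\<close>)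
      have "\<not> Q j'" if "j < j'" for j'
        using Greatest_le_nat[of Q j' i] that unfolding j_def[symmetric] by (auto simp: Q_def)
      then have "b j' = b i" if "Suc j \<le> j'" "j' < i" for j' using that unfolding Q_def by auto
      moreover have "u (n - 1 + 2 * int (Suc j)) = b j" by (simp add: b_def algebra_simps)
      moreover have "u (n + 2 * int (Suc j)) = (\<not> b j)" using pair[of j] j by (simp add: Q_def algebra_simps)
      ultimately show ?thesis using n j by (intro contra[of "Suc j"]) (auto simp: Q_def)
    qed
  qed
qed

text \<open>If no change is followed by a double, then one change forces alternation forever and no
  change means a constant word; both have period 2. Otherwise the double aligns the pairs, and by
  \<open>bad_of_decoded\<close> the decoded word has no bad positions either.\<close>

lemma decode_right:
  assumes nb': "\<forall>p\<ge>N. \<not> bad u p"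
  shows "(\<exists>M\<ge>N. \<forall>i\<ge>M. u (i + 2) = u i) \<or>
    (\<exists>M\<ge>N. \<exists>v. (\<forall>p\<ge>0. \<not> bad v p) \<and> (\<forall>j\<ge>0. u (M + 2 * j) = v j \<and> u (M + 2 * j + 1) = (\<not> v j)))"
proof -
  note nb = nb'[rule_format]
  show ?thesis
  proof (cases "\<exists>n>N. u (n - 1) \<noteq> u n \<and> u (n + 1) = u n")
    case True
    then obtain n where n: "N < n" "u (n - 1) \<noteq> u n" "u (n + 1) = u n" by blast
    define v where "v j = u (n + 1 + 2 * j)" for j
    have d: "u (n + 1 + 2 * j) = v j" "u (n + 1 + 2 * j + 1) = (\<not> v j)" if "0 \<le> j" for j
    proof -
      obtain i where "j = int i" using zero_le_imp_eq_int[OF \<open>0 \<le> j\<close>] by blast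
      then show "u (n + 1 + 2 * j) = v j" "u (n + 1 + 2 * j + 1) = (\<not> v j)"
        using aligned_after_double[OF nb n, of i] by (auto simp: v_def algebra_simps)
    qed
    have "\<not> bad v p" if "0 \<le> p" for p
    proof
      assume "bad v p"
      then have "bad u (n + 1 + 2 * p)" using that by (intro bad_of_decoded[where v = v] d) auto
      then show False using nb[of "n + 1 + 2 * p"] n that by simp
    qed
    then show ?thesis using d n by (intro disjI2 exI[of _ "n + 1"] conjI exI[of _ v]) auto
  next
    case False
    then have no: "u (n + 1) \<noteq> u n" if "N < n" "u (n - 1) \<noteq> u n" for n using that by blast
    show ?thesis
    proof (cases "\<exists>m\<ge>N. u m \<noteq> u (m + 1)")
      case True
      then obtain m where m: "N \<le> m" "u m \<noteq> u (m + 1)" by blast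
      have alt: "u i \<noteq> u (i + 1)" if "m \<le> i" for i using that
      proof (induction i rule: int_ge_induct)
        case (step i)
        then show ?case using no[of "i + 1"] m by auto
      qed (use m in simp)
      have "u (i + 2) = u i" if "m \<le> i" for i using alt[OF that] alt[of "i + 1"] that by (auto simp: add.assoc)
      then show ?thesis using m by blast
    next
      case False
      then have "u (i + 2) = u i" if "N \<le> i" for i
      proof -
        have "N \<le> i + 1" using that by simp
        then have "u (i + 1) = u (i + 1 + 1)" using False by blast
        moreover have "u i = u (i + 1)" using False that by blast
        ultimately have "u (i + 1 + 1) = u i" by (simp only:)
        then show ?thesis by (simp add: add.assoc)
      qed
      then show ?thesis by blast
    qed
  qed
qed

text \<open>For \<open>k = 0\<close> every word is in the range. Each decoding contributes one
  application of \<open>theta\<close>; a periodic tail found at a deeper level stays periodic, with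
  its period doubled each time.\<close>

lemma right_tail_without_bad:
  assumes "\<forall>p\<ge>N. \<not> bad u p"
  shows "\<exists>M\<ge>N. (\<exists>P>0. (\<lambda>i. u (M + int i)) \<in> periodic_tails P) \<or> (\<lambda>i. u (M + int i)) \<in> range (theta ^^ k)"
  using assms
proof (induction k arbitrary: u N)
  case 0
  then show ?case by auto
next
  case (Suc k)
  from decode_right[OF Suc.prems] show ?case
  proof (elim disjE exE conjE)
    fix M assume M: "N \<le> M" and per: "\<forall>i\<ge>M. u (i + 2) = u i"
    have "u (M + int (i + 2)) = u (M + int i)" for i
      using per[rule_format, of "M + int i"] by (simp add: algebra_simps)
    then have "(\<lambda>i. u (M + int i)) \<in> periodic_tails 2" by (simp add: periodic_tails_def)
    then show ?thesis using M by (intro exI[of _ M] conjI disjI1 exI[of _ 2]) simp_all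
  next
    fix M v assume M: "N \<le> M" and v: "\<forall>p\<ge>0. \<not> bad v p"
      and d: "\<forall>j\<ge>0. u (M + 2 * j) = v j \<and> u (M + 2 * j + 1) = (\<not> v j)"
    have 2: "N \<le> M" "\<forall>p\<ge>0. \<not> bad v p"
      "\<And>j. 0 \<le> j \<Longrightarrow> u (M + 2 * j) = v j" "\<And>j. 0 \<le> j \<Longrightarrow> u (M + 2 * j + 1) = (\<not> v j)"
      using M v d by blast+
    obtain M' where M': "0 \<le> M'" and alt: "(\<exists>P>0. (\<lambda>i. v (M' + int i)) \<in> periodic_tails P) \<or>
      (\<lambda>i. v (M' + int i)) \<in> range (theta ^^ k)" using Suc.IH[of 0 v, OF 2(2)] by blast
    have th: "(\<lambda>i. u (M + 2 * M' + int i)) = theta (\<lambda>i. v (M' + int i))"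
    proof
      fix i
      show "u (M + 2 * M' + int i) = theta (\<lambda>i. v (M' + int i)) i"
      proof (cases "even i")
        case True
        then obtain j where "i = 2 * j" by blast
        then show ?thesis using 2(3)[of "M' + int j"] M' by (simp add: theta_def algebra_simps)
      next
        case False
        then obtain j where "i = 2 * j + 1" by (auto elim: oddE)
        then show ?thesis using 2(4)[of "M' + int j"] M' by (simp add: theta_def algebra_simps)
      qed
    qed
    from alt have "(\<exists>P>0. theta (\<lambda>i. v (M' + int i)) \<in> periodic_tails P) \<or>
      theta (\<lambda>i. v (M' + int i)) \<in> range (theta ^^ Suc k)"
    proof (elim disjE exE conjE)
      fix P :: nat assume P: "0 < P" "(\<lambda>i. v (M' + int i)) \<in> periodic_tails P"
      then have "theta (\<lambda>i. v (M' + int i)) \<in> periodic_tails (2 * P)"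
        by (intro theta_periodic)
      then show ?thesis using P by (intro disjI1 exI[of _ "2 * P"] conjI) simp_all
    next
      assume "(\<lambda>i. v (M' + int i)) \<in> range (theta ^^ k)"
      then show ?thesis by (intro disjI2) auto
    qed
    then show ?thesis unfolding th[symmetric] using 2(1) M'
      by (intro exI[of _ "M + 2 * M'"] conjI) simp_all
  qed
qed

text \<open>Alignment extends only to the right of a double, so doubles are needed arbitrarily far
  left. They agree in parity: for odd distance the double on the right would be one of the unequal
  pairs set up by the one on the left. Hence the whole word decodes at once.\<close>

lemma decode_left:
  assumes nb: "\<forall>p. \<not> bad u p"
  shows "(\<exists>M. \<forall>i\<le>M. u (i - 2) = u i) \<or>
    (\<exists>s v. (\<forall>p. \<not> bad v p) \<and> (\<forall>j. u (s + 2 * j) = v j \<and> u (s + 2 * j + 1) = (\<not> v j)))"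
proof (cases "\<forall>N. \<exists>n<N. u (n - 1) \<noteq> u n \<and> u (n + 1) = u n")
  case True
  then obtain n where n: "u (n - 1) \<noteq> u n" "u (n + 1) = u n" by blast
  have al: "u (m + 1 + 2 * int i) \<noteq> u (m + 2 + 2 * int i)" if "u (m - 1) \<noteq> u m" "u (m + 1) = u m" for m i
    by (rule aligned_after_double[where N = "m - 1"]) (use nb that in auto)
  define s where "s = n + 1"
  have pair: "u (s + 2 * j) \<noteq> u (s + 2 * j + 1)" for j
  proof -
    obtain m where m: "m < min n (s + 2 * j)" "u (m - 1) \<noteq> u m" "u (m + 1) = u m" using True by blast
    have "even (m - n)"
    proof (rule ccontr)
      assume "odd (m - n)"
      then have "even (n - (m + 1))" by simp
      then obtain t where t: "n - (m + 1) = 2 * t" by blast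
      then have "0 \<le> t" using m(1) by auto
      then obtain i where "t = int i" using zero_le_imp_eq_int by blast
      then have "n = m + 1 + 2 * int i" using t by simp
      then show False using al[OF m(2,3), of i] n(2) by (simp add: algebra_simps)
    qed
    then obtain t where t: "m - n = 2 * t" by blast
    have "0 \<le> j - t" using m(1) t by (auto simp: s_def)
    then obtain i where "j - t = int i" using zero_le_imp_eq_int by blast
    then have "s + 2 * j = m + 1 + 2 * int i" using t by (simp add: s_def)
    then show ?thesis using al[OF m(2,3), of i] by (simp add: algebra_simps)
  qed
  define v where "v j = u (s + 2 * j)" for j
  have d: "u (s + 2 * j) = v j" "u (s + 2 * j + 1) = (\<not> v j)" for j
    using pair[of j] by (auto simp: v_def)
  have "\<not> bad v p" for p using bad_of_decoded[of p u s v] d nb by blast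
  then show ?thesis using d by blast
next
  case False
  then obtain N where no: "\<And>n. n < N \<Longrightarrow> u (n - 1) = u n \<or> u (n + 1) \<noteq> u n" by blast
  show ?thesis
  proof (cases "\<exists>m<N. u (m + 1) = u m")
    case True
    then obtain m where m: "m < N" "u (m + 1) = u m" by blast
    have "u (i + 1) = u i" if "i \<le> m" for i using that
    proof (induction i rule: int_le_induct)
      case (step i)
      then show ?case using no[of i] m by auto
    qed (use m in simp)
    note * = this
    have "u (i - 2) = u i" if "i \<le> m" for i using *[of "i - 2"] *[of "i - 1"] that by simp
    then show ?thesis by blast
  next
    case False
    then have alt: "u (i + 1) \<noteq> u i" if "i < N" for i using that by blast
    have "u (i - 2) = u i" if "i \<le> N" for i using alt[of "i - 2"] alt[of "i - 1"] that by auto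
    then show ?thesis by blast
  qed
qed

lemma left_tail_without_bad:
  assumes "\<forall>p. \<not> bad u p"
  shows "\<exists>M. (\<exists>P>0. (\<lambda>i. u (M - int i)) \<in> periodic_tails P) \<or> (\<lambda>i. u (M - int i)) \<in> range (theta ^^ k)"
  using assms
proof (induction k arbitrary: u)
  case 0
  then show ?case by auto
next
  case (Suc k)
  from decode_left[OF Suc.prems] show ?case
  proof (elim disjE exE conjE)
    fix M assume per: "\<forall>i\<le>M. u (i - 2) = u i"
    have "u (M - int (i + 2)) = u (M - int i)" for i
      using per[rule_format, of "M - int i"] by (simp add: algebra_simps)
    then have "(\<lambda>i. u (M - int i)) \<in> periodic_tails 2" by (simp add: periodic_tails_def)
    then show ?thesis by (intro exI[of _ M] conjI disjI1 exI[of _ 2]) simp_all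
  next
    fix s v assume v: "\<forall>p. \<not> bad v p"
      and d: "\<forall>j. u (s + 2 * j) = v j \<and> u (s + 2 * j + 1) = (\<not> v j)"
    have 2: "\<forall>p. \<not> bad v p"
      "\<And>j. u (s + 2 * j) = v j" "\<And>j. u (s + 2 * j + 1) = (\<not> v j)"
      using v d by blast+
    obtain M where alt: "(\<exists>P>0. (\<lambda>i. v (M - int i)) \<in> periodic_tails P) \<or>
      (\<lambda>i. v (M - int i)) \<in> range (theta ^^ k)" using Suc.IH[OF 2(1)] by blast
    \<comment> \<open>Read backwards, the pair of the letter \<open>v j\<close> is
      \<open>\<not> v j\<close>, \<open>v j\<close>, the image of the opposite letter.\<close>
    have th: "(\<lambda>i. u (s + 2 * M + 1 - int i)) = theta (\<lambda>i. \<not> v (M - int i))"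
    proof
      fix i
      show "u (s + 2 * M + 1 - int i) = theta (\<lambda>i. \<not> v (M - int i)) i"
      proof (cases "even i")
        case True
        then obtain j where "i = 2 * j" by blast
        then show ?thesis using 2(3)[of "M - int j"] by (simp add: theta_def algebra_simps)
      next
        case False
        then obtain j where "i = 2 * j + 1" by (auto elim: oddE)
        then show ?thesis using 2(2)[of "M - int j"] by (simp add: theta_def algebra_simps)
      qed
    qed
    from alt have "(\<exists>P>0. theta (\<lambda>i. \<not> v (M - int i)) \<in> periodic_tails P) \<or>
      theta (\<lambda>i. \<not> v (M - int i)) \<in> range (theta ^^ Suc k)"
    proof (elim disjE exE conjE)
      fix P :: nat assume P: "0 < P" "(\<lambda>i. v (M - int i)) \<in> periodic_tails P"
      then have "theta (\<lambda>i. \<not> v (M - int i)) \<in> periodic_tails (2 * P)"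
        by (intro theta_periodic)
      then show ?thesis using P by (intro disjI1 exI[of _ "2 * P"] conjI) simp_all
    next
      assume "(\<lambda>i. v (M - int i)) \<in> range (theta ^^ k)"
      then obtain w where w: "(\<lambda>i. v (M - int i)) = (theta ^^ k) w" by blast
      have "(\<lambda>i. \<not> v (M - int i)) = (theta ^^ k) (\<lambda>i. \<not> w i)"
        unfolding theta_compl using fun_cong[OF w] by simp
      then show ?thesis by (intro disjI2) auto
    qed
    then show ?thesis unfolding th[symmetric] by (intro exI[of _ "s + 2 * M + 1"])
  qed
qed


section \<open>Null sets of Hausdorff measures\<close>

lemma hausdorff_measure_eq_0_iff:
  "hausdorff_measure s A = 0 \<longleftrightarrow> (\<forall>\<delta>>0. hausdorff_premeasure s \<delta> A = 0)"
  by (auto simp: hausdorff_measure_def SUP_eq_iff bot_ennreal[symmetric])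

lemma hausdorff_premeasure_mono:
  "A \<subseteq> B \<Longrightarrow> hausdorff_premeasure s \<delta> A \<le> hausdorff_premeasure s \<delta> B"
  unfolding hausdorff_premeasure_def by (rule INF_superset_mono) auto

text \<open>Covers of weight below \<open>\<epsilon> / 2 ^ (j + 1)\<close> are merged into one
  sequence by the pairing function.\<close>

lemma hausdorff_premeasure_Union_eq_0:
  fixes A :: "nat \<Rightarrow> 'a::metric_space set"
  assumes "\<And>j. hausdorff_premeasure s \<delta> (A j) = 0"
  shows "hausdorff_premeasure s \<delta> (\<Union>j. A j) = 0"
proof -
  have "hausdorff_premeasure s \<delta> (\<Union>j. A j) \<le> 0 + ennreal \<epsilon>" if \<epsilon>: "0 < \<epsilon>" for \<epsilon>
  proof -
    let ?C = "\<lambda>A. {U :: nat \<Rightarrow> 'a set. A \<subseteq> (\<Union>i. U i) \<and> (\<forall>i. bounded (U i) \<and> diameter (U i) \<le> \<delta>)}"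
    have "\<exists>U\<in>?C (A j). (\<Sum>i. diam_pow s (U i)) < ennreal (\<epsilon> * (1/2) ^ Suc j)" for j
    proof -
      have "(INF U\<in>?C (A j). \<Sum>i. diam_pow s (U i)) < ennreal (\<epsilon> * (1/2) ^ Suc j)"
        using assms[of j] \<epsilon> unfolding hausdorff_premeasure_def by (simp add: ennreal_zero_less_mult_iff)
      then show ?thesis by (simp only: INF_less_iff)
    qed
    then have "\<forall>j. \<exists>U. U \<in> ?C (A j) \<and> (\<Sum>i. diam_pow s (U i)) < ennreal (\<epsilon> * (1/2) ^ Suc j)"
      unfolding Bex_def by (rule allI)
    from choice[OF this] obtain U where U: "\<And>j. U j \<in> ?C (A j)"
      "\<And>j. (\<Sum>i. diam_pow s (U j i)) < ennreal (\<epsilon> * (1/2) ^ Suc j)" by blast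
    define V where "V n = (case prod_decode n of (j, i) \<Rightarrow> U j i)" for n
    have "V \<in> ?C (\<Union>j. A j)"
    proof (intro CollectI conjI allI)
      show "(\<Union>j. A j) \<subseteq> (\<Union>n. V n)"
      proof
        fix x assume "x \<in> (\<Union>j. A j)"
        then obtain j where "x \<in> A j" by blast
        then obtain i where "x \<in> U j i" using U(1)[of j] by blast
        then have "x \<in> V (prod_encode (j, i))" by (simp add: V_def)
        then show "x \<in> (\<Union>n. V n)" by blast
      qed
      show "bounded (V n)" "diameter (V n) \<le> \<delta>" for n
        using U(1) by (auto simp: V_def split: prod.splits)
    qed
    then have "hausdorff_premeasure s \<delta> (\<Union>j. A j) \<le> (\<Sum>n. diam_pow s (V n))"
      unfolding hausdorff_premeasure_def by (rule INF_lower)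
    also have "\<dots> = (\<Sum>n. (\<lambda>(j, i). diam_pow s (U j i)) (prod_decode n))"
      by (intro suminf_cong) (simp add: V_def split: prod.splits)
    also have "\<dots> = (\<Sum>j. \<Sum>i. diam_pow s (U j i))"
      by (rule suminf_ennreal_2dimen) simp
    also have "\<dots> \<le> (\<Sum>j. ennreal (\<epsilon> * (1/2) ^ Suc j))"
      using U(2) by (intro suminf_le summableI less_imp_le)
    also have "\<dots> = ennreal \<epsilon>"
      using sums_mult[OF power_half_series, of \<epsilon>] \<epsilon> by (intro suminf_ennreal_eq) auto
    finally show ?thesis by simp
  qed
  then have "hausdorff_premeasure s \<delta> (\<Union>j. A j) \<le> 0" by (rule ennreal_le_epsilon)
  then show ?thesis by simp
qed

lemma hausdorff_measure_countable_Union_eq_0: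
  fixes A :: "'i \<Rightarrow> 'a::metric_space set"
  assumes "countable I" "\<And>i. i \<in> I \<Longrightarrow> hausdorff_measure s (A i) = 0"
  shows "hausdorff_measure s (\<Union>i\<in>I. A i) = 0"
  unfolding hausdorff_measure_eq_0_iff
proof (intro allI impI)
  fix \<delta> :: real assume \<delta>: "0 < \<delta>"
  show "hausdorff_premeasure s \<delta> (\<Union>i\<in>I. A i) = 0"
  proof (cases "I = {}")
    case True
    have "hausdorff_premeasure s \<delta> ({} :: 'a set) \<le> (\<Sum>i::nat. diam_pow s ({} :: 'a set))"
      unfolding hausdorff_premeasure_def
      by (rule INF_lower2[of "\<lambda>_. {}"]) (use \<delta> in \<open>auto simp: diameter_def\<close>)
    then show ?thesis using True by (simp add: diam_pow_def)
  next
    case False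
    have "hausdorff_premeasure s \<delta> (\<Union>j. A (from_nat_into I j)) = 0"
      using assms(2) from_nat_into[OF False] \<delta>
      by (intro hausdorff_premeasure_Union_eq_0) (auto simp: hausdorff_measure_eq_0_iff)
    moreover have "(\<Union>j. A (from_nat_into I j)) = (\<Union>i\<in>I. A i)"
      using range_from_nat_into[OF False assms(1)] by (metis image_image)
    ultimately show ?thesis by simp
  qed
qed

lemma hausdorff_premeasure_finite_cover:
  fixes A :: "'a::metric_space set"
  assumes "finite I" "A \<subseteq> (\<Union>i\<in>I. V i)" "\<And>i. i \<in> I \<Longrightarrow> bounded (V i) \<and> diameter (V i) \<le> d"
    and "0 \<le> d" "d \<le> \<delta>" "0 < s"
  shows "hausdorff_premeasure s \<delta> A \<le> ennreal (real (card I) * d powr s)"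
proof -
  obtain h where h: "bij_betw h {..<card I} I"
    using ex_bij_betw_nat_finite[OF assms(1)] by (auto simp: lessThan_atLeast0)
  define U where "U i = (if i < card I then V (h i) else {})" for i
  have hI: "h i \<in> I" if "i < card I" for i using h that by (auto simp: bij_betw_def)
  have "(\<Union>i\<in>I. V i) \<subseteq> (\<Union>i. U i)"
  proof
    fix x assume "x \<in> (\<Union>i\<in>I. V i)"
    then obtain i where "i \<in> I" "x \<in> V i" by blast
    moreover obtain n where "n < card I" "i = h n" using h \<open>i \<in> I\<close> by (auto simp: bij_betw_def)
    ultimately have "x \<in> U n" by (simp add: U_def)
    then show "x \<in> (\<Union>i. U i)" by blast
  qed
  with assms(2) have "A \<subseteq> (\<Union>i. U i)" by (rule order_trans)
  moreover have "bounded (U i)" "diameter (U i) \<le> \<delta>" for i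
  proof -
    show "bounded (U i)" using assms(3) hI by (auto simp: U_def)
    show "diameter (U i) \<le> \<delta>"
    proof (cases "i < card I")
      case True
      then show ?thesis using assms(3)[OF hI[OF True]] assms(5) by (simp add: U_def)
    qed (use assms(4,5) in \<open>simp add: U_def\<close>)
  qed
  ultimately have "hausdorff_premeasure s \<delta> A \<le> (\<Sum>i. diam_pow s (U i))"
    unfolding hausdorff_premeasure_def by (intro INF_lower) auto
  also have "\<dots> = (\<Sum>i<card I. diam_pow s (U i))"
    by (rule suminf_finite) (auto simp: U_def diam_pow_def)
  also have "\<dots> \<le> (\<Sum>i<card I. ennreal (d powr s))"
  proof (rule sum_mono)
    fix i assume "i \<in> {..<card I}"
    then have "h i \<in> I" using hI by simp
    then have "diameter (V (h i)) powr s \<le> d powr s"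
      using assms(3,6) diameter_ge_0 by (intro powr_mono2) auto
    then show "diam_pow s (U i) \<le> ennreal (d powr s)"
      using \<open>i \<in> {..<card I}\<close> assms(6) by (auto simp: U_def diam_pow_def intro: ennreal_leI)
  qed
  also have "\<dots> = ennreal (real (card I) * d powr s)"
    by (simp add: ennreal_mult ennreal_of_nat_eq_real_of_nat)
  finally show ?thesis .
qed

text \<open>The cost of the n-th cover is at most a constant times
  \<open>(b / 2 powr s) ^ n\<close>, which tends to 0.\<close>

lemma hausdorff_measure_eq_0_of_covers:
  fixes A :: "'a::metric_space set"
  assumes cover: "\<And>n. finite (I n) \<and> A \<subseteq> (\<Union>i\<in>I n. V n i)"
    and small: "\<And>n i. i \<in> I n \<Longrightarrow> bounded (V n i) \<and> diameter (V n i) \<le> 2 * (1/2) ^ n"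
    and card: "\<And>n. real (card (I n)) \<le> C * b ^ n" and b: "0 < b" "b < 2 powr s" and s: "0 < s"
  shows "hausdorff_measure s A = 0"
  unfolding hausdorff_measure_eq_0_iff
proof (intro allI impI)
  fix \<delta> :: real assume \<delta>: "0 < \<delta>"
  define q where "q = b / 2 powr s"
  have q: "0 < q" "q < 1" using b by (auto simp: q_def)
  have lim: "(\<lambda>n. C * 2 powr s * q ^ n) \<longlonglongrightarrow> C * 2 powr s * 0"
    using q by (intro tendsto_mult tendsto_const LIMSEQ_realpow_zero) auto
  have lim2: "(\<lambda>n. 2 * (1/2) ^ n :: real) \<longlonglongrightarrow> 2 * 0"
    by (intro tendsto_mult tendsto_const LIMSEQ_realpow_zero) auto
  have bound: "hausdorff_premeasure s \<delta> A \<le> ennreal (C * 2 powr s * q ^ n)"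
    if "2 * (1/2) ^ n \<le> \<delta>" for n
  proof -
    have "hausdorff_premeasure s \<delta> A \<le> ennreal (real (card (I n)) * (2 * (1/2) ^ n) powr s)"
      using cover[of n] small[of _ n] that s
      by (intro hausdorff_premeasure_finite_cover[where V = "V n"]) auto
    also have "(2 * (1/2) ^ n) powr s = 2 powr s * (1 / 2 powr s) ^ n"
      by (induction n) (simp_all add: powr_mult powr_divide)
    also have "ennreal (real (card (I n)) * (2 powr s * (1 / 2 powr s) ^ n)) \<le>
        ennreal (C * b ^ n * (2 powr s * (1 / 2 powr s) ^ n))"
      using card[of n] by (intro ennreal_leI mult_right_mono) auto
    also have "C * b ^ n * (2 powr s * (1 / 2 powr s) ^ n) = C * 2 powr s * q ^ n"
      by (simp add: q_def power_divide)
    finally show ?thesis .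
  qed
  have "hausdorff_premeasure s \<delta> A \<le> 0 + ennreal \<epsilon>" if "0 < \<epsilon>" for \<epsilon>
  proof -
    have "eventually (\<lambda>n. C * 2 powr s * q ^ n < \<epsilon> \<and> 2 * (1/2) ^ n < \<delta>) sequentially"
      using order_tendstoD(2)[OF lim, of \<epsilon>] order_tendstoD(2)[OF lim2, of \<delta>] that \<delta>
      by (auto intro: eventually_conj)
    then obtain n where "C * 2 powr s * q ^ n < \<epsilon>" "2 * (1/2) ^ n < \<delta>"
      by (auto dest!: eventually_happens)
    then show ?thesis using bound[of n] by (metis add_0 ennreal_leI less_imp_le order_trans)
  qed
  then have "hausdorff_premeasure s \<delta> A \<le> 0" by (rule ennreal_le_epsilon)
  then show "hausdorff_premeasure s \<delta> A = 0" by simp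
qed


section \<open>The survivor set of the hexagon\<close>

definition bin_val :: "(nat \<Rightarrow> bool) \<Rightarrow> real" where
  "bin_val f = (\<Sum>n. real (of_bool (f n)) / 2 ^ (n + 1))"

lemma summable_bin_val: "summable (\<lambda>n. real (of_bool (f n)) / 2 ^ (n + 1))"
  by (rule summable_digits) simp

lemma bin_val_split: "bin_val f = (of_bool (f 0) + bin_val (\<lambda>n. f (Suc n))) / 2"
  using digits_sum_split[of "\<lambda>n. of_bool (f n)"] by (simp add: bin_val_def)

lemma bin_val_nonneg: "0 \<le> bin_val f"
  unfolding bin_val_def by (intro suminf_nonneg summable_bin_val) simp

lemma bin_val_compl: "bin_val (\<lambda>n. \<not> f n) = 1 - bin_val f"
proof -
  have "(\<lambda>n. 1 / 2 ^ (n + 1) :: real) sums 1"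
    using power_half_series by (simp add: power_divide)
  moreover have "(\<lambda>n. real (of_bool (f n)) / 2 ^ (n + 1) + real (of_bool (\<not> f n)) / 2 ^ (n + 1)) sums
    (bin_val f + bin_val (\<lambda>n. \<not> f n))"
    unfolding bin_val_def by (intro sums_add summable_sums summable_bin_val)
  moreover have "(\<lambda>n. real (of_bool (f n)) / 2 ^ (n + 1) + real (of_bool (\<not> f n)) / 2 ^ (n + 1)) =
    (\<lambda>n. 1 / 2 ^ (n + 1))" by auto
  ultimately show ?thesis by (simp add: sums_iff)
qed

lemma bin_val_le_1: "bin_val f \<le> 1"
  using bin_val_nonneg[of "\<lambda>n. \<not> f n"] by (simp add: bin_val_compl)

lemma bin_val_eq_0: "bin_val f = 0 \<Longrightarrow> \<not> f n"
proof (induction n arbitrary: f)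
  case 0
  then show ?case using bin_val_split[of f] bin_val_nonneg[of "\<lambda>n. f (Suc n)"] by (auto simp: of_bool_def split: if_splits)
next
  case (Suc n)
  have "bin_val (\<lambda>n. f (Suc n)) = 0"
    using bin_val_split[of f] bin_val_nonneg[of "\<lambda>n. f (Suc n)"] Suc.prems by (auto simp: of_bool_def split: if_splits)
  then show ?case by (rule Suc.IH)
qed

lemma bin_val_eq_1: "bin_val f = 1 \<Longrightarrow> f n"
  using bin_val_eq_0[of "\<lambda>n. \<not> f n" n] by (simp add: bin_val_compl)

lemma bin_val_diff:
  assumes "\<And>i. i < j \<Longrightarrow> f i = g i"
  shows "bin_val f - bin_val g = (bin_val (\<lambda>n. f (n + j)) - bin_val (\<lambda>n. g (n + j))) / 2 ^ j"
  using assms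
proof (induction j arbitrary: f g)
  case (Suc j)
  have IH: "bin_val (\<lambda>n. f (Suc n)) - bin_val (\<lambda>n. g (Suc n)) =
    (bin_val (\<lambda>n. f (Suc (n + j))) - bin_val (\<lambda>n. g (Suc (n + j)))) / 2 ^ j"
    using Suc.IH[of "\<lambda>n. f (Suc n)" "\<lambda>n. g (Suc n)"] Suc.prems by simp
  have "bin_val f - bin_val g = (bin_val (\<lambda>n. f (Suc n)) - bin_val (\<lambda>n. g (Suc n))) / 2"
    using bin_val_split[of f] bin_val_split[of g] Suc.prems[of 0] by (simp add: diff_divide_distrib)
  then show ?case unfolding IH by (simp add: mult.commute)
qed simp

lemma bin_val_close:
  assumes "\<And>i. i < n \<Longrightarrow> f i = g i"
  shows "\<bar>bin_val f - bin_val g\<bar> \<le> (1/2) ^ n"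
proof -
  have "\<bar>bin_val (\<lambda>k. f (k + n)) - bin_val (\<lambda>k. g (k + n))\<bar> \<le> 1"
    using bin_val_nonneg[of "\<lambda>k. f (k + n)"] bin_val_le_1[of "\<lambda>k. f (k + n)"]
      bin_val_nonneg[of "\<lambda>k. g (k + n)"] bin_val_le_1[of "\<lambda>k. g (k + n)"] by linarith
  moreover have "bin_val f - bin_val g = (bin_val (\<lambda>k. f (k + n)) - bin_val (\<lambda>k. g (k + n))) / 2 ^ n"
    by (rule bin_val_diff) (rule assms)
  ultimately show ?thesis by (simp add: power_divide divide_right_mono)
qed

text \<open>The exception consists of the two expansions, ending in 1000... and 0111..., of a dyadic
  number.\<close>

lemma bin_val_lex_gt:
  assumes "lex_gt f g"
  shows "bin_val g < bin_val f \<or> (\<exists>j. (\<forall>n>j. \<not> f n) \<and> (\<forall>n>j. g n))"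
proof -
  obtain j where j: "\<And>i. i < j \<Longrightarrow> f i = g i" "f j" "\<not> g j" using assms by (auto simp: lex_gt_def)
  let ?f = "\<lambda>n. f (Suc n + j)" and ?g = "\<lambda>n. g (Suc n + j)"
  have d: "bin_val f - bin_val g = (1 + bin_val ?f - bin_val ?g) / 2 / 2 ^ j"
  proof -
    have "bin_val (\<lambda>n. f (n + j)) - bin_val (\<lambda>n. g (n + j)) = (1 + bin_val ?f - bin_val ?g) / 2"
      using j(2,3) bin_val_split[of "\<lambda>n. f (n + j)"] bin_val_split[of "\<lambda>n. g (n + j)"] by simp
    moreover have "bin_val f - bin_val g = (bin_val (\<lambda>n. f (n + j)) - bin_val (\<lambda>n. g (n + j))) / 2 ^ j"
      by (rule bin_val_diff) (rule j(1))
    ultimately show ?thesis by (simp only:)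
  qed
  show ?thesis
  proof (cases "bin_val ?f = 0 \<and> bin_val ?g = 1")
    case True
    have "\<not> f n \<and> g n" if "j < n" for n
    proof -
      have "Suc (n - Suc j) + j = n" using that by simp
      then show ?thesis using bin_val_eq_0[of ?f "n - Suc j"] bin_val_eq_1[of ?g "n - Suc j"] True by metis
    qed
    then show ?thesis by blast
  next
    case False
    then have "0 < 1 + bin_val ?f - bin_val ?g"
      using bin_val_nonneg[of ?f] bin_val_le_1[of ?g] by linarith
    then have "0 < bin_val f - bin_val g" unfolding d by simp
    then show ?thesis by simp
  qed
qed

text \<open>\<open>tm (2 * j + 1)\<close> and \<open>tm (2 * j + 2)\<close> differ, so
  \<open>tm\<close> does not end in 1s and the exception cannot occur.\<close>

lemma bin_val_gt_tm:
  assumes "lex_gt f tm"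
  shows "bin_val tm < bin_val f"
proof -
  have "\<not> (\<forall>n>j. tm n)" for j
  proof
    assume a: "\<forall>n>j. tm n"
    then have "tm (2 * j + 1)" "tm (2 * j + 2)" by simp_all
    then show False using tm_rec(2,3)[of j] by simp
  qed
  then show ?thesis using bin_val_lex_gt[OF assms] by blast
qed

lemma thue_morse_const_eq: "thue_morse_const = bin_val tm / 2"
proof -
  have t: "thue_morse n = of_bool (thue_morse n = 1)" for n using thue_morse_le[of n] by auto
  have "thue_morse_const = bin_val (\<lambda>n. thue_morse n = 1)"
    unfolding thue_morse_const_def bin_val_def by (subst t) simp
  then show ?thesis using bin_val_split[of "\<lambda>n. thue_morse n = 1"]
    by (simp add: thue_morse_rec(1) tm_def[abs_def])
qed

section \<open>From the hexagon to dominated words\<close>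

definition bool_coding :: "(int \<Rightarrow> bool) \<Rightarrow> real \<times> real" where
  "bool_coding u = (bin_val (\<lambda>n. u (int n + 1)), bin_val (\<lambda>n. u (- int n)))"

lemma coding_eq_bool_coding:
  assumes "u \<in> bi_sequences"
  shows "coding u = bool_coding (\<lambda>n. u n = 1)"
proof -
  have "real (u n) = real (of_bool (u n = 1))" for n using assms by (auto simp: bi_sequences_def)
  then show ?thesis unfolding coding_def bool_coding_def bin_val_def by simp
qed

definition avoids :: "(int \<Rightarrow> bool) \<Rightarrow> bool" where
  "avoids u \<longleftrightarrow> (\<forall>n. bool_coding (\<lambda>k. u (k + n)) \<notin> hexagon)"

definition left_tail :: "(int \<Rightarrow> bool) \<Rightarrow> int \<Rightarrow> nat \<Rightarrow> bool" where
  "left_tail u a i = u (a - int i)"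

definition right_tail :: "(int \<Rightarrow> bool) \<Rightarrow> int \<Rightarrow> nat \<Rightarrow> bool" where
  "right_tail u a i = u (a + int i)"

lemma bin_val_rel:
  "bin_val (\<lambda>n. u n \<noteq> c) = (if c then 1 - bin_val u else bin_val u)"
  by (auto simp: bin_val_compl)

text \<open>Shifting by \<open>p - 1\<close> makes \<open>u p\<close> the first binary digit of x.
  The two slanted sides belonging to the other letter can fail only for \<open>X = 1\<close> with Y
  equal to 0 or 1, and then one of the alternatives holds anyway.\<close>

lemma avoids_bad:
  assumes av: "avoids u" and "bad u p"
  defines "X \<equiv> bin_val (rel_right u p)"
  shows "X \<le> bin_val (rel_left u p) \<or> X \<le> bin_val (rel_left u (p + 1))"
proof -
  define Y where "Y = bin_val (rel_left u p)"
  have X1: "X \<le> 1" and Y01: "0 \<le> Y" "Y \<le> 1" by (simp_all add: X_def Y_def bin_val_nonneg bin_val_le_1)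
  have gt: "bin_val tm < X" unfolding X_def using assms(2) by (intro bin_val_gt_tm) (simp add: bad_def)
  have r0: "rel_right u p 0" using assms(2) lex_gt_tm_cases by (auto simp: bad_def)
  define x where "x = bin_val (\<lambda>n. u (int n + 1 + (p - 1)))"
  define y where "y = bin_val (\<lambda>n. u (- int n + (p - 1)))"
  have "(x, y) \<notin> hexagon"
    using av[unfolded avoids_def, rule_format, of "p - 1"] by (simp add: bool_coding_def x_def y_def)
  moreover have "(x, y) \<in> unit_square"
    by (simp add: unit_square_def x_def y_def bin_val_nonneg bin_val_le_1)
  ultimately have nh: "\<not> (2 * x - 1 < y \<and> y < 2 * x \<and> 2 - 4 * x < y \<and> y < 3 - 4 * x \<and>
      bin_val tm / 2 < x \<and> x < 1 - bin_val tm / 2)"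
    by (simp add: hexagon_def thue_morse_const_eq)
  have x: "x = (of_bool (u p) + bin_val (\<lambda>n. u (p + 1 + int n))) / 2"
    using bin_val_split[of "\<lambda>n. u (int n + 1 + (p - 1))"] by (simp add: x_def add_ac)
  have X: "X = (if u p then 1 - bin_val (\<lambda>n. u (p + 1 + int n)) else bin_val (\<lambda>n. u (p + 1 + int n)))"
    unfolding X_def rel_right_def[abs_def] by (rule bin_val_rel)
  have "y = bin_val (\<lambda>n. u (p - 1 - int n))" by (simp add: y_def add_ac)
  then have Y: "Y = (if u p then 1 - y else y)"
    unfolding Y_def rel_left_def[abs_def] by (simp only: bin_val_rel)
  have cases: "X \<le> Y \<or> Y \<le> 2 - 2 * X"
  proof (cases "u p")
    case True
    have "x = 1 - X / 2" using x X True by (simp add: field_simps)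
    moreover have "y = 1 - Y" using Y True by simp
    ultimately show ?thesis using nh gt X1 Y01 by (auto simp: not_less)
  next
    case False
    then have "x = X / 2" "y = Y" using x X Y by simp_all
    then show ?thesis using nh gt X1 Y01 by (auto simp: not_less)
  qed
  \<comment> \<open>Seen from \<open>p + 1\<close>, whose letter differs from \<open>u p\<close>,
    the left word is 1 followed by the complement of the left word seen from \<open>p\<close>; its
    value is \<open>1 - Y / 2\<close>.\<close>
  have "rel_left u (p + 1) (Suc n) \<longleftrightarrow> \<not> rel_left u p n" for n
    using r0 by (auto simp: rel_left_def rel_right_def algebra_simps)
  then have "bin_val (\<lambda>n. rel_left u (p + 1) (Suc n)) = 1 - Y"
    unfolding Y_def by (simp add: bin_val_compl)
  moreover have "rel_left u (p + 1) 0" using r0 by (auto simp: rel_left_def rel_right_def)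
  ultimately have "bin_val (rel_left u (p + 1)) = (2 - Y) / 2"
    using bin_val_split[of "rel_left u (p + 1)"] by simp
  then show ?thesis using cases unfolding Y_def by auto
qed

text \<open>Values and lexicographic order disagree only for two expansions of a dyadic number. This
  would make both tails of \<open>u\<close> constant, which \<open>nc\<close> excludes; such words
  belong to the periodic families.\<close>

lemma avoids_left_dominated:
  assumes av: "avoids u"
    and nc: "\<not> ((\<exists>a. left_tail u a \<in> periodic_tails 1) \<and> (\<exists>b. right_tail u b \<in> periodic_tails 1))"
  shows "left_dominated u"
proof -
  have *: "\<not> lex_gt (rel_right u p) (rel_left u p')"
    if le: "bin_val (rel_right u p) \<le> bin_val (rel_left u p')" for p p'
  proof
    assume "lex_gt (rel_right u p) (rel_left u p')"
    from bin_val_lex_gt[OF this] le obtain j where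
      j: "\<And>n. j < n \<Longrightarrow> \<not> rel_right u p n" "\<And>n. j < n \<Longrightarrow> rel_left u p' n" by auto
    have r: "u (p + 2 + int j + int n) = u p" for n
      using j(1)[of "Suc j + n"] by (simp add: rel_right_def algebra_simps)
    have l: "u (p' - 2 - int j - int n) = (\<not> u p')" for n
      using j(2)[of "Suc j + n"] by (auto simp: rel_left_def algebra_simps)
    have "right_tail u (p + 2 + int j) \<in> periodic_tails 1"
      unfolding periodic_tails_def right_tail_def using r[of "n + 1" for n] r by auto
    moreover have "left_tail u (p' - 2 - int j) \<in> periodic_tails 1"
      unfolding periodic_tails_def left_tail_def using l[of "n + 1" for n] l by auto
    ultimately show False using nc by blast
  qed
  show ?thesis unfolding left_dominated_def using avoids_bad[OF av] * by blast
qed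

section \<open>Countably many families of tails cover the survivors\<close>

instance label :: countable
  by countable_datatype

definition tail_family :: "nat \<Rightarrow> nat \<Rightarrow> (nat \<Rightarrow> bool) set set" where
  "tail_family K k = range (cut_tails K) \<union> range (rev_cut_tails K) \<union> periodic_tails ` {0<..} \<union>
     {range (theta ^^ k)}"

lemma countable_tail_family: "countable (tail_family K k)"
  unfolding tail_family_def by (intro countable_Un countable_image countable_insert countable_empty countableI_type)

lemma slow_tail_family:
  fixes c :: real
  assumes "1 < c"
  shows "\<exists>K k. \<forall>X\<in>tail_family K k. slow c X"
proof -
  obtain K where K: "\<And>\<tau>. slow c (cut_tails K \<tau>) \<and> slow c (rev_cut_tails K \<tau>)"
    using slow_cut_tails[OF assms] by blast
  obtain n where n: "2 < c ^ n" using real_arch_pow[OF assms] by blast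
  have "c ^ n \<le> c ^ (2 ^ n)" using assms by (intro power_increasing) auto
  then have "2 \<le> c ^ (2 ^ n)" using n by linarith
  then have "slow c (range (theta ^^ n))" by (rule slow_theta[OF assms])
  then have "\<forall>X\<in>tail_family K n. slow c X"
    using K slow_periodic[OF assms] unfolding tail_family_def by auto
  then show ?thesis by blast
qed

text \<open>A single bad position anywhere settles the left tail, since its chain runs to the left.
  The right tail requires bad positions arbitrarily far to the right, so the two case distinctions
  differ.\<close>

lemma avoids_tails:
  assumes av: "avoids u"
  shows "(\<exists>a. \<exists>X\<in>tail_family K k. left_tail u a \<in> X) \<and> (\<exists>b. \<exists>Y\<in>tail_family K k. right_tail u b \<in> Y)"
proof (cases "(\<exists>a. left_tail u a \<in> periodic_tails 1) \<and> (\<exists>b. right_tail u b \<in> periodic_tails 1)")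
  case True
  have "periodic_tails 1 \<in> tail_family K k" by (auto simp: tail_family_def)
  then show ?thesis using True by blast
next
  case False
  have ld: "left_dominated u" by (rule avoids_left_dominated[OF av False])
  have fam: "periodic_tails P \<in> tail_family K k" if "0 < P" for P
    using that by (auto simp: tail_family_def)
  have fam': "range (theta ^^ k) \<in> tail_family K k" "cut_tails K \<tau> \<in> tail_family K k"
    "rev_cut_tails K \<tau> \<in> tail_family K k" for \<tau>
    by (auto simp: tail_family_def)
  have lt: "left_tail u a = (\<lambda>i. u (a - int i))" and rt: "right_tail u a = (\<lambda>i. u (a + int i))" for a
    by (auto simp: left_tail_def right_tail_def)
  have "\<exists>a. \<exists>X\<in>tail_family K k. left_tail u a \<in> X"
  proof (cases "\<forall>p. \<not> bad u p")
    case True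
    from left_tail_without_bad[OF this, of k] obtain M where
      "(\<exists>P>0. left_tail u M \<in> periodic_tails P) \<or> left_tail u M \<in> range (theta ^^ k)"
      unfolding lt by (elim exE)
    then show ?thesis
    proof (elim disjE exE conjE)
      fix P :: nat assume "0 < P" "left_tail u M \<in> periodic_tails P"
      then show ?thesis by (intro exI[of _ M] bexI[OF _ fam])
    next
      assume "left_tail u M \<in> range (theta ^^ k)"
      then show ?thesis by (intro exI[of _ M] bexI[OF _ fam'(1)])
    qed
  next
    case False
    then obtain p where "bad u p" by blast
    from left_tail_with_bad[OF ld this, of K] obtain \<tau> a where "left_tail u a \<in> rev_cut_tails K \<tau>"
      unfolding lt by (elim exE)
    then show ?thesis by (intro exI[of _ a] bexI[OF _ fam'(3)])
  qed
  moreover have "\<exists>b. \<exists>Y\<in>tail_family K k. right_tail u b \<in> Y"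
  proof (cases "\<forall>N. \<exists>p\<ge>N. bad u p")
    case True
    from right_tail_with_bad[OF ld this, of K] obtain \<tau> a where "right_tail u a \<in> cut_tails K \<tau>"
      unfolding rt by (elim exE)
    then show ?thesis by (intro exI[of _ a] bexI[OF _ fam'(2)])
  next
    case False
    then obtain N where "\<forall>p\<ge>N. \<not> bad u p" by blast
    from right_tail_without_bad[OF this, of k] obtain M where
      "(\<exists>P>0. right_tail u M \<in> periodic_tails P) \<or> right_tail u M \<in> range (theta ^^ k)"
      unfolding rt by (elim exE conjE)
    then show ?thesis
    proof (elim disjE exE conjE)
      fix P :: nat assume "0 < P" "right_tail u M \<in> periodic_tails P"
      then show ?thesis by (intro exI[of _ M] bexI[OF _ fam])
    next
      assume "right_tail u M \<in> range (theta ^^ k)"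
      then show ?thesis by (intro exI[of _ M] bexI[OF _ fam'(1)])
    qed
  qed
  ultimately show ?thesis by blast
qed

definition with_tails :: "int \<Rightarrow> int \<Rightarrow> (nat \<Rightarrow> bool) set \<Rightarrow> (nat \<Rightarrow> bool) set \<Rightarrow> (int \<Rightarrow> bool) set" where
  "with_tails a b X Y = {u. left_tail u a \<in> X \<and> right_tail u b \<in> Y}"

text \<open>The letters from -m to m are counted as free, at the cost of a constant factor, which
  removes any gap or overlap between the tails. Each of the two sides grows with rate
  \<open>c\<close>, hence the square.\<close>

lemma card_central_words:
  fixes c :: real
  assumes "1 < c" "slow c X" "slow c Y"
  shows "\<exists>C. \<forall>n. real (card ((\<lambda>u. word u (- int n) (2 * n + 1)) ` with_tails a b X Y)) \<le> C * (c\<^sup>2) ^ n"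
proof -
  obtain C1 where C1: "\<And>n. real (card (prefixes X n)) \<le> C1 * c ^ n" using assms(2) by (auto simp: slow_def)
  obtain C2 where C2: "\<And>n. real (card (prefixes Y n)) \<le> C2 * c ^ n" using assms(3) by (auto simp: slow_def)
  define m where "m = nat (max \<bar>a\<bar> \<bar>b\<bar>)"
  have m: "\<bar>a\<bar> \<le> int m" "\<bar>b\<bar> \<le> int m" by (auto simp: m_def)
  define C where "C = C1 * c ^ (m + 1) * (C2 * c ^ (m + 1)) * 2 ^ (2 * m + 1)"
  have "real (card ((\<lambda>u. word u (- int n) (2 * n + 1)) ` with_tails a b X Y)) \<le> C * (c\<^sup>2) ^ n" for n
  proof -
    let ?N = "n + m + 1"
    let ?M = "{xs :: bool list. length xs = 2 * m + 1}"
    define R where "R = (\<lambda>(xs, ys, zs). map (\<lambda>k. let i = int k - int n in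
      if \<bar>i\<bar> \<le> int m then zs ! nat (i + int m) else if 0 < i then ys ! nat (i - b)
      else (xs ! nat (a - i) :: bool)) [0..<2 * n + 1])"
    have "(\<lambda>u. word u (- int n) (2 * n + 1)) ` with_tails a b X Y \<subseteq> R ` (prefixes X ?N \<times> prefixes Y ?N \<times> ?M)"
    proof
      fix w assume "w \<in> (\<lambda>u. word u (- int n) (2 * n + 1)) ` with_tails a b X Y"
      then obtain u where u: "left_tail u a \<in> X" "right_tail u b \<in> Y" and w: "w = word u (- int n) (2 * n + 1)"
        by (auto simp: with_tails_def)
      let ?t = "(map (left_tail u a) [0..<?N], map (right_tail u b) [0..<?N], word u (- int m) (2 * m + 1))"
      have "w = R ?t"
        unfolding w
      proof (rule nth_equalityI)
        fix k assume "k < length (word u (- int n) (2 * n + 1))"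
        then have k: "k < 2 * n + 1" by simp
        define i where "i = int k - int n"
        have i: "\<bar>i\<bar> \<le> int n" using k by (auto simp: i_def)
        have z: "word u (- int m) (2 * m + 1) ! nat (i + int m) = u i" if "\<bar>i\<bar> \<le> int m"
        proof -
          have "nat (i + int m) < 2 * m + 1" "0 \<le> i + int m" using that by auto
          then show ?thesis using that by simp
        qed
        have y: "map (right_tail u b) [0..<?N] ! nat (i - b) = u i" if "\<not> \<bar>i\<bar> \<le> int m" "0 < i"
        proof -
          have "nat (i - b) < ?N" "0 \<le> i - b" using that i m by auto
          then show ?thesis by (simp add: right_tail_def del: upt_Suc)
        qed
        have x: "map (left_tail u a) [0..<?N] ! nat (a - i) = u i" if "\<not> \<bar>i\<bar> \<le> int m" "\<not> 0 < i"
        proof -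
          have "nat (a - i) < ?N" "0 \<le> a - i" using that i m by auto
          then show ?thesis by (simp add: left_tail_def del: upt_Suc)
        qed
        have "R ?t ! k = u i"
          unfolding R_def using k x y z by (simp add: Let_def i_def[symmetric] del: upt_Suc)
        moreover have "word u (- int n) (2 * n + 1) ! k = u i" using k by (simp add: i_def)
        ultimately show "word u (- int n) (2 * n + 1) ! k = R ?t ! k" by simp
      qed (simp add: R_def)
      moreover have "?t \<in> prefixes X ?N \<times> prefixes Y ?N \<times> ?M"
        using u by (auto simp: prefixes_def)
      ultimately show "w \<in> R ` (prefixes X ?N \<times> prefixes Y ?N \<times> ?M)" by blast
    qed
    then have "card ((\<lambda>u. word u (- int n) (2 * n + 1)) ` with_tails a b X Y) \<le> card (prefixes X ?N \<times> prefixes Y ?N \<times> ?M)"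
      by (intro surj_card_le) (auto simp: finite_prefixes finite_bool_lists)
    also have "\<dots> = card (prefixes X ?N) * (card (prefixes Y ?N) * 2 ^ (2 * m + 1))"
      by (simp only: card_cartesian_product card_bool_lists)
    finally have "real (card ((\<lambda>u. word u (- int n) (2 * n + 1)) ` with_tails a b X Y)) \<le>
      real (card (prefixes X ?N) * (card (prefixes Y ?N) * 2 ^ (2 * m + 1)))" by (rule of_nat_mono)
    also have "\<dots> = real (card (prefixes X ?N)) * (real (card (prefixes Y ?N)) * 2 ^ (2 * m + 1))" by simp
    also have "\<dots> \<le> (C1 * c ^ ?N) * ((C2 * c ^ ?N) * 2 ^ (2 * m + 1))"
      by (intro mult_mono mult_right_mono C1 C2 order_trans[OF of_nat_0_le_iff C1]) auto
    also have "\<dots> = C * (c\<^sup>2) ^ n"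
      by (simp add: C_def power_add power2_eq_square power_mult_distrib)
    finally show ?thesis .
  qed
  then show ?thesis by blast
qed

lemma bool_coding_close:
  assumes "word u (- int n) (2 * n + 1) = word v (- int n) (2 * n + 1)"
  shows "dist (bool_coding u) (bool_coding v) \<le> 2 * (1/2) ^ n"
proof -
  have uv: "u i = v i" if "\<bar>i\<bar> \<le> int n" for i
  proof -
    have "nat (i + int n) < 2 * n + 1" "- int n + int (nat (i + int n)) = i" using that by auto
    then show ?thesis using nth_word[of "nat (i + int n)" "2 * n + 1" _ "- int n"] assms by metis
  qed
  have "\<bar>bin_val (\<lambda>k. u (int k + 1)) - bin_val (\<lambda>k. v (int k + 1))\<bar> \<le> (1/2) ^ n"
    by (rule bin_val_close) (rule uv, simp)
  moreover have "\<bar>bin_val (\<lambda>k. u (- int k)) - bin_val (\<lambda>k. v (- int k))\<bar> \<le> (1/2) ^ n"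
    by (rule bin_val_close) (rule uv, simp)
  ultimately show ?thesis
    unfolding bool_coding_def dist_Pair_Pair dist_real_def
    by (intro order_trans[OF sqrt_sum_squares_le_sum_abs]) auto
qed

lemma hausdorff_measure_with_tails:
  fixes s :: real
  assumes s: "0 < s" and "slow (2 powr (s / 4)) X" "slow (2 powr (s / 4)) Y"
  shows "hausdorff_measure s (bool_coding ` with_tails a b X Y) = 0"
proof -
  \<comment> \<open>The rate of the central words is the square of this,
    \<open>2 powr (s / 2)\<close>, safely below \<open>2 powr s\<close>.\<close>
  define c where "c = 2 powr (s / 4)"
  have c: "1 < c" using s by (simp add: c_def)
  have "c\<^sup>2 = 2 powr (s / 2)" by (simp add: c_def power2_eq_square powr_add[symmetric])
  then have c2: "c\<^sup>2 < 2 powr s" using s by simp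
  let ?w = "\<lambda>n u. word u (- int n) (2 * n + 1)"
  let ?E = "with_tails a b X Y"
  obtain C where C: "\<And>n. real (card (?w n ` ?E)) \<le> C * (c\<^sup>2) ^ n"
    using card_central_words[OF c] assms(2,3) unfolding c_def by blast
  define V where "V n x = bool_coding ` {u \<in> ?E. ?w n u = x}" for n x
  show ?thesis
  proof (rule hausdorff_measure_eq_0_of_covers[where I = "\<lambda>n. ?w n ` ?E" and V = V and C = C and b = "c\<^sup>2"])
    show "finite (?w n ` ?E) \<and> bool_coding ` ?E \<subseteq> (\<Union>i\<in>?w n ` ?E. V n i)" for n
      by (auto simp: V_def intro!: finite_subset[OF _ finite_bool_lists[of "2 * n + 1"]])
    show "bounded (V n i) \<and> diameter (V n i) \<le> 2 * (1/2) ^ n" if "i \<in> ?w n ` ?E" for n i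
    proof -
      have d: "dist x y \<le> 2 * (1/2) ^ n" if "x \<in> V n i" "y \<in> V n i" for x y
        using that bool_coding_close unfolding V_def by auto
      have "V n i \<noteq> {}" using that by (auto simp: V_def)
      then have "diameter (V n i) \<le> 2 * (1/2) ^ n"
        by (intro diameter_le) (auto simp: d dist_norm[symmetric])
      moreover have "bounded (V n i)" using d unfolding bounded_def by blast
      ultimately show ?thesis by simp
    qed
    show "0 < c\<^sup>2" using c by simp
  qed (use C c2 s in auto)
qed

lemma avoids_of_survivor:
  assumes "u \<in> bi_sequences" "\<forall>n. coding (shift n u) \<notin> hexagon"
  shows "avoids (\<lambda>k. u k = 1)"
  unfolding avoids_def
proof
  fix n
  have "shift n u \<in> bi_sequences" using assms(1) by (auto simp: bi_sequences_def shift_def)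
  then have "coding (shift n u) = bool_coding (\<lambda>k. u (k + n) = 1)"
    by (simp add: coding_eq_bool_coding shift_def)
  then show "bool_coding (\<lambda>k. u (k + n) = 1) \<notin> hexagon" using assms(2) by metis
qed

lemma hausdorff_measure_mono_0:
  assumes "A \<subseteq> B" "hausdorff_measure s B = 0"
  shows "hausdorff_measure s A = 0"
proof -
  have "hausdorff_premeasure s \<delta> A \<le> 0" if "0 < \<delta>" for \<delta>
    using hausdorff_premeasure_mono[OF assms(1), of s \<delta>] assms(2) that
    by (simp add: hausdorff_measure_eq_0_iff)
  then show ?thesis by (simp add: hausdorff_measure_eq_0_iff)
qed

lemma hausdorff_measure_survivors:
  assumes s: "0 < s"
  shows "hausdorff_measure s (survivor_set hexagon) = 0"
proof -
  have "1 < 2 powr (s / 4)" using s by simp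
  then obtain K k where slow: "\<And>X. X \<in> tail_family K k \<Longrightarrow> slow (2 powr (s / 4)) X"
    using slow_tail_family by blast
  let ?I = "(UNIV :: int set) \<times> (UNIV :: int set) \<times> tail_family K k \<times> tail_family K k"
  let ?A = "\<lambda>(a, b, X, Y). bool_coding ` with_tails a b X Y"
  have "hausdorff_measure s (\<Union>i\<in>?I. ?A i) = 0"
  proof (rule hausdorff_measure_countable_Union_eq_0)
    show "countable ?I" by (intro countable_SIGMA countable_tail_family countableI_type)
    show "hausdorff_measure s (?A i) = 0" if "i \<in> ?I" for i
      using that s slow by (auto intro: hausdorff_measure_with_tails)
  qed
  moreover have "survivor_set hexagon \<subseteq> (\<Union>i\<in>?I. ?A i)"
  proof
    fix z assume "z \<in> survivor_set hexagon"
    then obtain u where u: "u \<in> bi_sequences" "\<forall>n. coding (shift n u) \<notin> hexagon" and z: "z = coding u"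
      by (auto simp: survivor_set_def)
    let ?v = "\<lambda>k. u k = 1"
    obtain a b X Y where "X \<in> tail_family K k" "Y \<in> tail_family K k" "left_tail ?v a \<in> X" "right_tail ?v b \<in> Y"
      using avoids_tails[OF avoids_of_survivor[OF u], of K k] by blast
    then have "z \<in> ?A (a, b, X, Y)" "(a, b, X, Y) \<in> ?I"
      using z coding_eq_bool_coding[OF u(1)] by (auto simp: with_tails_def)
    then show "z \<in> (\<Union>i\<in>?I. ?A i)" by (rule UN_I[rotated])
  qed
  ultimately show ?thesis by (rule hausdorff_measure_mono_0[rotated])
qed

lemma openin_hexagon: "openin (top_of_set unit_square) hexagon"
proof -
  let ?H = "{z :: real \<times> real. 2 * fst z - 1 < snd z \<and> snd z < 2 * fst z \<and> 2 - 4 * fst z < snd z \<and>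
    snd z < 3 - 4 * fst z \<and> thue_morse_const < fst z \<and> fst z < 1 - thue_morse_const}"
  have "open ?H"
    by (intro open_Collect_conj open_Collect_less continuous_intros)
  moreover have "hexagon = unit_square \<inter> ?H" by (auto simp: hexagon_def)
  ultimately show ?thesis by (auto simp: openin_open)
qed

theorem theorem4p10:
  shows "dimension_trap hexagon"
proof -
  have "hausdorff_dim (survivor_set hexagon) \<le> 0 + ennreal \<epsilon>" if "0 < \<epsilon>" for \<epsilon>
    unfolding hausdorff_dim_def
    by (rule INF_lower2[of \<epsilon>]) (use that hausdorff_measure_survivors in auto)
  then have "hausdorff_dim (survivor_set hexagon) \<le> 0" by (rule ennreal_le_epsilon)
  then show ?thesis using openin_hexagon by (simp add: dimension_trap_def)
qed

end
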